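(* Suppose $p>2$ is a prime. Let $F$ be a field which either contains a primitive $p$th root of unity or has characteristic $p$, and let $E/F$ be a cyclic extension of degree $p$. Then $T_{E/F}$ contains precisely one maximal closed subgroup which is elementary abelian.
   Context: For a cyclic field extension $E/F$ of degree $p$, $T_{E/F}:=G_F/G_E^p[G_E,G_E]$, where $G_F$, $G_E$ are the absolute Galois groups and $G_E^p[G_E,G_E]$ is the closed subgroup of $G_E$ generated by $p$th powers and commutators. "Elementary abelian" means abelian of exponent dividing $p$. *)

theory Defs
  imports
    "HOL-Analysis.Analysis"
    "HOL-Algebra.Algebraic_Closure_Type"
    "HOL-Algebra.Generated_Groups"
    "HOL-Algebra.Coset"
    "HOL-Algebra.Bij"
    "HOL-Algebra.Elementary_Groups"
begin

text \<open>
  The base field \<open>F\<close> is a type \<open>'a\<close> of class \<open>field\<close>, identified with its image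
  \<open>range to_ac\<close> in the algebraic closure \<open>'a alg_closure\<close>. All extensions of \<open>F\<close> are
  subfields of \<open>'a alg_closure\<close>, i.e. subfields of the ring \<open>ring_of_type_algebra\<close> at that type.
\<close>

definition base_field :: "'a::field alg_closure set"
  where "base_field = range to_ac"

text \<open>
  An element is separable over \<open>F\<close> if its minimal polynomial has only simple roots in the
  algebraic closure. The polynomial below is the minimal polynomial up to a unit.
\<close>

definition sep_closure :: "'a::field alg_closure set"
  where "sep_closure = {x. \<exists>f :: 'a poly. Factorial_Ring.irreducible f \<and>
           poly (map_poly to_ac f) x = 0 \<and> rsquarefree (map_poly to_ac f)}"


text \<open>
  As in \<^const>\<open>BijGroup\<close>, automorphisms of \<open>L\<close> are extensional functions, and the
  multiplication is composition.
\<close>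

definition galois_group :: "'b::field set \<Rightarrow> 'b set \<Rightarrow> ('b \<Rightarrow> 'b) monoid"
  where "galois_group L K = (BijGroup L)\<lparr>carrier :=
           {\<sigma> \<in> Bij L. (\<forall>x\<in>L. \<forall>y\<in>L. \<sigma> (x + y) = \<sigma> x + \<sigma> y \<and> \<sigma> (x * y) = \<sigma> x * \<sigma> y) \<and>
                       (\<forall>x\<in>K. \<sigma> x = x)}\<rparr>"

definition cyclic_extension :: "nat \<Rightarrow> 'b::field set \<Rightarrow> 'b set \<Rightarrow> bool"
  where "cyclic_extension n L K \<longleftrightarrow>
           subfield K ring_of_type_algebra \<and> subfield L ring_of_type_algebra \<and> K \<subseteq> L \<and>
           ring.dimension ring_of_type_algebra n K L \<and>
           {x\<in>L. \<forall>\<sigma>\<in>carrier (galois_group L K). \<sigma> x = x} = K \<and>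
           cyclic_group (galois_group L K)"

text \<open>
  The Krull topology on \<open>Gal(L/K)\<close>: the cosets of the subgroups \<open>Gal(L/M)\<close>, with
  \<open>M/K\<close> finite, form a basis.
\<close>

definition krull_topology :: "'b::field set \<Rightarrow> 'b set \<Rightarrow> ('b \<Rightarrow> 'b) topology"
  where "krull_topology L K = topology_generated_by
           {\<sigma> <#\<^bsub>galois_group L K\<^esub> carrier (galois_group L M) | \<sigma> M.
              \<sigma> \<in> carrier (galois_group L K) \<and> subfield M ring_of_type_algebra \<and>
              K \<subseteq> M \<and> M \<subseteq> L \<and> ring.finite_dimension ring_of_type_algebra K M}"

text \<open>
  For an algebraic extension \<open>K\<close> of \<open>F\<close> inside \<open>sep_closure\<close>, the set \<open>sep_closure\<close> is also a
  separable closure of \<open>K\<close>, so that the following is the absolute Galois group of \<open>K\<close>.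
\<close>

definition abs_galois_group ::
    "'a::field alg_closure set \<Rightarrow> ('a alg_closure \<Rightarrow> 'a alg_closure) monoid"
  where "abs_galois_group K = galois_group sep_closure K"

definition abs_galois_topology ::
    "'a::field alg_closure set \<Rightarrow> ('a alg_closure \<Rightarrow> 'a alg_closure) topology"
  where "abs_galois_topology K = krull_topology sep_closure K"


definition closed_subgroup_generated :: "('g, 'm) monoid_scheme \<Rightarrow> 'g topology \<Rightarrow> 'g set \<Rightarrow> 'g set"
  where "closed_subgroup_generated G \<tau> S = \<Inter>{H. subgroup H G \<and> closedin \<tau> H \<and> S \<subseteq> H}"

definition power_commutator_subgroup :: "nat \<Rightarrow> ('g, 'm) monoid_scheme \<Rightarrow> 'g topology \<Rightarrow> 'g set"
  where "power_commutator_subgroup p G \<tau> = closed_subgroup_generated G \<tau>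
           ({g [^]\<^bsub>G\<^esub> p | g. g \<in> carrier G} \<union> derived_set G (carrier G))"

definition maximal_closed_subgroup :: "('g, 'm) monoid_scheme \<Rightarrow> 'g topology \<Rightarrow> 'g set \<Rightarrow> bool"
  where "maximal_closed_subgroup G \<tau> M \<longleftrightarrow>
           subgroup M G \<and> closedin \<tau> M \<and> M \<noteq> carrier G \<and>
           (\<forall>H. subgroup H G \<and> closedin \<tau> H \<and> M \<subseteq> H \<longrightarrow> H = M \<or> H = carrier G)"

definition elementary_abelian :: "nat \<Rightarrow> ('g, 'm) monoid_scheme \<Rightarrow> bool"
  where "elementary_abelian p G \<longleftrightarrow> comm_group G \<and> (\<forall>x\<in>carrier G. x [^]\<^bsub>G\<^esub> p = \<one>\<^bsub>G\<^esub>)"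

definition quotient_topology :: "'g topology \<Rightarrow> ('g \<Rightarrow> 'h) \<Rightarrow> 'h topology"
  where "quotient_topology \<tau> f =
           topology (\<lambda>V. V \<subseteq> f ` topspace \<tau> \<and> openin \<tau> {x \<in> topspace \<tau>. f x \<in> V})"

lemma openin_quotient_topology:
  "openin (quotient_topology \<tau> f) V \<longleftrightarrow>
     V \<subseteq> f ` topspace \<tau> \<and> openin \<tau> {x \<in> topspace \<tau>. f x \<in> V}"
proof -
  let ?P = "\<lambda>V. V \<subseteq> f ` topspace \<tau> \<and> openin \<tau> {x \<in> topspace \<tau>. f x \<in> V}"
  have 1: "?P (A \<inter> B)" if "?P A" "?P B" for A B
  proof -
    have "{x \<in> topspace \<tau>. f x \<in> A \<inter> B} =
            {x \<in> topspace \<tau>. f x \<in> A} \<inter> {x \<in> topspace \<tau>. f x \<in> B}"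
      by auto
    with that show ?thesis by auto
  qed
  have 2: "?P (\<Union>\<A>)" if "\<forall>A\<in>\<A>. ?P A" for \<A>
  proof -
    have "{x \<in> topspace \<tau>. f x \<in> \<Union>\<A>} = (\<Union>A\<in>\<A>. {x \<in> topspace \<tau>. f x \<in> A})"
      by auto
    moreover have "openin \<tau> (\<Union>A\<in>\<A>. {x \<in> topspace \<tau>. f x \<in> A})"
      using that by blast
    ultimately show ?thesis using that by auto
  qed
  have "istopology ?P"
    unfolding istopology_def using 1 2 by blast
  then show ?thesis
    by (simp add: quotient_topology_def topology_inverse')
qed

lemma topspace_quotient_topology: "topspace (quotient_topology \<tau> f) = f ` topspace \<tau>"
proof -
  have "{x \<in> topspace \<tau>. f x \<in> f ` topspace \<tau>} = topspace \<tau>" by auto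
  then have "openin (quotient_topology \<tau> f) (f ` topspace \<tau>)"
    by (simp add: openin_quotient_topology)
  then show ?thesis
    by (metis openin_quotient_topology openin_subset openin_topspace subset_antisym)
qed

lemma quotient_map_quotient_topology: "quotient_map \<tau> (quotient_topology \<tau> f) f"
  by (auto simp: quotient_map_def topspace_quotient_topology openin_quotient_topology)


text \<open>The group \<open>T\<^bsub>E/F\<^esub> = G\<^sub>F / G\<^sub>E\<^sup>p[G\<^sub>E, G\<^sub>E]\<close> with the quotient topology.\<close>

definition T_kernel :: "nat \<Rightarrow> 'a::field alg_closure set \<Rightarrow> ('a alg_closure \<Rightarrow> 'a alg_closure) set"
  where "T_kernel p E = power_commutator_subgroup p (abs_galois_group E) (abs_galois_topology E)"

definition T_group ::
    "nat \<Rightarrow> 'a::field alg_closure set \<Rightarrow> ('a alg_closure \<Rightarrow> 'a alg_closure) set monoid"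
  where "T_group p E = abs_galois_group base_field Mod T_kernel p E"

definition T_topology ::
    "nat \<Rightarrow> 'a::field alg_closure set \<Rightarrow> ('a alg_closure \<Rightarrow> 'a alg_closure) set topology"
  where "T_topology p E = quotient_topology (abs_galois_topology base_field)
           (\<lambda>\<sigma>. T_kernel p E #>\<^bsub>abs_galois_group base_field\<^esub> \<sigma>)"

end

theory Submission
  imports Defs
begin

text \<open>
  Write \<open>F\<close> for the base field, \<open>G\<^sub>F\<close> and \<open>G\<^sub>E\<close> for the Galois groups of the separable closure
  over \<open>F\<close> and over \<open>E\<close>, and \<open>N\<close> for the closed subgroup of \<open>G\<^sub>E\<close> generated by the \<open>p\<close>-th powers
  and the commutators, so that \<open>T = G\<^sub>F/N\<close>. The subgroup in question is \<open>G\<^sub>E/N\<close>.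

  It is elementary abelian because \<open>N\<close> contains the \<open>p\<close>-th powers and the commutators. It is
  closed because the automorphisms that move a given element of \<open>E\<close> form an open set. It is maximal
  because the degree is prime: by \<open>restriction_power\<close>, the powers of one \<open>h \<in> G\<^sub>F\<close> that moves
  something in \<open>E\<close> induce on \<open>E\<close> everything that \<open>G\<^sub>F\<close> induces there, so \<open>h\<close> and \<open>G\<^sub>E\<close> generate
  \<open>G\<^sub>F\<close>. It is proper because a nontrivial automorphism of \<open>E\<close> extends to the separable closure.

  For the uniqueness it suffices that every elementary abelian subgroup of \<open>T\<close> lies in \<open>G\<^sub>E/N\<close>, which
  says that an element \<open>\<tau>\<close> of \<open>G\<^sub>F\<close> with \<open>\<tau>\<^sup>p \<in> N\<close> belongs to \<open>G\<^sub>E\<close>. Suppose that it does not. Since \<open>\<tau>\<^sup>p\<close>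
  is trivial on \<open>E\<close>, the automorphism \<open>\<tau>\<close> has order \<open>p\<close> there.

  Let \<open>F\<close> contain a primitive \<open>p\<close>-th root of unity \<open>\<zeta>\<close>. By the independence of characters there is
  an \<open>\<alpha> \<noteq> 0\<close> in \<open>E\<close> with \<open>\<tau> \<alpha> = \<zeta>\<^sup>-\<^sup>1 \<alpha>\<close>. Let \<open>\<beta>\<^sup>p = \<alpha>\<close>. Elements of \<open>G\<^sub>E\<close> multiply \<open>\<beta>\<close> by roots of unity, so
  that \<open>N\<close> fixes \<open>\<beta>\<close>, and in particular \<open>\<tau>\<^sup>p \<beta> = \<beta>\<close>. Then \<open>\<gamma> = \<beta> \<cdot> \<tau> \<beta> \<cdots> \<tau>\<^sup>p\<^sup>-\<^sup>1 \<beta>\<close> is fixed by \<open>\<tau>\<close>. On the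
  other hand \<open>\<gamma>\<^sup>p = \<alpha> \<cdot> \<tau> \<alpha> \<cdots> \<tau>\<^sup>p\<^sup>-\<^sup>1 \<alpha>\<close> is \<open>\<alpha>\<^sup>p\<close> divided by \<open>\<zeta>\<close> to the power \<open>0 + 1 + \<dots> + (p - 1)\<close>, a
  multiple of \<open>p\<close> as \<open>p\<close> is odd. Hence \<open>\<gamma>\<close> is \<open>\<alpha>\<close> times a root of unity and \<open>\<tau> \<gamma> = \<zeta>\<^sup>-\<^sup>1 \<gamma> \<noteq> \<gamma>\<close>, a
  contradiction. In characteristic \<open>p\<close> the same argument runs additively, with \<open>x\<^sup>p - x\<close> in place of
  \<open>x\<^sup>p\<close>, an element \<open>\<theta>\<close> with \<open>\<tau> \<theta> = \<theta> + 1\<close> in place of \<open>\<alpha>\<close>, and traces in place of products. These are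
  \<open>no_lift_of_prime_order_kummer\<close> and \<open>no_lift_of_prime_order_artin_schreier\<close>.

  The field theory behind this is developed for subfields of the algebraic closure given as sets: the
  separable elements form a field (\<open>subfield_set_sep_closure\<close>), homomorphisms extend to the
  algebraic closure (\<open>extend_hom_to_alg_closure\<close>), and the open sets of the Krull topology are
  described by agreement on finite sets (\<open>openin_krull_topology_iff\<close>).
\<close>

section \<open>Subfields as sets\<close>

text \<open>
  Stated with the operations of the type class, so that simplification applies to them; zero, sums and
  negatives follow from \<open>1\<close> and differences.
\<close>
definition subfield_set :: "'b::field set \<Rightarrow> bool"
  where "subfield_set K \<longleftrightarrow> 1 \<in> K \<and> (\<forall>x\<in>K. \<forall>y\<in>K. x - y \<in> K \<and> x * y \<in> K) \<and>
           (\<forall>x\<in>K. inverse x \<in> K)"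

lemma subfield_setI:
  assumes "1 \<in> K" "\<And>x y. x \<in> K \<Longrightarrow> y \<in> K \<Longrightarrow> x - y \<in> K"
    "\<And>x y. x \<in> K \<Longrightarrow> y \<in> K \<Longrightarrow> x * y \<in> K" "\<And>x. x \<in> K \<Longrightarrow> inverse x \<in> K"
  shows "subfield_set K"
  using assms by (simp add: subfield_set_def)

context
  fixes K :: "'b::field set"
  assumes K: "subfield_set K"
begin

lemma subfield_set_one: "1 \<in> K"
  and subfield_set_diff: "x \<in> K \<Longrightarrow> y \<in> K \<Longrightarrow> x - y \<in> K"
  and subfield_set_mult: "x \<in> K \<Longrightarrow> y \<in> K \<Longrightarrow> x * y \<in> K"
  and subfield_set_inverse: "x \<in> K \<Longrightarrow> inverse x \<in> K"
  using K by (auto simp: subfield_set_def)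

lemma subfield_set_zero: "0 \<in> K"
  using subfield_set_diff[OF subfield_set_one subfield_set_one] by simp

lemma subfield_set_uminus: "x \<in> K \<Longrightarrow> - x \<in> K"
  using subfield_set_diff[OF subfield_set_zero] by simp

lemma subfield_set_add: "x \<in> K \<Longrightarrow> y \<in> K \<Longrightarrow> x + y \<in> K"
  using subfield_set_diff[OF _ subfield_set_uminus, of x y] by simp

lemma subfield_set_divide: "x \<in> K \<Longrightarrow> y \<in> K \<Longrightarrow> x / y \<in> K"
  using subfield_set_mult[OF _ subfield_set_inverse, of x y] by (simp add: divide_inverse)

lemma subfield_set_sum: "(\<And>i. i \<in> I \<Longrightarrow> f i \<in> K) \<Longrightarrow> sum f I \<in> K"
  by (induction I rule: infinite_finite_induct) (auto simp: subfield_set_zero subfield_set_add)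

lemma subfield_set_prod: "(\<And>i. i \<in> I \<Longrightarrow> f i \<in> K) \<Longrightarrow> prod f I \<in> K"
  by (induction I rule: infinite_finite_induct) (auto simp: subfield_set_one subfield_set_mult)

lemma subfield_set_power: "x \<in> K \<Longrightarrow> x ^ n \<in> K"
  by (induction n) (auto simp: subfield_set_one subfield_set_mult)

lemma subfield_set_of_nat: "of_nat n \<in> K"
  by (induction n) (auto simp: subfield_set_zero subfield_set_one subfield_set_add)

end

lemmas subfield_set_closed =
  subfield_set_one subfield_set_zero subfield_set_diff subfield_set_mult subfield_set_inverse
  subfield_set_uminus subfield_set_add subfield_set_divide subfield_set_sum subfield_set_prod
  subfield_set_power subfield_set_of_nat

lemma field_ring_of_type_algebra: "field (ring_of_type_algebra :: 'b::field ring)"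
  by (rule field_from_type_algebra)

lemma ring_of_type_algebra_simps:
  "carrier (ring_of_type_algebra :: 'b::field ring) = UNIV"
  "mult (ring_of_type_algebra :: 'b::field ring) = (*)"
  "one (ring_of_type_algebra :: 'b::field ring) = 1"
  "ring.zero (ring_of_type_algebra :: 'b::field ring) = 0"
  "add (ring_of_type_algebra :: 'b::field ring) = (+)"
  by (auto simp: ring_of_type_algebra_def fun_eq_iff)

lemma a_inv_ring_of_type_algebra:
  "a_inv (ring_of_type_algebra :: 'b::field ring) x = - x"
proof -
  interpret field "ring_of_type_algebra :: 'b ring" by (rule field_ring_of_type_algebra)
  show ?thesis
    using minus_equality[of "-x" x] by (simp add: ring_of_type_algebra_simps)
qed

lemma m_inv_ring_of_type_algebra:
  assumes "x \<noteq> 0"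
  shows "m_inv (ring_of_type_algebra :: 'b::field ring) x = inverse x"
proof -
  interpret field "ring_of_type_algebra :: 'b ring" by (rule field_ring_of_type_algebra)
  show ?thesis
    by (rule comm_inv_char) (use assms in \<open>simp_all add: ring_of_type_algebra_simps\<close>)
qed

lemma subfield_ring_of_type_algebra_iff:
  "subfield K (ring_of_type_algebra :: 'b::field ring) \<longleftrightarrow> subfield_set K"
proof -
  interpret field "ring_of_type_algebra :: 'b ring" by (rule field_ring_of_type_algebra)
  show ?thesis
  proof
    assume sub: "subfield K (ring_of_type_algebra :: 'b ring)"
    note subr = subringE[OF subfieldE(1)[OF sub], unfolded ring_of_type_algebra_simps
        a_inv_ring_of_type_algebra]
    show "subfield_set K"
    proof (rule subfield_setI)
      show "x - y \<in> K" if "x \<in> K" "y \<in> K" for x y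
        using subr(7)[OF that(1) subr(5)[OF that(2)]] by simp
      show "inverse x \<in> K" if "x \<in> K" for x
      proof (cases "x = 0")
        case False
        then show ?thesis
          using subfield_m_inv(1)[OF sub, of x] that m_inv_ring_of_type_algebra[of x]
          by (simp add: ring_of_type_algebra_simps)
      qed (use subr(2) in simp)
    qed (use subr in auto)
  next
    assume K: "subfield_set K"
    show "subfield K (ring_of_type_algebra :: 'b ring)"
    proof (rule subfieldI')
      show "subring K (ring_of_type_algebra :: 'b ring)"
        by (rule subringI)
          (auto simp: ring_of_type_algebra_simps a_inv_ring_of_type_algebra subfield_set_closed[OF K])
      show "m_inv ring_of_type_algebra k \<in> K" if "k \<in> K - {ring.zero (ring_of_type_algebra :: 'b ring)}" for k
        using that m_inv_ring_of_type_algebra[of k] subfield_set_inverse[OF K]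
        by (auto simp: ring_of_type_algebra_simps)
    qed
  qed
qed

section \<open>Polynomials and homomorphisms over a subfield\<close>

definition polys_over :: "'b::field set \<Rightarrow> 'b poly set"
  where "polys_over K = {P. \<forall>i. Polynomial.coeff P i \<in> K}"

context
  fixes K :: "'b::field set"
  assumes K: "subfield_set K"
begin

lemma polys_over_const: "c \<in> K \<Longrightarrow> [:c:] \<in> polys_over K"
  by (auto simp: polys_over_def coeff_pCons subfield_set_closed[OF K] split: nat.splits)

lemma polys_over_pCons: "c \<in> K \<Longrightarrow> P \<in> polys_over K \<Longrightarrow> pCons c P \<in> polys_over K"
  by (auto simp: polys_over_def coeff_pCons subfield_set_closed[OF K] split: nat.splits)

lemma polys_over_0: "0 \<in> polys_over K"
  by (auto simp: polys_over_def subfield_set_closed[OF K])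

lemma polys_over_1: "1 \<in> polys_over K"
  by (auto simp: polys_over_def coeff_1 subfield_set_closed[OF K])

lemma polys_over_monom: "c \<in> K \<Longrightarrow> Polynomial.monom c n \<in> polys_over K"
  by (auto simp: polys_over_def subfield_set_closed[OF K])

lemma polys_over_add: "P \<in> polys_over K \<Longrightarrow> Q \<in> polys_over K \<Longrightarrow> P + Q \<in> polys_over K"
  by (auto simp: polys_over_def subfield_set_closed[OF K])

lemma polys_over_diff: "P \<in> polys_over K \<Longrightarrow> Q \<in> polys_over K \<Longrightarrow> P - Q \<in> polys_over K"
  by (auto simp: polys_over_def subfield_set_closed[OF K])

lemma polys_over_mult: "P \<in> polys_over K \<Longrightarrow> Q \<in> polys_over K \<Longrightarrow> P * Q \<in> polys_over K"
  by (auto simp: polys_over_def coeff_mult intro!: subfield_set_closed[OF K])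

lemma polys_over_pderiv: "P \<in> polys_over K \<Longrightarrow> pderiv P \<in> polys_over K"
  unfolding polys_over_def coeff_pderiv mem_Collect_eq
  by (intro allI subfield_set_mult[OF K] subfield_set_of_nat[OF K]) (erule spec)

lemma polys_over_prod: "(\<And>i. i \<in> I \<Longrightarrow> f i \<in> polys_over K) \<Longrightarrow> prod f I \<in> polys_over K"
  by (induction I rule: infinite_finite_induct)
    (auto simp: polys_over_mult polys_over_1)

lemma polys_over_pcompose:
  assumes "P \<in> polys_over K" "Q \<in> polys_over K"
  shows "pcompose P Q \<in> polys_over K"
  using assms(1)
proof (induction P)
  case (pCons a P)
  have a: "a \<in> K" "P \<in> polys_over K"
    using pCons.prems
    unfolding polys_over_def mem_Collect_eq by (metis coeff_pCons_0, metis coeff_pCons_Suc)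
  then show ?case
    using pCons.IH assms(2) by (simp add: pcompose_pCons polys_over_add polys_over_mult polys_over_const)
qed (simp add: polys_over_0)

end

lemma polys_over_mono: "K \<subseteq> L \<Longrightarrow> polys_over K \<subseteq> polys_over L"
  by (auto simp: polys_over_def)

text \<open>
  A homomorphism defined on the subfield \<open>K\<close> only; its values elsewhere are arbitrary. The condition
  at \<open>1\<close> excludes the zero map.
\<close>
definition hom_on :: "'b::field set \<Rightarrow> ('b \<Rightarrow> 'b) \<Rightarrow> bool"
  where "hom_on K \<phi> \<longleftrightarrow> \<phi> 1 = 1 \<and>
           (\<forall>x\<in>K. \<forall>y\<in>K. \<phi> (x + y) = \<phi> x + \<phi> y \<and> \<phi> (x * y) = \<phi> x * \<phi> y)"

context
  fixes K :: "'b::field set" and \<phi> :: "'b \<Rightarrow> 'b"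
  assumes K: "subfield_set K" and hom: "hom_on K \<phi>"
begin

lemma hom_on_one: "\<phi> 1 = 1"
  and hom_on_add: "x \<in> K \<Longrightarrow> y \<in> K \<Longrightarrow> \<phi> (x + y) = \<phi> x + \<phi> y"
  and hom_on_mult: "x \<in> K \<Longrightarrow> y \<in> K \<Longrightarrow> \<phi> (x * y) = \<phi> x * \<phi> y"
  using hom by (auto simp: hom_on_def)

lemma hom_on_zero: "\<phi> 0 = 0"
proof -
  have "\<phi> (0 + 0) = \<phi> 0 + \<phi> 0"
    by (rule hom_on_add) (rule subfield_set_zero[OF K])+
  then show ?thesis
    by (simp only: add_0_left add_cancel_right_right)
qed

lemma hom_on_uminus: "x \<in> K \<Longrightarrow> \<phi> (- x) = - \<phi> x"
  using hom_on_add[of x "- x"] subfield_set_uminus[OF K, of x] hom_on_zero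
  by (simp add: minus_unique)

lemma hom_on_diff: "x \<in> K \<Longrightarrow> y \<in> K \<Longrightarrow> \<phi> (x - y) = \<phi> x - \<phi> y"
  using hom_on_add[of x "- y"] subfield_set_uminus[OF K, of y] hom_on_uminus[of y] by simp

lemma hom_on_inverse: "x \<in> K \<Longrightarrow> \<phi> (inverse x) = inverse (\<phi> x)"
proof (cases "x = 0")
  case False
  assume "x \<in> K"
  then have "\<phi> x * \<phi> (inverse x) = 1"
    using hom_on_mult[of x "inverse x"] subfield_set_inverse[OF K, of x] hom_on_one False by simp
  then show ?thesis
    by (metis inverse_unique)
qed (simp add: hom_on_zero)

lemma hom_on_eq_0_iff: "x \<in> K \<Longrightarrow> \<phi> x = 0 \<longleftrightarrow> x = 0"
proof (cases "x = 0")
  case False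
  assume "x \<in> K"
  then have "\<phi> x * \<phi> (inverse x) = 1"
    using hom_on_mult[of x "inverse x"] subfield_set_inverse[OF K, of x] hom_on_one False by simp
  then show ?thesis
    using False by auto
qed (simp add: hom_on_zero)

lemma hom_on_inj: "inj_on \<phi> K"
proof (rule inj_onI)
  fix x y assume xy: "x \<in> K" "y \<in> K" "\<phi> x = \<phi> y"
  then have "\<phi> (x - y) = 0"
    by (simp add: hom_on_diff)
  then show "x = y"
    using hom_on_eq_0_iff[of "x - y"] subfield_set_diff[OF K] xy by simp
qed

lemma hom_on_sum: "(\<And>i. i \<in> I \<Longrightarrow> f i \<in> K) \<Longrightarrow> \<phi> (sum f I) = (\<Sum>i\<in>I. \<phi> (f i))"
  by (induction I rule: infinite_finite_induct)
    (auto simp: hom_on_zero hom_on_add subfield_set_sum[OF K])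

lemma hom_on_prod: "(\<And>i. i \<in> I \<Longrightarrow> f i \<in> K) \<Longrightarrow> \<phi> (prod f I) = (\<Prod>i\<in>I. \<phi> (f i))"
  by (induction I rule: infinite_finite_induct)
    (auto simp: hom_on_one hom_on_mult subfield_set_prod[OF K])

lemma hom_on_power: "x \<in> K \<Longrightarrow> \<phi> (x ^ n) = \<phi> x ^ n"
  by (induction n) (auto simp: hom_on_one hom_on_mult subfield_set_power[OF K])

lemma coeff_map_poly_hom: "Polynomial.coeff (map_poly \<phi> P) i = \<phi> (Polynomial.coeff P i)"
  by (simp add: coeff_map_poly hom_on_zero)

lemma map_poly_hom_diff:
  "P \<in> polys_over K \<Longrightarrow> Q \<in> polys_over K \<Longrightarrow> map_poly \<phi> (P - Q) = map_poly \<phi> P - map_poly \<phi> Q"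
  by (intro poly_eqI) (auto simp: coeff_map_poly_hom hom_on_diff polys_over_def)

lemma map_poly_hom_mult:
  "P \<in> polys_over K \<Longrightarrow> Q \<in> polys_over K \<Longrightarrow> map_poly \<phi> (P * Q) = map_poly \<phi> P * map_poly \<phi> Q"
  by (intro poly_eqI)
    (auto simp: coeff_map_poly_hom coeff_mult hom_on_sum hom_on_mult polys_over_def
      subfield_set_mult[OF K])

lemma map_poly_hom_prod:
  "(\<And>i. i \<in> I \<Longrightarrow> f i \<in> polys_over K) \<Longrightarrow> map_poly \<phi> (prod f I) = (\<Prod>i\<in>I. map_poly \<phi> (f i))"
  by (induction I rule: infinite_finite_induct)
    (auto simp: hom_on_one map_poly_hom_mult polys_over_prod[OF K])

lemma poly_map_poly_hom:
  assumes "P \<in> polys_over K" "x \<in> K"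
  shows "poly (map_poly \<phi> P) (\<phi> x) = \<phi> (poly P x)"
proof -
  have "Polynomial.degree (map_poly \<phi> P) = Polynomial.degree P"
    using assms(1) hom_on_eq_0_iff[of "Polynomial.lead_coeff P"]
    by (cases "P = 0") (auto simp: polys_over_def intro!: map_poly_degree_eq)
  then show ?thesis
    using assms
    by (simp add: poly_altdef coeff_map_poly_hom polys_over_def hom_on_sum hom_on_mult hom_on_power
        subfield_set_closed[OF K])
qed

end

text \<open>
  Long division by a monic polynomial does not leave the coefficient field. The type class version
  would only give a quotient with coefficients in the whole field.
\<close>
lemma polys_over_division:
  assumes K: "subfield_set K" and P: "P \<in> polys_over K" "Polynomial.lead_coeff P = 1"
    and Q: "Q \<in> polys_over K"
  shows "\<exists>A\<in>polys_over K. \<exists>R\<in>polys_over K. Q = P * A + R \<and>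
           (R = 0 \<or> Polynomial.degree R < Polynomial.degree P)"
  using Q
proof (induction "Polynomial.degree Q" arbitrary: Q rule: less_induct)
  case less
  show ?case
  proof (cases "Q = 0 \<or> Polynomial.degree Q < Polynomial.degree P")
    case True
    then show ?thesis
      using less.prems by (intro bexI[of _ 0] bexI[of _ Q]) (auto simp: polys_over_0[OF K])
  next
    case False
    define M where "M = Polynomial.monom (Polynomial.lead_coeff Q) (Polynomial.degree Q - Polynomial.degree P)"
    have M: "M \<in> polys_over K"
      using less.prems by (auto simp: M_def polys_over_def intro!: polys_over_monom[OF K, unfolded polys_over_def] subfield_set_zero[OF K])
    have M0: "M \<noteq> 0" "Polynomial.degree M = Polynomial.degree Q - Polynomial.degree P"
      "Polynomial.lead_coeff M = Polynomial.lead_coeff Q"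
      using False by (auto simp: M_def Polynomial.degree_monom_eq)
    have P0: "P \<noteq> 0" using P(2) by auto
    define Q' where "Q' = Q - P * M"
    have Q': "Q' \<in> polys_over K"
      unfolding Q'_def using less.prems P M by (intro polys_over_diff[OF K] polys_over_mult[OF K])
    have dPM: "Polynomial.degree (P * M) = Polynomial.degree Q"
      using M0 P0 False by (simp add: Polynomial.degree_mult_eq)
    have lPM: "Polynomial.lead_coeff (P * M) = Polynomial.lead_coeff Q"
      using P(2) M0 by (simp add: Polynomial.lead_coeff_mult)
    have dQ': "Q' = 0 \<or> Polynomial.degree Q' < Polynomial.degree Q"
    proof (cases "Q' = 0")
      case False
      have "Polynomial.degree Q' \<le> Polynomial.degree Q"
        unfolding Q'_def using dPM by (metis Polynomial.degree_diff_le order_refl)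
      moreover have "Polynomial.coeff Q' (Polynomial.degree Q) = 0"
        using lPM dPM by (simp add: Q'_def)
      ultimately show ?thesis
        using False by (metis Polynomial.leading_coeff_0_iff le_neq_implies_less)
    qed simp
    show ?thesis
    proof (cases "Q' = 0")
      case True
      then show ?thesis
        using M by (intro bexI[of _ M] bexI[of _ 0]) (auto simp: Q'_def polys_over_0[OF K])
    next
      case False
      with dQ' less.hyps[OF _ Q'] obtain A R where AR: "A \<in> polys_over K" "R \<in> polys_over K"
        "Q' = P * A + R" "R = 0 \<or> Polynomial.degree R < Polynomial.degree P"
        by blast
      have "Q = P * (A + M) + R"
        using AR(3) by (simp add: Q'_def algebra_simps)
      then show ?thesis
        using AR M polys_over_add[OF K] by blast
    qed
  qed
qed

text \<open>
  A monic annihilating polynomial of least degree works: the remainder of any other annihilating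
  polynomial has smaller degree, hence vanishes. The quotient is again over \<open>K\<close>, which makes the
  divisibility survive the application of a homomorphism that is defined on \<open>K\<close> only.
\<close>
lemma minimal_polynomial_over:
  assumes K: "subfield_set K" and f: "f \<in> polys_over K" "f \<noteq> 0" "poly f u = 0"
  obtains P where "P \<in> polys_over K" "Polynomial.lead_coeff P = 1" "poly P u = 0"
    "\<And>Q. Q \<in> polys_over K \<Longrightarrow> poly Q u = 0 \<Longrightarrow> \<exists>A\<in>polys_over K. Q = P * A"
proof -
  let ?S = "\<lambda>P. P \<in> polys_over K \<and> P \<noteq> 0 \<and> poly P u = 0"
  obtain P0 where P0: "?S P0" and min: "\<And>Q. ?S Q \<Longrightarrow> Polynomial.degree P0 \<le> Polynomial.degree Q"
    using ex_has_least_nat[of ?S f Polynomial.degree] f by blast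
  define P where "P = Polynomial.smult (inverse (Polynomial.lead_coeff P0)) P0"
  have P: "P \<in> polys_over K" "Polynomial.lead_coeff P = 1" "poly P u = 0"
    "Polynomial.degree P = Polynomial.degree P0"
    using P0 by (auto simp: P_def polys_over_def intro!: subfield_set_closed[OF K])
  show ?thesis
  proof (rule that[OF P(1-3)])
    fix Q assume Q: "Q \<in> polys_over K" "poly Q u = 0"
    obtain A R where AR: "A \<in> polys_over K" "R \<in> polys_over K" "Q = P * A + R"
      "R = 0 \<or> Polynomial.degree R < Polynomial.degree P"
      using polys_over_division[OF K P(1,2) Q(1)] by blast
    have "poly R u = 0"
      using AR(3) Q(2) P(3) by simp
    then have "R = 0"
      using min[of R] AR P(4) by fastforce
    then show "\<exists>A\<in>polys_over K. Q = P * A"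
      using AR by auto
  qed
qed

section \<open>Minimal polynomials and separable elements\<close>

abbreviation ac_poly :: "'a::field poly \<Rightarrow> 'a alg_closure poly"
  where "ac_poly \<equiv> map_poly to_ac"

lemma ac_poly_add: "ac_poly (f + g) = ac_poly f + ac_poly g"
  by (intro poly_eqI) (simp add: coeff_map_poly)

lemma ac_poly_diff: "ac_poly (f - g) = ac_poly f - ac_poly g"
  by (intro poly_eqI) (simp add: coeff_map_poly)

lemma ac_poly_mult: "ac_poly (f * g) = ac_poly f * ac_poly g"
  by (intro poly_eqI) (simp add: coeff_map_poly coeff_mult to_ac_sum)

lemma ac_poly_pderiv: "ac_poly (pderiv f) = pderiv (ac_poly f)"
  by (intro poly_eqI) (simp add: coeff_map_poly coeff_pderiv del: of_nat_Suc)

lemma ac_poly_pcompose: "ac_poly (pcompose f g) = pcompose (ac_poly f) (ac_poly g)"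
  by (induction f) (simp_all add: pcompose_pCons ac_poly_add ac_poly_mult map_poly_pCons)

lemma ac_poly_eq_0_iff: "ac_poly f = 0 \<longleftrightarrow> f = 0"
  by (simp add: map_poly_eq_0_iff)

lemma degree_ac_poly: "Polynomial.degree (ac_poly f) = Polynomial.degree f"
  by (rule degree_map_poly) simp

lemma subfield_set_base_field: "subfield_set (base_field :: 'a::field alg_closure set)"
proof (rule subfield_setI)
  show "1 \<in> (base_field :: 'a alg_closure set)"
    by (metis base_field_def rangeI to_ac_1)
  fix x y :: "'a alg_closure"
  assume x: "x \<in> base_field"
  then obtain a where a: "x = to_ac a" by (auto simp: base_field_def)
  show "inverse x \<in> base_field"
    by (simp add: a base_field_def flip: to_ac_inverse)
  assume "y \<in> base_field"
  then obtain b where b: "y = to_ac b" by (auto simp: base_field_def)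
  show "x - y \<in> base_field" "x * y \<in> base_field"
    by (simp_all add: a b base_field_def flip: to_ac_diff to_ac_mult)
qed

lemma polys_over_base_field: "polys_over (base_field :: 'a::field alg_closure set) = range ac_poly"
proof (intro equalityI subsetI)
  fix P :: "'a alg_closure poly" assume "P \<in> polys_over base_field"
  then have "ac_poly (map_poly of_ac P) = P"
    by (intro poly_eqI) (auto simp: coeff_map_poly polys_over_def base_field_def to_ac_of_ac)
  then show "P \<in> range ac_poly" by (metis rangeI)
qed (auto simp: polys_over_def base_field_def coeff_map_poly)

lemma algebraic_over_base_field:
  fixes x :: "'a::field alg_closure"
  obtains f where "f \<in> polys_over base_field" "f \<noteq> 0" "poly f x = 0"
proof -
  obtain f where f: "f \<noteq> 0" "poly (ac_poly f) x = 0"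
    by (rule alg_closure_algebraic)
  have "ac_poly f \<in> polys_over base_field"
    unfolding polys_over_base_field by (rule rangeI)
  moreover have "ac_poly f \<noteq> 0"
    using f(1) by (simp only: ac_poly_eq_0_iff not_False_eq_True)
  ultimately show ?thesis
    using f(2) that by blast
qed

text \<open>
  The previous construction over \<open>F\<close> itself, pulled back to polynomials over the type \<open>'a\<close>, where
  irreducibility makes sense.
\<close>
lemma minimal_polynomial_ac:
  fixes x :: "'a::field alg_closure"
  obtains g :: "'a poly" where "Factorial_Ring.irreducible g" "poly (ac_poly g) x = 0"
    "\<And>h. poly (ac_poly h) x = 0 \<Longrightarrow> g dvd h"
proof -
  obtain f where f: "f \<in> polys_over base_field" "f \<noteq> 0" "poly f x = 0"
    by (rule algebraic_over_base_field)
  obtain P where P: "P \<in> polys_over base_field" "Polynomial.lead_coeff P = 1" "poly P x = 0"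
    "\<And>Q. Q \<in> polys_over base_field \<Longrightarrow> poly Q x = 0 \<Longrightarrow> \<exists>A\<in>polys_over base_field. Q = P * A"
    using minimal_polynomial_over[OF subfield_set_base_field f] by blast
  obtain g where g: "P = ac_poly g"
    using P(1) unfolding polys_over_base_field by (rule rangeE)
  have div: "g dvd h" if hx: "poly (ac_poly h) x = 0" for h
  proof -
    have "ac_poly h \<in> polys_over base_field"
      unfolding polys_over_base_field by (rule rangeI)
    then obtain A where A: "A \<in> polys_over base_field" "ac_poly h = P * A"
      using P(4)[OF _ hx] by auto
    obtain a where "A = ac_poly a"
      using A(1) unfolding polys_over_base_field by (rule rangeE)
    then have "ac_poly h = ac_poly (g * a)"
      using A(2) g by (simp only: ac_poly_mult)
    then have "ac_poly (h - g * a) = 0" by (simp add: ac_poly_diff)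
    then show ?thesis by (simp add: ac_poly_eq_0_iff)
  qed
  have g0: "g \<noteq> 0" using P(2) g by auto
  have "Factorial_Ring.irreducible g"
  proof (rule comm_semiring_1_class.irreducibleI)
    show "\<not> g dvd 1"
    proof
      assume "g dvd 1"
      then have "Polynomial.degree g = 0"
        by (simp add: is_unit_iff_degree g0)
      then have "Polynomial.degree P = 0" by (simp add: g degree_ac_poly)
      then have "P = 1" using P(2)
        by (metis degree_0_id one_pCons)
      then show False using P(3) by simp
    qed
    fix a b assume ab: "g = a * b"
    then have "poly (ac_poly a) x = 0 \<or> poly (ac_poly b) x = 0"
      using P(3) g by (simp add: ac_poly_mult)
    then show "a dvd 1 \<or> b dvd 1"
    proof
      assume "poly (ac_poly a) x = 0"
      then have "a * b dvd a * 1" using div ab by auto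
      then show ?thesis using g0 ab by (simp add: mult_dvd_mono)
    next
      assume "poly (ac_poly b) x = 0"
      then have "a * b dvd 1 * b" using div ab by auto
      then show ?thesis using g0 ab by (simp add: dvd_times_right_cancel_iff)
    qed
  qed (rule g0)
  then show ?thesis using that P(3) g div by blast
qed

text \<open>
  An irreducible polynomial is associated to the minimal polynomial of each of its roots.
\<close>
lemma irreducible_dvd_of_root:
  fixes g h :: "'a::field poly"
  assumes g: "Factorial_Ring.irreducible g" "poly (ac_poly g) x = 0" and h: "poly (ac_poly h) x = 0"
  shows "g dvd h"
proof -
  obtain m :: "'a poly" where m: "Factorial_Ring.irreducible m" "poly (ac_poly m) x = 0"
    "\<And>h. poly (ac_poly h) x = 0 \<Longrightarrow> m dvd h"
    using minimal_polynomial_ac[of x] by blast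
  obtain c where c: "g = m * c" using m(3)[OF g(2)] by (auto elim: dvdE)
  then have "c dvd 1"
    using g(1) m(1) by (metis comm_semiring_1_class.irreducible_not_unit comm_semiring_1_class.irreducibleD)
  then have "g dvd m" using c by (metis dvd_mult_unit_iff' dvd_refl mult.commute mult_unit_dvd_iff)
  then show ?thesis using m(3)[OF h] by (rule dvd_trans)
qed

lemma pderiv_eq_0_or_degree_less:
  fixes g :: "'b::field poly"
  shows "Polynomial.degree (pderiv g) < Polynomial.degree g \<or> pderiv g = 0"
proof (cases "Polynomial.degree g = 0")
  case True
  then show ?thesis by (metis pderiv_singleton degree_eq_zeroE)
next
  case False
  have "Polynomial.degree (pderiv g) \<le> Polynomial.degree g - 1"
    by (intro Polynomial.degree_le allI impI) (simp add: coeff_pderiv Polynomial.coeff_eq_0)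
  then show ?thesis using False by linarith
qed

lemma order_le_1_of_pderiv:
  fixes f :: "'b::field poly"
  assumes "f \<noteq> 0" "poly (pderiv f) a \<noteq> 0"
  shows "Polynomial.order a f = 0 \<or> Polynomial.order a f = 1"
proof (rule ccontr)
  assume "\<not> ?thesis"
  then have "2 \<le> Polynomial.order a f" by simp
  then have "[:- a, 1:] ^ 2 dvd f"
    by (meson assms(1) order_divides)
  then obtain k where "f = [:- a, 1:] ^ 2 * k" by (auto elim: dvdE)
  then have "poly (pderiv f) a = 0"
    by (simp only: power2_eq_square pderiv_mult poly_add poly_mult) simp
  then show False using assms(2) by simp
qed

lemma pderiv_ne_0_of_rsquarefree:
  fixes f :: "'b::field poly"
  assumes "rsquarefree f" "poly f a = 0"
  shows "poly (pderiv f) a \<noteq> 0"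
proof -
  have f0: "f \<noteq> 0" using assms(1) by (simp add: rsquarefree_def)
  have o: "Polynomial.order a f = 1" using rsquarefree_root_order[OF assms f0] .
  obtain k where k: "f = [:- a, 1:] * k" using assms(2) by (auto simp: poly_eq_0_iff_dvd elim: dvdE)
  have "poly k a \<noteq> 0"
  proof
    assume "poly k a = 0"
    then have "[:- a, 1:] ^ 2 dvd f"
      unfolding k power2_eq_square by (intro mult_dvd_mono dvd_refl) (simp add: poly_eq_0_iff_dvd)
    then show False using o f0 by (simp add: order_divides)
  qed
  then show ?thesis using k by (simp only: pderiv_mult poly_add poly_mult) (simp add: pderiv_pCons)
qed

text \<open>
  The minimal polynomial \<open>g\<close> of \<open>x\<close> divides every polynomial over \<open>F\<close> with \<open>x\<close> as a simple root, so
  that \<open>g'\<close> does not vanish at \<open>x\<close>; and \<open>g\<close> has no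
  double root \<open>a\<close> at all, since \<open>g\<close> is also minimal for \<open>a\<close> and would divide the nonzero polynomial \<open>g'\<close> of
  smaller degree.
\<close>
lemma mem_sep_closure_iff:
  fixes x :: "'a::field alg_closure"
  shows "x \<in> sep_closure \<longleftrightarrow>
    (\<exists>f\<in>polys_over base_field. poly f x = 0 \<and> poly (pderiv f) x \<noteq> 0)"
proof
  assume "x \<in> sep_closure"
  then obtain f :: "'a poly" where "poly (ac_poly f) x = 0" "rsquarefree (ac_poly f)"
    by (auto simp: sep_closure_def)
  then show "\<exists>f\<in>polys_over base_field. poly f x = 0 \<and> poly (pderiv f) x \<noteq> 0"
    using pderiv_ne_0_of_rsquarefree by (metis polys_over_base_field rangeI)
next
  assume "\<exists>f\<in>polys_over base_field. poly f x = 0 \<and> poly (pderiv f) x \<noteq> 0"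
  then obtain f :: "'a poly" where f: "poly (ac_poly f) x = 0" "poly (ac_poly (pderiv f)) x \<noteq> 0"
    by (auto simp: polys_over_base_field ac_poly_pderiv)
  obtain g :: "'a poly" where g: "Factorial_Ring.irreducible g" "poly (ac_poly g) x = 0"
    "\<And>h. poly (ac_poly h) x = 0 \<Longrightarrow> g dvd h"
    using minimal_polynomial_ac[of x] by blast
  obtain k where "f = g * k" using g(3)[OF f(1)] by (auto elim: dvdE)
  then have g': "poly (ac_poly (pderiv g)) x \<noteq> 0"
    using f(2) g(2) by (auto simp: pderiv_mult ac_poly_add ac_poly_mult)
  have g0: "g \<noteq> 0" using g(1) by auto
  have "poly (pderiv (ac_poly g)) a \<noteq> 0" if "poly (ac_poly g) a = 0" for a
  proof
    assume "poly (pderiv (ac_poly g)) a = 0"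
    then have "g dvd pderiv g"
      using irreducible_dvd_of_root[OF g(1) that] by (simp add: ac_poly_pderiv)
    then have "pderiv g = 0 \<or> Polynomial.degree g \<le> Polynomial.degree (pderiv g)"
      using Polynomial.dvd_imp_degree_le by blast
    moreover have "Polynomial.degree (pderiv g) < Polynomial.degree g \<or> pderiv g = 0"
      by (rule pderiv_eq_0_or_degree_less)
    ultimately have "pderiv g = 0" by linarith
    then show False using g' by simp
  qed
  then have "rsquarefree (ac_poly g)"
    unfolding rsquarefree_def using g0 order_le_1_of_pderiv order_0I
    by (metis ac_poly_eq_0_iff)
  then show "x \<in> sep_closure"
    using g by (auto simp: sep_closure_def)
qed

text \<open>
  Otherwise \<open>g\<close> would divide a nonzero polynomial of smaller degree.
\<close>
lemma pderiv_eq_0_of_not_separable: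
  fixes x :: "'a::field alg_closure"
  assumes x: "x \<notin> sep_closure" and g: "Factorial_Ring.irreducible g" "poly (ac_poly g) x = 0"
  shows "pderiv g = 0"
proof -
  have "poly (ac_poly (pderiv g)) x = 0"
    using x g(2) polys_over_base_field mem_sep_closure_iff ac_poly_pderiv by (metis rangeI)
  then have "g dvd pderiv g"
    by (rule irreducible_dvd_of_root[OF g])
  then have "pderiv g = 0 \<or> Polynomial.degree g \<le> Polynomial.degree (pderiv g)"
    using Polynomial.dvd_imp_degree_le by blast
  moreover have "Polynomial.degree (pderiv g) < Polynomial.degree g \<or> pderiv g = 0"
    by (rule pderiv_eq_0_or_degree_less)
  ultimately show ?thesis by linarith
qed

section \<open>The field of separable elements\<close>

interpretation ac: vector_space "\<lambda>(c::'a::field) (x::'a alg_closure). to_ac c * x"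
  by unfold_locales (simp_all add: algebra_simps)

lemma poly_ac_poly_altdef:
  "poly (ac_poly h) x = (\<Sum>i\<le>Polynomial.degree h. to_ac (Polynomial.coeff h i) * x ^ i)"
  by (simp add: poly_altdef coeff_map_poly degree_ac_poly)

lemma poly_in_span_powers: "poly (ac_poly h) x \<in> ac.span (range (\<lambda>i. x ^ i))"
  unfolding poly_ac_poly_altdef by (intro ac.span_sum ac.span_scale ac.span_base) simp

text \<open>
  Reduce modulo \<open>g\<close>.
\<close>
lemma poly_in_span_finite_powers:
  fixes g h :: "'a::field poly"
  assumes g: "g \<noteq> 0" "poly (ac_poly g) x = 0"
  shows "poly (ac_poly h) x \<in> ac.span ((\<lambda>i. x ^ i) ` {..<Polynomial.degree g})"
proof -
  define r where "r = h mod g"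
  have "h = g * (h div g) + r" by (simp add: r_def)
  then have "ac_poly h = ac_poly g * ac_poly (h div g) + ac_poly r"
    by (metis ac_poly_add ac_poly_mult)
  then have *: "poly (ac_poly h) x = poly (ac_poly r) x"
    using g(2) by simp
  have r: "r = 0 \<or> Polynomial.degree r < Polynomial.degree g"
    using g(1) degree_mod_less[of g h] by (simp add: r_def)
  show ?thesis
  proof (cases "r = 0")
    case True
    then show ?thesis by (simp add: * ac.span_zero)
  next
    case False
    with r have "Polynomial.degree r < Polynomial.degree g" by simp
    then show ?thesis
      unfolding * poly_ac_poly_altdef[of r] by (intro ac.span_sum ac.span_scale ac.span_base) auto
  qed
qed

text \<open>
  A linear relation between powers of \<open>x\<close>, or an equality between two of them, is a polynomial of
  degree less than \<open>n\<close> with root \<open>x\<close>.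
\<close>
lemma powers_inj_independent:
  fixes x :: "'a::field alg_closure"
  assumes n: "\<And>h. h \<noteq> 0 \<Longrightarrow> poly (ac_poly h) x = 0 \<Longrightarrow> n \<le> Polynomial.degree h"
  shows "inj_on (\<lambda>i. x ^ i) {..<n}" and "ac.independent ((\<lambda>i. x ^ i) ` {..<n})"
proof -
  show inj: "inj_on (\<lambda>i. x ^ i) {..<n}"
  proof (rule linorder_inj_onI')
    fix i j assume ij: "i \<in> {..<n}" "j \<in> {..<n}" "i < j"
    show "x ^ i \<noteq> x ^ j"
    proof
      assume eq: "x ^ i = x ^ j"
      define h :: "'a poly" where "h = Polynomial.monom 1 j - Polynomial.monom 1 i"
      have "Polynomial.coeff h j = 1" using ij by (simp add: h_def)
      then have "h \<noteq> 0" by auto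
      moreover have "poly (ac_poly h) x = 0"
        by (simp add: h_def ac_poly_diff map_poly_monom poly_monom eq)
      moreover have "Polynomial.degree h \<le> j"
        unfolding h_def using ij
        by (intro Polynomial.degree_diff_le) (auto intro: order_trans[OF Polynomial.degree_monom_le])
      ultimately show False using n[of h] ij by simp
    qed
  qed
  show "ac.independent ((\<lambda>i. x ^ i) ` {..<n})"
  proof (rule ac.independent_if_scalars_zero)
    fix u v assume u: "(\<Sum>v\<in>(\<lambda>i. x ^ i) ` {..<n}. to_ac (u v) * v) = 0" and v: "v \<in> (\<lambda>i. x ^ i) ` {..<n}"
    define h where "h = (\<Sum>i<n. Polynomial.monom (u (x ^ i)) i)"
    have coeff: "Polynomial.coeff h i = (if i < n then u (x ^ i) else 0)" for i
      by (simp add: h_def Polynomial.coeff_sum)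
    have "poly (ac_poly h) x = (\<Sum>i\<le>Polynomial.degree h. to_ac (Polynomial.coeff h i) * x ^ i)"
      by (rule poly_ac_poly_altdef)
    also have "\<dots> = (\<Sum>i\<in>{..Polynomial.degree h} \<union> {..<n}. to_ac (Polynomial.coeff h i) * x ^ i)"
      by (rule sum.mono_neutral_left) (auto simp: Polynomial.coeff_eq_0)
    also have "\<dots> = (\<Sum>i<n. to_ac (u (x ^ i)) * x ^ i)"
      by (rule sum.mono_neutral_cong_right) (auto simp: coeff)
    also have "\<dots> = 0" using u by (simp add: sum.reindex[OF inj])
    finally have h: "poly (ac_poly h) x = 0" .
    have "h = 0"
    proof (rule ccontr)
      assume h0: "h \<noteq> 0"
      then have "n \<le> Polynomial.degree h" using n h by blast
      then have "Polynomial.lead_coeff h = 0" using coeff by simp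
      then show False using h0 by simp
    qed
    then show "u v = 0" using v coeff by (metis (no_types, lifting) Polynomial.coeff_0 imageE lessThan_iff)
  qed simp
qed

lemma independent_powers_no_relation:
  fixes y :: "'a::field alg_closure"
  assumes inj: "inj_on (\<lambda>i. y ^ i) {..<n}" and ind: "ac.independent ((\<lambda>i. y ^ i) ` {..<n})"
    and h: "Polynomial.degree h < n" "poly (ac_poly h) y = 0"
  shows "h = 0"
proof -
  define u where "u v = Polynomial.coeff h (the_inv_into {..<n} (\<lambda>i. y ^ i) v)" for v
  have u: "u (y ^ i) = Polynomial.coeff h i" if "i < n" for i
    using that by (simp add: u_def the_inv_into_f_f[OF inj])
  have "(\<Sum>v\<in>(\<lambda>i. y ^ i) ` {..<n}. to_ac (u v) * v) = (\<Sum>i<n. to_ac (Polynomial.coeff h i) * y ^ i)"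
    by (simp add: sum.reindex[OF inj] u)
  also have "\<dots> = poly (ac_poly h) y"
    unfolding poly_ac_poly_altdef using h(1)
    by (intro sum.mono_neutral_right) (auto simp: Polynomial.coeff_eq_0)
  finally have sum0: "(\<Sum>v\<in>(\<lambda>i. y ^ i) ` {..<n}. to_ac (u v) * v) = 0"
    using h(2) by simp
  have "u (y ^ Polynomial.degree h) = 0"
    by (rule ac.independentD[OF ind _ _ sum0]) (use h(1) in auto)
  then show "h = 0"
    using u[OF h(1)] by simp
qed

lemma span_mult:
  assumes "a \<in> ac.span A" "b \<in> ac.span B"
  shows "a * b \<in> ac.span {x * y |x y. x \<in> A \<and> y \<in> B}"
  using assms(1)
proof (induction rule: ac.span_induct_alt)
  case (step c x y)
  have "x * b \<in> ac.span {x * y |x y. x \<in> A \<and> y \<in> B}"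
    using assms(2)
  proof (induction rule: ac.span_induct_alt)
    case (step d y z)
    have "x * (to_ac d * y + z) = to_ac d * (x * y) + x * z" by (simp add: algebra_simps)
    moreover have "x * y \<in> {x * y |x y. x \<in> A \<and> y \<in> B}"
      using step \<open>x \<in> A\<close> by blast
    ultimately show ?case
      using step by (simp only: ac.span_add[OF ac.span_scale[OF ac.span_base]])
  qed (simp add: ac.span_zero)
  moreover have "(to_ac c * x + y) * b = to_ac c * (x * b) + y * b" by (simp add: algebra_simps)
  ultimately show ?case
    using step by (auto intro!: ac.span_add ac.span_scale)
qed (simp add: ac.span_zero)

text \<open>
  In \<open>g(x) = 0\<close> for the minimal polynomial \<open>g\<close>, move the nonzero constant term to the other side and
  divide by \<open>x\<close>.
\<close>
lemma inverse_eq_poly: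
  fixes x :: "'a::field alg_closure"
  shows "\<exists>h :: 'a poly. inverse x = poly (ac_poly h) x"
proof (cases "x = 0")
  case True
  then show ?thesis by (intro exI[of _ 0]) simp
next
  case False
  obtain g :: "'a poly" where g: "Factorial_Ring.irreducible g" "poly (ac_poly g) x = 0"
    "\<And>h. poly (ac_poly h) x = 0 \<Longrightarrow> g dvd h"
    using minimal_polynomial_ac[of x] by blast
  obtain a k where ak: "g = pCons a k" by (rule pCons_cases)
  have k: "to_ac a + x * poly (ac_poly k) x = 0"
    using g(2) by (simp add: ak map_poly_pCons)
  have "a \<noteq> 0"
  proof
    assume "a = 0"
    then have "poly (ac_poly k) x = 0" using k False by simp
    then have "g dvd k" by (rule g(3))
    moreover have "k \<noteq> 0" using g(1) ak \<open>a = 0\<close> by auto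
    ultimately have "Polynomial.degree g \<le> Polynomial.degree k"
      by (rule Polynomial.dvd_imp_degree_le)
    then show False using \<open>k \<noteq> 0\<close> by (simp add: ak)
  qed
  have "x * (- (poly (ac_poly k) x / to_ac a)) = 1"
    using k \<open>a \<noteq> 0\<close> by (simp add: field_simps) (metis add.commute add_eq_0_iff)
  then have "inverse x = - (poly (ac_poly k) x / to_ac a)"
    by (rule inverse_unique)
  also have "\<dots> = poly (ac_poly (Polynomial.smult (- inverse a) k)) x"
    by (simp add: map_poly_smult divide_inverse del: smult_minus_left)
  finally show ?thesis by blast
qed

context
  fixes q :: nat
  assumes q: "CHAR('a::field) = q" "q > 0"
begin

lemma prime_q: "Factorial_Ring.prime q"
  using prime_CHAR_semidom[where ?'a = 'a] q by simp

lemma frobenius_add: "(x + y :: 'a alg_closure) ^ q = x ^ q + y ^ q"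
  by (rule freshmans_dream) (use prime_q q in simp_all)

lemma frobenius_inj: "(x :: 'a alg_closure) ^ q = y ^ q \<longleftrightarrow> x = y"
proof
  assume eq: "x ^ q = y ^ q"
  have "((x - y) + y) ^ q = (x - y) ^ q + y ^ q" by (rule frobenius_add)
  then have "(x - y) ^ q = 0" using eq by simp
  then show "x = y" by simp
qed simp

text \<open>
  The polynomial \<open>C = c(X\<^sup>q)\<close> has root \<open>x\<close> and derivative zero, and this forces a high power of the
  minimal polynomial \<open>g\<close> of \<open>x\<close> to divide \<open>C\<close>: from \<open>C = g\<^sup>j k\<close> with \<open>0 < j < q\<close> one gets \<open>j g' k + g k' = 0\<close>, so \<open>k(x) = 0\<close> and \<open>g\<close> divides
  \<open>k\<close>. Thus \<open>g\<^sup>q\<close> divides \<open>C\<close>, and the degrees give the claim.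
\<close>
lemma degree_le_of_frobenius_root:
  fixes x :: "'a alg_closure"
  assumes x: "x \<in> sep_closure" and g: "Factorial_Ring.irreducible g" "poly (ac_poly g) x = 0"
    and c: "c \<noteq> 0" "poly (ac_poly c) (x ^ q) = 0"
  shows "Polynomial.degree g \<le> Polynomial.degree c"
proof -
  obtain f where "f \<in> polys_over base_field" and f': "poly f x = 0" "poly (pderiv f) x \<noteq> 0"
    using x mem_sep_closure_iff by blast
  then obtain f0 where f0: "f = ac_poly f0"
    unfolding polys_over_base_field by (auto elim: rangeE)
  obtain k0 where "f0 = g * k0"
    using irreducible_dvd_of_root[OF g, of f0] f0 f' by (auto elim: dvdE)
  then have g': "poly (ac_poly (pderiv g)) x \<noteq> 0"
    using f' g(2) unfolding f0 by (auto simp: pderiv_mult ac_poly_mult ac_poly_pderiv)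
  define C where "C = pcompose c (Polynomial.monom 1 q)"
  have C': "pderiv C = 0"
    unfolding C_def pderiv_pcompose using of_nat_CHAR[where ?'a = 'a] q(1) by (simp add: pderiv_monom)
  have Cx: "poly (ac_poly C) x = 0"
    by (simp add: C_def ac_poly_pcompose poly_pcompose map_poly_monom poly_monom c)
  have g0: "g \<noteq> 0" using g(1) by auto
  have "\<exists>k. C = g ^ j * k" if "j \<le> q" for j
    using that
  proof (induction j)
    case (Suc j)
    then obtain k where k: "C = g ^ j * k" by auto
    have "poly (ac_poly k) x = 0"
    proof (cases j)
      case 0
      then show ?thesis using k Cx by simp
    next
      case (Suc i)
      have "0 = pderiv (g ^ Suc i * k)" using C' k Suc by simp
      also have "\<dots> = g ^ i * (Polynomial.smult (of_nat (Suc i)) (pderiv g * k) + g * pderiv k)"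
        by (simp only: pderiv_mult pderiv_power_Suc) (simp add: algebra_simps)
      finally have "Polynomial.smult (of_nat (Suc i)) (pderiv g * k) + g * pderiv k = 0"
        using g0 by simp
      then have "poly (ac_poly (Polynomial.smult (of_nat (Suc i)) (pderiv g * k) + g * pderiv k)) x = 0"
        by simp
      then have "of_nat (Suc i) * (poly (ac_poly (pderiv g)) x * poly (ac_poly k) x) = 0"
        using g(2) by (simp add: ac_poly_add ac_poly_mult map_poly_smult del: of_nat_Suc)
      moreover have "(of_nat (Suc i) :: 'a alg_closure) \<noteq> 0"
        unfolding of_nat_eq_0_iff_char_dvd using Suc Suc.prems q
        by (auto dest: dvd_imp_le)
      ultimately show ?thesis using g' by simp
    qed
    then have "g dvd k" by (rule irreducible_dvd_of_root[OF g])
    then obtain k' where "k = g * k'" by (auto elim: dvdE)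
    then show ?case using k by (intro exI[of _ k']) (simp add: mult_ac)
  qed simp
  then obtain k where k: "C = g ^ q * k" by blast
  have "C \<noteq> 0"
    unfolding C_def using c(1) q by (simp add: pcompose_eq_0_iff Polynomial.degree_monom_eq)
  then have "Polynomial.degree (g ^ q) \<le> Polynomial.degree C"
    using k by (intro Polynomial.dvd_imp_degree_le) auto
  then have "q * Polynomial.degree g \<le> Polynomial.degree c * q"
    by (simp add: C_def Polynomial.degree_pcompose Polynomial.degree_monom_eq Polynomial.degree_power_eq[OF g0])
  then show ?thesis using q by (simp add: mult.commute)
qed

text \<open>
  The powers \<open>(x\<^sup>q)\<^sup>i\<close> with \<open>i\<close> below the degree of \<open>x\<close> are independent by the preceding lemma, and
  they are as many as the dimension of \<open>F[x]\<close>, so they span \<open>F[x]\<close>.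
\<close>
lemma separable_in_span_frobenius_powers:
  fixes x :: "'a alg_closure"
  assumes x: "x \<in> sep_closure"
  shows "x \<in> ac.span (range (\<lambda>i. (x ^ q) ^ i))"
proof -
  obtain g :: "'a poly" where g: "Factorial_Ring.irreducible g" "poly (ac_poly g) x = 0"
    using minimal_polynomial_ac[of x] by blast
  have g0: "g \<noteq> 0" using g(1) by auto
  let ?d = "Polynomial.degree g"
  let ?B = "(\<lambda>i. (x ^ q) ^ i) ` {..<?d}" and ?P = "(\<lambda>i. x ^ i) ` {..<?d}"
  note B = powers_inj_independent[OF degree_le_of_frobenius_root[OF x g]]
  have P: "h \<in> ac.span ?P" if "h = poly (ac_poly f) x" for h f
    using poly_in_span_finite_powers[OF g0 g(2)] that by simp
  have "x \<in> ac.span ?B"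
  proof (rule ccontr)
    assume nx: "x \<notin> ac.span ?B"
    then have "ac.independent (insert x ?B)"
      using B(2) by (simp add: ac.independent_insert)
    moreover have "insert x ?B \<subseteq> ac.span ?P"
    proof -
      have "x = poly (ac_poly [:0, 1:]) x" by (simp add: map_poly_pCons)
      moreover have "(x ^ q) ^ i = poly (ac_poly (Polynomial.monom 1 (q * i))) x" for i
        by (simp add: map_poly_monom poly_monom power_mult)
      ultimately show ?thesis using P by blast
    qed
    ultimately have "card (insert x ?B) \<le> card ?P"
      using ac.independent_span_bound[of ?P "insert x ?B"] by simp
    also have "\<dots> \<le> ?d" using card_image_le[of "{..<?d}"] by simp
    also have "card (insert x ?B) = Suc ?d"
      using nx ac.span_base[of x ?B] B(1) by (subst card_insert_disjoint) (auto simp: card_image)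
    finally show False by simp
  qed
  then show ?thesis by (rule subsetD[OF ac.span_mono, rotated]) auto
qed

lemma span_frobenius:
  assumes "v \<in> ac.span B"
  shows "(v :: 'a alg_closure) ^ q \<in> ac.span ((\<lambda>b. b ^ q) ` B)"
  using assms
proof (induction rule: ac.span_induct_alt)
  case base
  then show ?case using q by (simp add: ac.span_zero power_0_left)
next
  case (step c x y)
  have "(to_ac c * x + y) ^ q = to_ac (c ^ q) * x ^ q + y ^ q"
    by (simp add: frobenius_add power_mult_distrib)
  moreover have "x ^ q \<in> (\<lambda>b. b ^ q) ` B" using step by blast
  ultimately show ?case using step by (simp only: ac.span_add[OF ac.span_scale[OF ac.span_base]])
qed

text \<open>
  Let \<open>V\<close> have finite dimension and be spanned by its \<open>q\<close>-th powers. For a basis \<open>B\<close> of \<open>V\<close> the \<open>q\<close>-th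
  powers of the elements of \<open>B\<close> span \<open>V\<close>, and there are at most as many of them as the dimension; hence they are
  independent. If \<open>z\<close> is not separable, its minimal polynomial is \<open>h(X\<^sup>q)\<close>. The powers of \<open>z\<close> up to the
  degree of \<open>h\<close> are independent, so they can be put into \<open>B\<close>, but \<open>h(z\<^sup>q) = 0\<close> is a relation between their
  \<open>q\<close>-th powers.
\<close>
lemma separable_of_frobenius_spanning:
  fixes z :: "'a alg_closure"
  assumes W: "finite W" and V: "V \<subseteq> ac.span W" "V \<subseteq> ac.span ((\<lambda>v. v ^ q) ` V)"
    and z: "\<And>i. z ^ i \<in> V"
  shows "z \<in> sep_closure"
proof (rule ccontr)
  assume nz: "z \<notin> sep_closure"
  obtain g :: "'a poly" where g: "Factorial_Ring.irreducible g" "poly (ac_poly g) z = 0"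
    "\<And>h. poly (ac_poly h) z = 0 \<Longrightarrow> g dvd h"
    using minimal_polynomial_ac[of z] by blast
  have g0: "g \<noteq> 0" using g(1) by auto
  have g': "pderiv g = 0" by (rule pderiv_eq_0_of_not_separable[OF nz g(1,2)])
  have cg: "Polynomial.coeff g i = 0" if "\<not> q dvd i" for i
  proof -
    from that have "i \<noteq> 0" by (metis dvd_0_right)
    then obtain j where j: "i = Suc j" by (cases i) auto
    have "of_nat i * Polynomial.coeff g i = 0"
      using arg_cong[OF g', of "\<lambda>P. Polynomial.coeff P j"] by (simp add: coeff_pderiv j del: of_nat_Suc)
    then show ?thesis using that q by (simp add: of_nat_eq_0_iff_char_dvd)
  qed
  \<comment> \<open>The vanishing of \<open>g'\<close> leaves only exponents divisible by \<open>q\<close>, so \<open>g = h(X\<^sup>q)\<close>.\<close>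
  define h where "h = Abs_poly (\<lambda>i. Polynomial.coeff g (q * i))"
  have ch: "Polynomial.coeff h i = Polynomial.coeff g (q * i)" for i
    unfolding h_def
  proof (subst Abs_poly_inverse)
    have "\<forall>i>Polynomial.degree g. Polynomial.coeff g (q * i) = 0"
      using q by (auto intro!: Polynomial.coeff_eq_0 intro: less_le_trans)
    then show "(\<lambda>i. Polynomial.coeff g (q * i)) \<in> {f. \<forall>\<^sub>\<infinity>n. f n = 0}"
      by (auto simp: MOST_nat)
  qed simp
  have q2: "q \<ge> 2" using prime_q by (rule prime_ge_2_nat)
  have dg: "Polynomial.degree g > 0"
    using g(1) g0 by (metis is_unit_iff_degree comm_semiring_1_class.irreducible_not_unit gr0I)
  have dh: "Polynomial.degree h \<le> Polynomial.degree g div q"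
  proof (rule Polynomial.degree_le, intro allI impI)
    fix i assume "Polynomial.degree g div q < i"
    then have "Polynomial.degree g < q * i" using q by (simp add: div_less_iff_less_mult mult.commute)
    then show "Polynomial.coeff h i = 0" by (simp add: ch Polynomial.coeff_eq_0)
  qed
  then have dh: "Polynomial.degree h < Polynomial.degree g"
  proof (rule le_less_trans)
    show "Polynomial.degree g div q < Polynomial.degree g" using dg q2 by simp
  qed
  have "poly (ac_poly g) z = (\<Sum>i\<le>q * Polynomial.degree g. to_ac (Polynomial.coeff g i) * z ^ i)"
    unfolding poly_ac_poly_altdef using q
    by (intro sum.mono_neutral_left) (auto simp: Polynomial.coeff_eq_0 intro: order_trans)
  also have "\<dots> = (\<Sum>i\<in>(\<lambda>j. q * j) ` {..Polynomial.degree g}. to_ac (Polynomial.coeff g i) * z ^ i)"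
  proof (rule sum.mono_neutral_right)
    show "\<forall>i\<in>{..q * Polynomial.degree g} - (\<lambda>j. q * j) ` {..Polynomial.degree g}.
        to_ac (Polynomial.coeff g i) * z ^ i = 0"
    proof
      fix i assume i: "i \<in> {..q * Polynomial.degree g} - (\<lambda>j. q * j) ` {..Polynomial.degree g}"
      have "\<not> q dvd i"
      proof
        assume "q dvd i"
        then obtain j where "i = q * j" by (auto elim: dvdE)
        then show False using i q by auto
      qed
      then show "to_ac (Polynomial.coeff g i) * z ^ i = 0" by (simp add: cg)
    qed
  qed auto
  also have "\<dots> = (\<Sum>j\<le>Polynomial.degree g. to_ac (Polynomial.coeff g (q * j)) * z ^ (q * j))"
    using q by (subst sum.reindex) (auto simp: inj_on_def)
  also have "\<dots> = (\<Sum>j\<le>Polynomial.degree h. to_ac (Polynomial.coeff h j) * (z ^ q) ^ j)"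
    using dh by (intro sum.mono_neutral_cong_right) (auto simp: power_mult Polynomial.coeff_eq_0 simp flip: ch)
  also have "\<dots> = poly (ac_poly h) (z ^ q)"
    by (simp add: poly_ac_poly_altdef)
  finally have hz: "poly (ac_poly h) (z ^ q) = 0" using g(2) by simp
  define m where "m = Suc (Polynomial.degree h)"
  have min: "m \<le> Polynomial.degree f" if "f \<noteq> 0" "poly (ac_poly f) z = 0" for f
    using Polynomial.dvd_imp_degree_le[OF g(3)[OF that(2)] that(1)] dh by (simp add: m_def)
  note pow = powers_inj_independent[OF min]
  have "(\<lambda>i. z ^ i) ` {..<m} \<subseteq> V" using z by auto
  then obtain B where B: "(\<lambda>i. z ^ i) ` {..<m} \<subseteq> B" "B \<subseteq> V" "ac.independent B" "V \<subseteq> ac.span B"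
    using ac.maximal_independent_subset_extend pow(2) by metis
  have fB: "finite B" using ac.independent_span_bound[OF W B(3)] B(2) V(1) by blast
  let ?Bq = "(\<lambda>b. b ^ q) ` B"
  have sBq: "V \<subseteq> ac.span ?Bq"
  proof -
    have "(\<lambda>v. v ^ q) ` V \<subseteq> ac.span ?Bq" using span_frobenius B(4) by blast
    then have "ac.span ((\<lambda>v. v ^ q) ` V) \<subseteq> ac.span ?Bq"
      by (rule ac.span_minimal) simp
    then show ?thesis using V(2) by blast
  qed
  have "ac.independent ?Bq"
  proof
    assume "ac.dependent ?Bq"
    then obtain b where b: "b \<in> ?Bq" "b \<in> ac.span (?Bq - {b})"
      unfolding ac.dependent_def by blast
    have "ac.span (?Bq - {b}) = ac.span ?Bq"
      using ac.span_redundant[OF b(2)] b(1) by (simp add: insert_absorb)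
    then have "B \<subseteq> ac.span (?Bq - {b})" using sBq B(2) by blast
    from ac.independent_span_bound[OF finite_Diff[OF finite_imageI[OF fB]] B(3) this]
    have "card B \<le> card (?Bq - {b})" by (rule conjunct2)
    also have "\<dots> < card ?Bq" using fB b(1) by (intro psubset_card_mono) auto
    also have "\<dots> \<le> card B" using fB by (rule card_image_le)
    finally show False by simp
  qed
  then have "ac.independent ((\<lambda>i. (z ^ q) ^ i) ` {..<m})"
  proof (rule ac.independent_mono)
    show "(\<lambda>i. (z ^ q) ^ i) ` {..<m} \<subseteq> ?Bq"
    proof (rule image_subsetI)
      fix i assume "i \<in> {..<m}"
      then have "z ^ i \<in> B" using B(1) by blast
      moreover have "(z ^ q) ^ i = (z ^ i) ^ q" by (simp add: mult.commute flip: power_mult)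
      ultimately show "(z ^ q) ^ i \<in> ?Bq" by (rule image_eqI[rotated])
    qed
  qed
  moreover have "inj_on (\<lambda>i. (z ^ q) ^ i) {..<m}"
  proof (rule inj_onI)
    fix i j assume ij: "i \<in> {..<m}" "j \<in> {..<m}" "(z ^ q) ^ i = (z ^ q) ^ j"
    then have "(z ^ i) ^ q = (z ^ j) ^ q" by (simp add: mult.commute flip: power_mult)
    then show "i = j" using inj_onD[OF pow(1)] ij by (simp add: frobenius_inj)
  qed
  ultimately have "h = 0"
    using independent_powers_no_relation[of "z ^ q" m h] hz by (simp add: m_def)
  moreover have "Polynomial.coeff g (Polynomial.degree g) \<noteq> 0" using g0 by simp
  then have "q dvd Polynomial.degree g" using cg by blast
  then have "Polynomial.coeff h (Polynomial.degree g div q) \<noteq> 0"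
    using g0 by (simp add: ch)
  ultimately show False by simp
qed

text \<open>
  Take \<open>V = F[x, y]\<close> in the preceding lemma. Each of \<open>x\<close> and \<open>y\<close> is a combination of powers of its
  \<open>q\<close>-th power, so \<open>V\<close> is spanned by \<open>q\<close>-th powers.
\<close>
lemma separable_of_mem_span_separable:
  fixes x y :: "'a alg_closure"
  assumes x: "x \<in> sep_closure" and y: "y \<in> sep_closure"
    and z: "z \<in> ac.span {x ^ i * y ^ j |i j. True}"
  shows "z \<in> sep_closure"
proof -
  define R where "R = {x ^ i * y ^ j |i j. True}"
  define V where "V = ac.span R"
  have V_mult: "a * b \<in> V" if "a \<in> V" "b \<in> V" for a b
  proof -
    have "{u * v |u v. u \<in> R \<and> v \<in> R} \<subseteq> R"
    proof clarify
      fix u v assume "u \<in> R" "v \<in> R"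
      then obtain i j k l where "u = x ^ i * y ^ j" "v = x ^ k * y ^ l" by (auto simp: R_def)
      then have "u * v = x ^ (i + k) * y ^ (j + l)" by (simp add: power_add mult_ac)
      then show "u * v \<in> R" by (auto simp: R_def)
    qed
    from subsetD[OF ac.span_mono[OF this] span_mult] that show ?thesis unfolding V_def by blast
  qed
  have "x ^ 0 * y ^ 0 \<in> R" unfolding R_def by blast
  then have one: "1 \<in> V" by (simp add: V_def ac.span_base)
  have zV: "z ^ i \<in> V" for i
  proof (induction i)
    case (Suc i)
    have "z \<in> V" using z by (simp only: V_def R_def)
    then show ?case unfolding power_Suc using Suc by (rule V_mult)
  qed (simp add: one)
  obtain g :: "'a poly" where g: "Factorial_Ring.irreducible g" "poly (ac_poly g) x = 0"
    using minimal_polynomial_ac[of x] by blast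
  obtain k :: "'a poly" where k: "Factorial_Ring.irreducible k" "poly (ac_poly k) y = 0"
    using minimal_polynomial_ac[of y] by blast
  have gk: "g \<noteq> 0" "k \<noteq> 0" using g(1) k(1) by auto
  define A where "A = (\<lambda>i. x ^ i) ` {..<Polynomial.degree g}"
  define B where "B = (\<lambda>i. y ^ i) ` {..<Polynomial.degree k}"
  define W where "W = {a * b |a b. a \<in> A \<and> b \<in> B}"
  have "W = (\<lambda>(a, b). a * b) ` (A \<times> B)" by (auto simp: W_def)
  then have fW: "finite W" by (simp add: A_def B_def)
  have powA: "x ^ i \<in> ac.span A" and powB: "y ^ i \<in> ac.span B" for i
    using poly_in_span_finite_powers[of g x "Polynomial.monom 1 i"]
      poly_in_span_finite_powers[of k y "Polynomial.monom 1 i"] g(2) k(2) gk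
    by (auto simp: A_def B_def map_poly_monom poly_monom)
  have "R \<subseteq> ac.span W"
    using span_mult[OF powA powB] by (auto simp: R_def W_def)
  then have VW: "V \<subseteq> ac.span W" unfolding V_def by (rule ac.span_minimal) simp
  have frob: "a ^ i \<in> ac.span (range (\<lambda>i. (a ^ q) ^ i))" if "a \<in> sep_closure" for a :: "'a alg_closure" and i
  proof (induction i)
    case 0
    show ?case by (rule ac.span_base) (auto intro: range_eqI[of _ _ 0])
  next
    case (Suc i)
    have "{u * v |u v. u \<in> range (\<lambda>i. (a ^ q) ^ i) \<and> v \<in> range (\<lambda>i. (a ^ q) ^ i)} \<subseteq> range (\<lambda>i. (a ^ q) ^ i)"
      by (auto simp flip: power_add)
    from ac.span_mono[OF this] span_mult[OF separable_in_span_frobenius_powers[OF that] Suc]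
    show ?case unfolding power_Suc by (rule subsetD)
  qed
  have "R \<subseteq> ac.span ((\<lambda>v. v ^ q) ` V)"
  proof
    fix r assume "r \<in> R"
    then obtain i j where r: "r = x ^ i * y ^ j" by (auto simp: R_def)
    have "{u * v |u v. u \<in> range (\<lambda>i. (x ^ q) ^ i) \<and> v \<in> range (\<lambda>i. (y ^ q) ^ i)} \<subseteq> (\<lambda>v. v ^ q) ` V"
    proof clarify
      fix a b
      have "x ^ a * y ^ b \<in> V" by (auto simp: V_def R_def intro: ac.span_base)
      moreover have "(x ^ q) ^ a * (y ^ q) ^ b = (x ^ a * y ^ b) ^ q"
        by (simp add: power_mult_distrib mult.commute flip: power_mult)
      ultimately show "(x ^ q) ^ a * (y ^ q) ^ b \<in> (\<lambda>v. v ^ q) ` V" by blast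
    qed
    from ac.span_mono[OF this] span_mult[OF frob[OF x, of i] frob[OF y, of j]]
    show "r \<in> ac.span ((\<lambda>v. v ^ q) ` V)" unfolding r by (rule subsetD)
  qed
  then have "V \<subseteq> ac.span ((\<lambda>v. v ^ q) ` V)" unfolding V_def by (rule ac.span_minimal) (rule ac.subspace_span)
  from separable_of_frobenius_spanning[OF fW VW this zV] show ?thesis .
qed

end

text \<open>
  In characteristic zero the derivative of a nonconstant polynomial does not vanish.
\<close>
lemma sep_closure_char_0:
  assumes "CHAR('a::field) = 0"
  shows "(x :: 'a alg_closure) \<in> sep_closure"
proof (rule ccontr)
  assume nx: "x \<notin> sep_closure"
  obtain g :: "'a poly" where g: "Factorial_Ring.irreducible g" "poly (ac_poly g) x = 0"
    using minimal_polynomial_ac[of x] by blast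
  have g0: "g \<noteq> 0" using g(1) by auto
  have dg: "Polynomial.degree g > 0"
    using g(1) g0 by (metis is_unit_iff_degree comm_semiring_1_class.irreducible_not_unit gr0I)
  then obtain j where j: "Polynomial.degree g = Suc j" by (cases "Polynomial.degree g") auto
  have "Polynomial.coeff (pderiv g) j = 0"
    unfolding pderiv_eq_0_of_not_separable[OF nx g] by (rule Polynomial.coeff_0)
  then have "of_nat (Suc j) * Polynomial.lead_coeff g = 0"
    unfolding coeff_pderiv j .
  then show False using assms g0 by (simp add: of_nat_eq_0_iff_char_dvd del: of_nat_Suc)
qed

lemma base_field_subset_sep_closure: "base_field \<subseteq> sep_closure"
proof
  fix x :: "'a alg_closure" assume x: "x \<in> base_field"
  have "[:- x, 1:] \<in> polys_over base_field"
    by (intro polys_over_pCons polys_over_const subfield_set_uminus subfield_set_one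
        subfield_set_base_field x)
  then show "x \<in> sep_closure"
    unfolding mem_sep_closure_iff by (rule bexI[rotated]) (simp add: pderiv_pCons)
qed

theorem subfield_set_sep_closure: "subfield_set (sep_closure :: 'a::field alg_closure set)"
proof (cases "CHAR('a) = 0")
  case True
  then have "(sep_closure :: 'a alg_closure set) = UNIV" using sep_closure_char_0 by blast
  then show ?thesis by (auto intro!: subfield_setI)
next
  case False
  then have q: "CHAR('a) = CHAR('a)" "CHAR('a) > 0" by auto
  note S = separable_of_mem_span_separable[OF q]
  have pow: "x ^ i * y ^ j \<in> ac.span {x ^ i * y ^ j |i j. True}" for x y :: "'a alg_closure" and i j
    by (rule ac.span_base) blast
  have one: "1 \<in> (sep_closure :: 'a alg_closure set)"
    using base_field_subset_sep_closure subfield_set_one[OF subfield_set_base_field] by blast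
  show ?thesis
  proof (rule subfield_setI[OF one])
    fix x y :: "'a alg_closure"
    assume x: "x \<in> sep_closure"
    show "inverse x \<in> sep_closure"
    proof -
      obtain h :: "'a poly" where h: "inverse x = poly (ac_poly h) x" using inverse_eq_poly by blast
      have "range (\<lambda>i. x ^ i) \<subseteq> {x ^ i * x ^ j |i j. True}"
      proof (rule image_subsetI)
        fix i :: nat
        have "x ^ i = x ^ i * x ^ 0" by simp
        then show "x ^ i \<in> {x ^ i * x ^ j |i j. True}" by blast
      qed
      from subsetD[OF ac.span_mono[OF this] poly_in_span_powers[of h x]]
      have "inverse x \<in> ac.span {x ^ i * x ^ j |i j. True}" unfolding h .
      then show ?thesis by (rule S[OF x x])
    qed
    assume y: "y \<in> sep_closure"
    show "x * y \<in> sep_closure"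
      by (rule S[OF x y]) (use pow[of x 1 y 1] in simp)
    show "x - y \<in> sep_closure"
      by (rule S[OF x y]) (use ac.span_diff[OF pow[of x 1 y 0] pow[of x 0 y 1]] in simp)
  qed
qed

text \<open>
  The composition of a polynomial for \<open>h(b)\<close> with \<open>h\<close> has \<open>b\<close> as a simple root, by the chain rule. This
  provides separable \<open>p\<close>-th roots and roots of \<open>X\<^sup>p - X - y\<close>.
\<close>
lemma separable_preimage:
  fixes b :: "'a::field alg_closure"
  assumes h: "h \<in> polys_over base_field" "poly h b \<in> sep_closure" "poly (pderiv h) b \<noteq> 0"
  shows "b \<in> sep_closure"
proof -
  obtain f where f: "f \<in> polys_over base_field" "poly f (poly h b) = 0" "poly (pderiv f) (poly h b) \<noteq> 0"
    using h(2) mem_sep_closure_iff by blast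
  then show ?thesis
    unfolding mem_sep_closure_iff using h
    by (intro bexI[of _ "pcompose f h"])
      (auto simp: poly_pcompose pderiv_pcompose intro!: polys_over_pcompose subfield_set_base_field)
qed

section \<open>Extension of homomorphisms\<close>

text \<open>
  The graph of a homomorphism between subfields. Partial homomorphisms are kept as relations because
  Zorn's lemma then applies to them with inclusion as order and unions as upper bounds. The last
  condition makes the relation single-valued.
\<close>
definition field_graph :: "('b::field \<times> 'b) set \<Rightarrow> bool"
  where "field_graph R \<longleftrightarrow> (1, 1) \<in> R \<and>
     (\<forall>a b c d. (a, b) \<in> R \<longrightarrow> (c, d) \<in> R \<longrightarrow> (a - c, b - d) \<in> R \<and> (a * c, b * d) \<in> R) \<and>
     (\<forall>a b. (a, b) \<in> R \<longrightarrow> (inverse a, inverse b) \<in> R \<and> (a = 0 \<longrightarrow> b = 0))"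

lemma field_graphI:
  assumes "(1, 1) \<in> R"
    and "\<And>a b c d. (a, b) \<in> R \<Longrightarrow> (c, d) \<in> R \<Longrightarrow> (a - c, b - d) \<in> R"
    and "\<And>a b c d. (a, b) \<in> R \<Longrightarrow> (c, d) \<in> R \<Longrightarrow> (a * c, b * d) \<in> R"
    and "\<And>a b. (a, b) \<in> R \<Longrightarrow> (inverse a, inverse b) \<in> R"
    and "\<And>b. (0, b) \<in> R \<Longrightarrow> b = 0"
  shows "field_graph R"
  unfolding field_graph_def using assms by auto

lemma field_graphD:
  assumes "field_graph R"
  shows "(1, 1) \<in> R"
    and "(a, b) \<in> R \<Longrightarrow> (c, d) \<in> R \<Longrightarrow> (a - c, b - d) \<in> R"
    and "(a, b) \<in> R \<Longrightarrow> (c, d) \<in> R \<Longrightarrow> (a * c, b * d) \<in> R"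
    and "(a, b) \<in> R \<Longrightarrow> (inverse a, inverse b) \<in> R"
    and "(0, b) \<in> R \<Longrightarrow> b = 0"
  using assms unfolding field_graph_def by blast+

lemma field_graph_unique:
  assumes "field_graph R" "(a, b) \<in> R" "(a, b') \<in> R"
  shows "b = b'"
  using field_graphD(5)[OF assms(1), of "b - b'"] field_graphD(2)[OF assms(1) assms(2,3)] by simp

lemma subfield_set_Domain:
  assumes R: "field_graph R"
  shows "subfield_set (Domain R)"
proof (rule subfield_setI)
  show "1 \<in> Domain R" using field_graphD(1)[OF R] by (rule DomainI)
  fix x y assume "x \<in> Domain R"
  then obtain x' where x: "(x, x') \<in> R" by (rule DomainE)
  show "inverse x \<in> Domain R" using field_graphD(4)[OF R x] by (rule DomainI)
  assume "y \<in> Domain R"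
  then obtain y' where y: "(y, y') \<in> R" by (rule DomainE)
  show "x - y \<in> Domain R" using field_graphD(2)[OF R x y] by (rule DomainI)
  show "x * y \<in> Domain R" using field_graphD(3)[OF R x y] by (rule DomainI)
qed

lemma field_graph_hom:
  assumes R: "field_graph R"
  obtains \<phi> where "hom_on (Domain R) \<phi>" "R = {(x, \<phi> x) |x. x \<in> Domain R}"
proof -
  define \<phi> where "\<phi> x = (THE y. (x, y) \<in> R)" for x
  have \<phi>: "\<phi> x = y" if "(x, y) \<in> R" for x y
    unfolding \<phi>_def using that field_graph_unique[OF R] by (intro the_equality)
  have zero: "(0, 0) \<in> R"
    using field_graphD(2)[OF R field_graphD(1)[OF R] field_graphD(1)[OF R]] by simp
  have "hom_on (Domain R) \<phi>"
    unfolding hom_on_def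
  proof (intro conjI ballI)
    show "\<phi> 1 = 1" by (rule \<phi>) (rule field_graphD(1)[OF R])
    fix x y assume "x \<in> Domain R" "y \<in> Domain R"
    then obtain x' y' where xy: "(x, x') \<in> R" "(y, y') \<in> R" by (auto elim: DomainE)
    have "(x - (0 - y), x' - (0 - y')) \<in> R"
      by (intro field_graphD(2)[OF R] xy zero)
    then have "(x + y, x' + y') \<in> R" by simp
    then show "\<phi> (x + y) = \<phi> x + \<phi> y"
      using \<phi> xy by simp
    show "\<phi> (x * y) = \<phi> x * \<phi> y"
      using \<phi>[OF field_graphD(3)[OF R xy]] \<phi> xy by simp
  qed
  moreover have "R = {(x, \<phi> x) |x. x \<in> Domain R}"
  proof (intro equalityI subrelI)
    fix x y assume xy: "(x, y) \<in> R"
    then show "(x, y) \<in> {(x, \<phi> x) |x. x \<in> Domain R}"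
      using DomainI[OF xy] \<phi>[OF xy] by simp
  next
    fix x y assume "(x, y) \<in> {(x, \<phi> x) |x. x \<in> Domain R}"
    then have "x \<in> Domain R" "y = \<phi> x" by auto
    then obtain y' where "(x, y') \<in> R" by (auto elim: DomainE)
    then show "(x, y) \<in> R" using \<phi>[of x y'] \<open>y = \<phi> x\<close> by simp
  qed
  ultimately show ?thesis by (rule that)
qed

lemma field_graph_of_hom:
  assumes K: "subfield_set K" and \<phi>: "hom_on K \<phi>"
  shows "field_graph {(x, \<phi> x) |x. x \<in> K}"
  by (rule field_graphI)
    (auto simp: subfield_set_one[OF K] subfield_set_diff[OF K] subfield_set_mult[OF K]
      subfield_set_inverse[OF K] hom_on_one[OF K \<phi>] hom_on_diff[OF K \<phi>] hom_on_mult[OF K \<phi>]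
      hom_on_inverse[OF K \<phi>] hom_on_zero[OF K \<phi>])

lemma field_graph_Union:
  assumes ne: "\<R> \<noteq> {}" and R: "\<And>R. R \<in> \<R> \<Longrightarrow> field_graph R"
    and chain: "\<And>R S. R \<in> \<R> \<Longrightarrow> S \<in> \<R> \<Longrightarrow> R \<subseteq> S \<or> S \<subseteq> R"
  shows "field_graph (\<Union>\<R>)"
proof (rule field_graphI)
  show "(1, 1) \<in> \<Union>\<R>"
    using ne field_graphD(1)[OF R] by blast
  show "(inverse a, inverse b) \<in> \<Union>\<R>" if ab: "(a, b) \<in> \<Union>\<R>" for a b
  proof -
    obtain S where S: "S \<in> \<R>" "(a, b) \<in> S" using ab by blast
    show ?thesis using field_graphD(4)[OF R[OF S(1)] S(2)] S(1) by (rule UnionI[rotated])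
  qed
  show "b = 0" if b: "(0, b) \<in> \<Union>\<R>" for b
  proof -
    obtain S where S: "S \<in> \<R>" "(0, b) \<in> S" using b by blast
    show ?thesis by (rule field_graphD(5)[OF R[OF S(1)] S(2)])
  qed
  fix a b c d assume "(a, b) \<in> \<Union>\<R>" "(c, d) \<in> \<Union>\<R>"
  then obtain R1 R2 where R12: "R1 \<in> \<R>" "(a, b) \<in> R1" "R2 \<in> \<R>" "(c, d) \<in> R2"
    by blast
  define S where "S = R1 \<union> R2"
  have "S = R1 \<or> S = R2" unfolding S_def using chain[OF R12(1,3)] by blast
  then have S: "S \<in> \<R>" "(a, b) \<in> S" "(c, d) \<in> S"
    using R12 by (auto simp: S_def)
  show "(a - c, b - d) \<in> \<Union>\<R>"
    using field_graphD(2)[OF R[OF S(1)] S(2,3)] S(1) by (rule UnionI[rotated])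
  show "(a * c, b * d) \<in> \<Union>\<R>"
    using field_graphD(3)[OF R[OF S(1)] S(2,3)] S(1) by (rule UnionI[rotated])
qed

text \<open>
  Adjunction of one element \<open>u\<close>. Let \<open>P\<close> be the minimal polynomial of \<open>u\<close> over the domain \<open>K\<close> of \<open>\<phi>\<close>,
  and \<open>v\<close> a root of its image under \<open>\<phi>\<close>. Sending \<open>Q(u)\<close> to the value at \<open>v\<close> of the image of \<open>Q\<close> is well defined
  since \<open>P\<close> divides over \<open>K\<close> every polynomial that vanishes at \<open>u\<close>.
\<close>
lemma field_graph_extend:
  fixes u :: "'a::field alg_closure"
  assumes R: "field_graph R" and base: "\<And>c. c \<in> base_field \<Longrightarrow> (c, c) \<in> R"
  shows "\<exists>R'. field_graph R' \<and> R \<subseteq> R' \<and> u \<in> Domain R'"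
proof -
  define K where "K = Domain R"
  have K: "subfield_set K" unfolding K_def by (rule subfield_set_Domain[OF R])
  obtain \<phi> where \<phi>: "hom_on K \<phi>" and R_eq: "R = {(x, \<phi> x) |x. x \<in> K}"
    unfolding K_def by (rule field_graph_hom[OF R])
  have R_iff: "(x, y) \<in> R \<longleftrightarrow> x \<in> K \<and> y = \<phi> x" for x y
    by (subst R_eq) auto
  have base_K: "base_field \<subseteq> K" and base_\<phi>: "\<And>c. c \<in> base_field \<Longrightarrow> \<phi> c = c"
    using base R_iff by auto
  obtain f where f: "f \<in> polys_over base_field" "f \<noteq> 0" "poly f u = 0"
    by (rule algebraic_over_base_field)
  have fK: "f \<in> polys_over K" using subsetD[OF polys_over_mono[OF base_K] f(1)] .
  obtain P where P: "P \<in> polys_over K" "Polynomial.lead_coeff P = 1" "poly P u = 0"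
    "\<And>Q. Q \<in> polys_over K \<Longrightarrow> poly Q u = 0 \<Longrightarrow> \<exists>A\<in>polys_over K. Q = P * A"
    using minimal_polynomial_over[OF K fK f(2,3)] by blast
  have deg: "Polynomial.degree P > 0"
  proof (rule ccontr)
    assume "\<not> ?thesis"
    then obtain c where "P = [:c:]" by (metis degree_eq_zeroE not_gr0)
    then show False using P(2,3) by auto
  qed
  have "Polynomial.degree (map_poly \<phi> P) = Polynomial.degree P"
    by (rule map_poly_degree_eq) (simp add: P(2) hom_on_one[OF K \<phi>])
  then obtain v where v: "poly (map_poly \<phi> P) v = 0"
    using alg_closed_imp_poly_has_root[of "map_poly \<phi> P"] deg by auto
  have zero_v: "poly (map_poly \<phi> Q) v = 0" if "Q \<in> polys_over K" "poly Q u = 0" for Q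
  proof -
    obtain A where "A \<in> polys_over K" "Q = P * A" using P(4) \<open>Q \<in> polys_over K\<close> \<open>poly Q u = 0\<close> by blast
    then show ?thesis using v by (simp add: map_poly_hom_mult[OF K \<phi> P(1)])
  qed
  define R' where "R' = {(poly Q u, poly (map_poly \<phi> Q) v) |Q. Q \<in> polys_over K}"
  have R'I: "(a, b) \<in> R'" if "Q \<in> polys_over K" "a = poly Q u" "b = poly (map_poly \<phi> Q) v" for Q a b
    unfolding R'_def using that by blast
  have const: "(c, \<phi> c) \<in> R'" if "c \<in> K" for c
    by (rule R'I[OF polys_over_const[OF K that]]) (simp_all add: map_poly_pCons hom_on_zero[OF K \<phi>])
  have "field_graph R'"
  proof (rule field_graphI)
    show "(1, 1) \<in> R'" using const[OF subfield_set_one[OF K]] by (simp add: hom_on_one[OF K \<phi>])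
    show "b = 0" if "(0, b) \<in> R'" for b
      using that zero_v unfolding R'_def by auto
    fix a b assume "(a, b) \<in> R'"
    then obtain Q where Q: "Q \<in> polys_over K" "a = poly Q u" "b = poly (map_poly \<phi> Q) v"
      unfolding R'_def by blast
    \<comment> \<open>The inverse of \<open>a\<close> is a polynomial in \<open>a\<close> over \<open>F\<close>, hence of the form \<open>H(u)\<close>; then
        \<open>Q H - 1\<close> vanishes at \<open>u\<close>, and its image vanishes at \<open>v\<close>.\<close>
    show "(inverse a, inverse b) \<in> R'"
    proof (cases "a = 0")
      case True
      then have "b = 0" using zero_v Q by simp
      with True const[OF subfield_set_zero[OF K]] show ?thesis by (simp add: hom_on_zero[OF K \<phi>])
    next
      case False
      obtain h where h: "inverse a = poly (ac_poly h) a" using inverse_eq_poly by blast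
      have hK: "ac_poly h \<in> polys_over K"
        by (rule subsetD[OF polys_over_mono[OF base_K]]) (simp add: polys_over_base_field)
      define H where "H = pcompose (ac_poly h) Q"
      have H: "H \<in> polys_over K" unfolding H_def by (rule polys_over_pcompose[OF K hK Q(1)])
      have Hu: "poly H u = inverse a" by (simp add: H_def poly_pcompose h flip: Q(2))
      have "poly (map_poly \<phi> (Q * H - 1)) v = 0"
      proof (rule zero_v)
        show "Q * H - 1 \<in> polys_over K"
          by (intro polys_over_diff[OF K] polys_over_mult[OF K] Q(1) H polys_over_1[OF K])
        show "poly (Q * H - 1) u = 0" using Hu Q(2) False by simp
      qed
      then have "b * poly (map_poly \<phi> H) v = 1"
        using Q H by (simp add: map_poly_hom_diff[OF K \<phi>] map_poly_hom_mult[OF K \<phi>] polys_over_mult[OF K]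
            polys_over_1[OF K] hom_on_one[OF K \<phi>])
      then have "inverse b = poly (map_poly \<phi> H) v" by (rule inverse_unique)
      then show ?thesis using R'I[OF H] Hu by simp
    qed
    fix c d assume "(c, d) \<in> R'"
    then obtain S where S: "S \<in> polys_over K" "c = poly S u" "d = poly (map_poly \<phi> S) v"
      unfolding R'_def by blast
    show "(a - c, b - d) \<in> R'"
      by (rule R'I[OF polys_over_diff[OF K Q(1) S(1)]])
        (simp_all add: Q S map_poly_hom_diff[OF K \<phi>])
    show "(a * c, b * d) \<in> R'"
      by (rule R'I[OF polys_over_mult[OF K Q(1) S(1)]])
        (simp_all add: Q S map_poly_hom_mult[OF K \<phi>])
  qed
  moreover have "R \<subseteq> R'" using R_iff const by auto
  moreover have "(u, v) \<in> R'"
    by (rule R'I[of "[:0, 1:]"])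
      (simp_all add: polys_over_pCons[OF K] polys_over_const[OF K] subfield_set_zero[OF K]
        subfield_set_one[OF K] map_poly_pCons hom_on_zero[OF K \<phi>] hom_on_one[OF K \<phi>] polys_over_0[OF K])
  then have "u \<in> Domain R'" by (rule DomainI)
  ultimately show ?thesis by blast
qed

lemma extend_hom_to_alg_closure:
  fixes \<sigma> :: "'a::field alg_closure \<Rightarrow> 'a alg_closure"
  assumes K: "subfield_set K" "base_field \<subseteq> K" and \<sigma>: "hom_on K \<sigma>" "\<And>c. c \<in> base_field \<Longrightarrow> \<sigma> c = c"
  obtains \<tau> where "hom_on UNIV \<tau>" "\<And>x. x \<in> K \<Longrightarrow> \<tau> x = \<sigma> x"
proof -
  define R0 where "R0 = {(x, \<sigma> x) |x. x \<in> K}"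
  have R0: "field_graph R0" unfolding R0_def by (rule field_graph_of_hom[OF K(1) \<sigma>(1)])
  let ?A = "{R. field_graph R \<and> R0 \<subseteq> R}"
  have "\<exists>M\<in>?A. \<forall>R\<in>?A. M \<subseteq> R \<longrightarrow> R = M"
  proof (rule subset_Zorn_nonempty)
    show "?A \<noteq> {}" using R0 by blast
    fix C assume C: "C \<noteq> {}" "subset.chain ?A C"
    then have C': "C \<subseteq> ?A" "\<forall>R\<in>C. \<forall>S\<in>C. R \<subseteq> S \<or> S \<subseteq> R"
      unfolding subset_chain_def by auto
    have "field_graph (\<Union>C)"
    proof (rule field_graph_Union[OF C(1)])
      show "field_graph R" if "R \<in> C" for R
        using subsetD[OF C'(1) that] by simp
      show "R \<subseteq> S \<or> S \<subseteq> R" if "R \<in> C" "S \<in> C" for R S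
        using C'(2) that by simp
    qed
    moreover have "R0 \<subseteq> \<Union>C"
    proof -
      obtain S where S: "S \<in> C" using C(1) by blast
      then have "R0 \<subseteq> S" using subsetD[OF C'(1) S] by simp
      then show ?thesis using S by blast
    qed
    ultimately show "\<Union>C \<in> ?A" by simp
  qed
  then obtain M where MA: "M \<in> ?A" and M_max: "\<forall>R\<in>?A. M \<subseteq> R \<longrightarrow> R = M"
    by (rule bexE)
  have M: "field_graph M" "R0 \<subseteq> M" using MA by auto
  have max: "R = M" if "field_graph R" "M \<subseteq> R" for R
    using bspec[OF M_max, of R] that order_trans[OF M(2) that(2)] by simp
  have base: "(c, c) \<in> M" if "c \<in> base_field" for c
  proof -
    have "(c, \<sigma> c) \<in> R0" unfolding R0_def using that K(2) by blast
    then show ?thesis using M(2) \<sigma>(2)[OF that] by auto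
  qed
  have dom: "u \<in> Domain M" for u
  proof -
    obtain R' where R': "field_graph R'" "M \<subseteq> R'" "u \<in> Domain R'"
      using field_graph_extend[OF M(1) base, of u] by auto
    then show ?thesis using max[OF R'(1,2)] by simp
  qed
  then have D: "Domain M = UNIV" using dom by (intro equalityI subsetI UNIV_I)
  obtain \<tau> where \<tau>: "hom_on UNIV \<tau>" "M = {(x, \<tau> x) |x. x \<in> UNIV}"
    by (rule field_graph_hom[OF M(1), unfolded D])
  have "\<tau> x = \<sigma> x" if "x \<in> K" for x
  proof -
    have "(x, \<sigma> x) \<in> M" using that M(2) by (auto simp: R0_def)
    then show ?thesis unfolding \<tau>(2) by simp
  qed
  with \<tau>(1) show ?thesis by (rule that)
qed

lemma subfield_set_UNIV: "subfield_set UNIV"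
  by (rule subfield_setI) auto

lemma map_poly_fixed:
  assumes "P \<in> polys_over K" "\<And>c. c \<in> K \<Longrightarrow> \<tau> c = c" "\<tau> 0 = 0"
  shows "map_poly \<tau> P = P"
  using assms by (intro poly_eqI) (auto simp: coeff_map_poly polys_over_def)

lemma hom_fixing_base_poly:
  assumes L: "subfield_set L" "base_field \<subseteq> L" and \<tau>: "hom_on L \<tau>" "\<And>c. c \<in> base_field \<Longrightarrow> \<tau> c = c"
    and P: "P \<in> polys_over base_field" and x: "x \<in> L"
  shows "poly P (\<tau> x) = \<tau> (poly P x)"
proof -
  have "map_poly \<tau> P = P" by (rule map_poly_fixed[OF P \<tau>(2)]) (simp_all add: hom_on_zero[OF L(1) \<tau>(1)])
  then show ?thesis
    using poly_map_poly_hom[OF L(1) \<tau>(1) _ x, of P] polys_over_mono[OF L(2)] P by auto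
qed

text \<open>
  Surjectivity holds because an injective map permutes the finite set of roots of each polynomial over
  \<open>F\<close>.
\<close>
lemma bij_betw_sep_closure:
  fixes \<tau> :: "'a::field alg_closure \<Rightarrow> 'a alg_closure"
  assumes \<tau>: "hom_on UNIV \<tau>" "\<And>c. c \<in> base_field \<Longrightarrow> \<tau> c = c"
  shows "bij_betw \<tau> sep_closure sep_closure"
proof -
  have P: "poly f (\<tau> x) = \<tau> (poly f x)" if "f \<in> polys_over base_field" for f x
    by (rule hom_fixing_base_poly[OF subfield_set_UNIV _ \<tau>(1)]) (simp_all add: \<tau>(2) that)
  have zero: "\<tau> x = 0 \<longleftrightarrow> x = 0" for x
    by (rule hom_on_eq_0_iff[OF subfield_set_UNIV \<tau>(1)]) simp
  have inj: "inj \<tau>" by (rule hom_on_inj[OF subfield_set_UNIV \<tau>(1)])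
  have root: "poly f (\<tau> x) = 0 \<longleftrightarrow> poly f x = 0" if "f \<in> polys_over base_field" for f x
    using P[OF that] zero by simp
  have sep: "\<tau> x \<in> sep_closure \<longleftrightarrow> x \<in> sep_closure" for x
    unfolding mem_sep_closure_iff
  proof (intro bex_cong conj_cong refl)
    fix f :: "'a alg_closure poly" assume f: "f \<in> polys_over base_field"
    show "poly f (\<tau> x) = 0 \<longleftrightarrow> poly f x = 0" by (rule root[OF f])
    show "poly (pderiv f) (\<tau> x) \<noteq> 0 \<longleftrightarrow> poly (pderiv f) x \<noteq> 0"
      using root[OF polys_over_pderiv[OF subfield_set_base_field f]] by simp
  qed
  have surj: "y \<in> range \<tau>" for y
  proof -
    obtain f where f: "f \<in> polys_over base_field" "f \<noteq> 0" "poly f y = 0"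
      by (rule algebraic_over_base_field)
    let ?Z = "{z. poly f z = 0}"
    have "finite ?Z" using f(2) by (rule poly_roots_finite)
    moreover have "\<tau> ` ?Z \<subseteq> ?Z" using root[OF f(1)] by auto
    ultimately have "\<tau> ` ?Z = ?Z"
      using card_image[OF inj_on_subset[OF inj subset_UNIV], of ?Z] by (rule card_subset_eq)
    then show ?thesis using f(3) by blast
  qed
  have "\<tau> ` sep_closure = sep_closure"
  proof (intro equalityI subsetI)
    fix y :: "'a alg_closure" assume "y \<in> sep_closure"
    moreover obtain x where "y = \<tau> x" using surj by (rule rangeE)
    ultimately show "y \<in> \<tau> ` sep_closure" using sep by auto
  qed (use sep in auto)
  then show ?thesis using inj_on_subset[OF inj subset_UNIV] by (simp add: bij_betw_def)
qed

section \<open>Galois groups and the Krull topology\<close>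

lemma galois_group_simps:
  "mult (galois_group L K) = mult (BijGroup L)"
  "one (galois_group L K) = one (BijGroup L)"
  by (simp_all add: galois_group_def)

lemma mem_galois_group_iff:
  "\<sigma> \<in> carrier (galois_group L K) \<longleftrightarrow>
     \<sigma> \<in> Bij L \<and> (\<forall>x\<in>L. \<forall>y\<in>L. \<sigma> (x + y) = \<sigma> x + \<sigma> y \<and> \<sigma> (x * y) = \<sigma> x * \<sigma> y) \<and> (\<forall>x\<in>K. \<sigma> x = x)"
  by (simp add: galois_group_def)

lemma galois_group_apply_mult:
  assumes "\<sigma> \<in> carrier (galois_group L K)" "\<tau> \<in> carrier (galois_group L K)" "x \<in> L"
  shows "(\<sigma> \<otimes>\<^bsub>galois_group L K\<^esub> \<tau>) x = \<sigma> (\<tau> x)"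
  using assms by (simp add: galois_group_simps BijGroup_def mem_galois_group_iff compose_def)

lemma galois_group_apply_one: "x \<in> L \<Longrightarrow> \<one>\<^bsub>galois_group L K\<^esub> x = x"
  by (simp add: galois_group_simps BijGroup_def)

lemma galois_group_bij: "\<sigma> \<in> carrier (galois_group L K) \<Longrightarrow> bij_betw \<sigma> L L"
  by (simp add: mem_galois_group_iff Bij_def)

lemma galois_group_closed: "\<sigma> \<in> carrier (galois_group L K) \<Longrightarrow> x \<in> L \<Longrightarrow> \<sigma> x \<in> L"
  by (rule bij_betwE[OF galois_group_bij, rule_format])

lemma galois_group_fixes: "\<sigma> \<in> carrier (galois_group L K) \<Longrightarrow> x \<in> K \<Longrightarrow> \<sigma> x = x"
  by (simp add: mem_galois_group_iff)

lemma galois_group_mono: "K \<subseteq> K' \<Longrightarrow> carrier (galois_group L K') \<subseteq> carrier (galois_group L K)"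
proof
  fix \<sigma> assume K: "K \<subseteq> K'" and \<sigma>: "\<sigma> \<in> carrier (galois_group L K')"
  have "\<sigma> x = x" if "x \<in> K" for x
    by (rule galois_group_fixes[OF \<sigma> subsetD[OF K that]])
  then show "\<sigma> \<in> carrier (galois_group L K)"
    using \<sigma> by (simp add: mem_galois_group_iff)
qed

text \<open>
  The membership condition says nothing about \<open>1\<close>; its image is a nonzero idempotent.
\<close>
lemma galois_group_hom_on:
  assumes L: "subfield_set L" and \<sigma>: "\<sigma> \<in> carrier (galois_group L K)"
  shows "hom_on L \<sigma>"
proof -
  have hom: "\<sigma> (x + y) = \<sigma> x + \<sigma> y" "\<sigma> (x * y) = \<sigma> x * \<sigma> y" if "x \<in> L" "y \<in> L" for x y
    using \<sigma> that by (simp_all add: mem_galois_group_iff)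
  have zero: "0 \<in> L" and one: "1 \<in> L"
    using subfield_set_zero[OF L] subfield_set_one[OF L] .
  have "\<sigma> 0 = 0" using hom(1)[OF zero zero] by (simp only: add_0_left add_cancel_right_right)
  then have "\<sigma> 1 \<noteq> 0"
    using inj_onD[OF bij_betw_imp_inj_on[OF galois_group_bij[OF \<sigma>]] _ one zero] by auto
  moreover have "\<sigma> 1 * \<sigma> 1 = \<sigma> 1" using hom(2)[OF one one] by simp
  ultimately have "\<sigma> 1 = 1" by simp
  then show ?thesis using hom by (simp add: hom_on_def)
qed

lemma restrict_mem_galois_group:
  assumes L: "subfield_set L" "K \<subseteq> L" and \<tau>: "bij_betw \<tau> L L" "hom_on L \<tau>" "\<And>x. x \<in> K \<Longrightarrow> \<tau> x = x"
  shows "restrict \<tau> L \<in> carrier (galois_group L K)"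
  unfolding mem_galois_group_iff
proof (intro conjI ballI)
  show "restrict \<tau> L \<in> Bij L" using \<tau>(1) by (simp add: Bij_def)
  fix x y assume "x \<in> L" "y \<in> L"
  then show "restrict \<tau> L (x + y) = restrict \<tau> L x + restrict \<tau> L y"
    "restrict \<tau> L (x * y) = restrict \<tau> L x * restrict \<tau> L y"
    by (simp_all add: subfield_set_add[OF L(1)] subfield_set_mult[OF L(1)] hom_on_add[OF L(1) \<tau>(2)]
        hom_on_mult[OF L(1) \<tau>(2)])
next
  fix x assume "x \<in> K"
  then show "restrict \<tau> L x = x" using L(2) \<tau>(3) by auto
qed

lemma subgroup_galois_group_Bij:
  assumes L: "subfield_set L" and K: "K \<subseteq> L"
  shows "subgroup (carrier (galois_group L K)) (BijGroup L)"
proof (rule group.subgroupI[OF group_BijGroup])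
  show "carrier (galois_group L K) \<subseteq> carrier (BijGroup L)"
    by (auto simp: mem_galois_group_iff BijGroup_def)
  have "restrict id L \<in> carrier (galois_group L K)"
    by (rule restrict_mem_galois_group[OF L K]) (simp_all add: hom_on_def)
  then show "carrier (galois_group L K) \<noteq> {}" by (simp only: ex_in_conv[symmetric]) (rule exI)
  fix \<sigma> assume \<sigma>: "\<sigma> \<in> carrier (galois_group L K)"
  have \<sigma>B: "\<sigma> \<in> Bij L" using \<sigma> by (simp add: mem_galois_group_iff)
  note bij = galois_group_bij[OF \<sigma>] and hom = galois_group_hom_on[OF L \<sigma>]
  let ?i = "inv_into L \<sigma>"
  have i: "?i x \<in> L" "\<sigma> (?i x) = x" if "x \<in> L" for x
    using that bij by (auto simp: bij_betw_def inv_into_into f_inv_into_f)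
  have iI: "?i x = y" if "y \<in> L" "\<sigma> y = x" for x y
    using that bij by (auto simp: bij_betw_def)
  have "restrict ?i L \<in> carrier (galois_group L K)"
  proof (rule restrict_mem_galois_group[OF L K])
    show "bij_betw ?i L L" by (rule bij_betw_inv_into[OF bij])
    show "?i x = x" if "x \<in> K" for x
      using that K galois_group_fixes[OF \<sigma> that] by (intro iI) auto
    show "hom_on L ?i"
      unfolding hom_on_def
    proof (intro conjI ballI)
      show "?i 1 = 1" by (intro iI subfield_set_one[OF L] hom_on_one[OF L hom])
      fix x y assume xy: "x \<in> L" "y \<in> L"
      show "?i (x + y) = ?i x + ?i y"
        using i[OF xy(1)] i[OF xy(2)] by (intro iI) (simp_all add: subfield_set_add[OF L] hom_on_add[OF L hom])
      show "?i (x * y) = ?i x * ?i y"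
        using i[OF xy(1)] i[OF xy(2)] by (intro iI) (simp_all add: subfield_set_mult[OF L] hom_on_mult[OF L hom])
    qed
  qed
  then show "m_inv (BijGroup L) \<sigma> \<in> carrier (galois_group L K)"
    using inv_BijGroup[OF \<sigma>B] by simp
  fix \<tau> assume \<tau>: "\<tau> \<in> carrier (galois_group L K)"
  note bij' = galois_group_bij[OF \<tau>] and hom' = galois_group_hom_on[OF L \<tau>]
  have "restrict (\<sigma> \<circ> \<tau>) L \<in> carrier (galois_group L K)"
  proof (rule restrict_mem_galois_group[OF L K])
    show "bij_betw (\<sigma> \<circ> \<tau>) L L" by (rule bij_betw_trans[OF bij' bij])
    show "hom_on L (\<sigma> \<circ> \<tau>)"
      using galois_group_closed[OF \<tau>]
      by (simp add: hom_on_def hom_on_one[OF L hom] hom_on_one[OF L hom'] hom_on_add[OF L hom] hom_on_add[OF L hom']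
          hom_on_mult[OF L hom] hom_on_mult[OF L hom'])
    show "(\<sigma> \<circ> \<tau>) x = x" if "x \<in> K" for x
      using galois_group_fixes[OF \<sigma> that] galois_group_fixes[OF \<tau> that] by simp
  qed
  moreover have "mult (BijGroup L) \<sigma> \<tau> = restrict (\<sigma> \<circ> \<tau>) L"
    using \<sigma> \<tau> by (simp add: BijGroup_def mem_galois_group_iff compose_def comp_def)
  ultimately show "mult (BijGroup L) \<sigma> \<tau> \<in> carrier (galois_group L K)" by simp
qed

lemma galois_group_eq_restrict: "galois_group L K' = (galois_group L K)\<lparr>carrier := carrier (galois_group L K')\<rparr>"
  by (simp add: galois_group_def)

lemma group_galois_group:
  assumes L: "subfield_set L" and K: "K \<subseteq> L"
  shows "group (galois_group L K)"
proof -
  have "galois_group L K = (BijGroup L)\<lparr>carrier := carrier (galois_group L K)\<rparr>"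
    by (simp add: galois_group_def)
  then show ?thesis
    using group.subgroup_imp_group[OF group_BijGroup subgroup_galois_group_Bij[OF L K]] by simp
qed

lemma subgroup_galois_group:
  assumes L: "subfield_set L" and K: "K \<subseteq> K'" "K' \<subseteq> L"
  shows "subgroup (carrier (galois_group L K')) (galois_group L K)"
proof -
  have KL: "K \<subseteq> L" using K by (rule order_trans)
  have "galois_group L K = (BijGroup L)\<lparr>carrier := carrier (galois_group L K)\<rparr>"
    by (simp add: galois_group_def)
  then show ?thesis
    using group.subgroup_incl[OF group_BijGroup subgroup_galois_group_Bij[OF L K(2)]
        subgroup_galois_group_Bij[OF L KL] galois_group_mono[OF K(1)]] by simp
qed

context
  fixes L K :: "'b::field set"
  assumes L: "subfield_set L" and K: "K \<subseteq> L"
begin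

interpretation G: group "galois_group L K" by (rule group_galois_group[OF L K])

lemma galois_group_apply_pow:
  assumes \<sigma>: "\<sigma> \<in> carrier (galois_group L K)" and x: "x \<in> L"
  shows "(\<sigma> [^]\<^bsub>galois_group L K\<^esub> (n::nat)) x = (\<sigma> ^^ n) x"
proof (induction n)
  case 0
  show ?case using galois_group_apply_one[OF x] by simp
next
  case (Suc n)
  have "(\<sigma> [^]\<^bsub>galois_group L K\<^esub> Suc n) x = (\<sigma> \<otimes>\<^bsub>galois_group L K\<^esub> \<sigma> [^]\<^bsub>galois_group L K\<^esub> n) x"
    by (simp only: G.nat_pow_Suc2[OF \<sigma>])
  also have "\<dots> = \<sigma> ((\<sigma> [^]\<^bsub>galois_group L K\<^esub> n) x)"
    by (rule galois_group_apply_mult[OF \<sigma> G.nat_pow_closed[OF \<sigma>] x])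
  finally show ?case using Suc by simp
qed

lemma galois_group_apply_inv:
  assumes \<sigma>: "\<sigma> \<in> carrier (galois_group L K)" and x: "x \<in> L"
  shows "(inv\<^bsub>galois_group L K\<^esub> \<sigma>) (\<sigma> x) = x" and "\<sigma> ((inv\<^bsub>galois_group L K\<^esub> \<sigma>) x) = x"
proof -
  have "(inv\<^bsub>galois_group L K\<^esub> \<sigma> \<otimes>\<^bsub>galois_group L K\<^esub> \<sigma>) x = x"
    unfolding G.l_inv[OF \<sigma>] by (rule galois_group_apply_one[OF x])
  then show "(inv\<^bsub>galois_group L K\<^esub> \<sigma>) (\<sigma> x) = x"
    by (simp only: galois_group_apply_mult[OF G.inv_closed[OF \<sigma>] \<sigma> x])
  have "(\<sigma> \<otimes>\<^bsub>galois_group L K\<^esub> inv\<^bsub>galois_group L K\<^esub> \<sigma>) x = x"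
    unfolding G.r_inv[OF \<sigma>] by (rule galois_group_apply_one[OF x])
  then show "\<sigma> ((inv\<^bsub>galois_group L K\<^esub> \<sigma>) x) = x"
    by (simp only: galois_group_apply_mult[OF \<sigma> G.inv_closed[OF \<sigma>] x])
qed

lemma galois_group_coset:
  assumes \<sigma>: "\<sigma> \<in> carrier (galois_group L K)" and M: "K \<subseteq> M" "M \<subseteq> L"
  shows "\<sigma> <#\<^bsub>galois_group L K\<^esub> carrier (galois_group L M) =
           {\<tau> \<in> carrier (galois_group L K). \<forall>x\<in>M. \<tau> x = \<sigma> x}"
proof (intro equalityI subsetI)
  fix \<tau> assume "\<tau> \<in> \<sigma> <#\<^bsub>galois_group L K\<^esub> carrier (galois_group L M)"
  then obtain h where h: "h \<in> carrier (galois_group L M)" "\<tau> = \<sigma> \<otimes>\<^bsub>galois_group L K\<^esub> h"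
    unfolding l_coset_def by auto
  have h': "h \<in> carrier (galois_group L K)" using subsetD[OF galois_group_mono[OF M(1)] h(1)] .
  have "\<tau> x = \<sigma> x" if "x \<in> M" for x
    using galois_group_apply_mult[OF \<sigma> h', of x] galois_group_fixes[OF h(1) that] subsetD[OF M(2) that] h(2)
    by simp
  then show "\<tau> \<in> {\<tau> \<in> carrier (galois_group L K). \<forall>x\<in>M. \<tau> x = \<sigma> x}"
    using h(2) G.m_closed[OF \<sigma> h'] by simp
next
  fix \<tau> assume "\<tau> \<in> {\<tau> \<in> carrier (galois_group L K). \<forall>x\<in>M. \<tau> x = \<sigma> x}"
  then have \<tau>: "\<tau> \<in> carrier (galois_group L K)" "\<And>x. x \<in> M \<Longrightarrow> \<tau> x = \<sigma> x" by auto
  define h where "h = inv\<^bsub>galois_group L K\<^esub> \<sigma> \<otimes>\<^bsub>galois_group L K\<^esub> \<tau>"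
  have hK: "h \<in> carrier (galois_group L K)" unfolding h_def using \<sigma> \<tau>(1) by simp
  have "h x = x" if "x \<in> M" for x
    using galois_group_apply_mult[OF G.inv_closed[OF \<sigma>] \<tau>(1) subsetD[OF M(2) that]]
      galois_group_apply_inv(1)[OF \<sigma> subsetD[OF M(2) that]] \<tau>(2)[OF that] by (simp add: h_def)
  then have "h \<in> carrier (galois_group L M)" using hK by (simp add: mem_galois_group_iff)
  moreover have "\<tau> = \<sigma> \<otimes>\<^bsub>galois_group L K\<^esub> h"
    unfolding h_def using \<sigma> \<tau>(1) by (simp add: G.m_assoc[symmetric])
  ultimately show "\<tau> \<in> \<sigma> <#\<^bsub>galois_group L K\<^esub> carrier (galois_group L M)"
    unfolding l_coset_def by auto
qed

end

text \<open>
  Connects the two encodings of polynomials: coefficient lists with the leading coefficient first, and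
  the polynomial type.
\<close>
lemma poly_list_eval:
  "ring.eval (ring_of_type_algebra :: 'b::field ring) xs x = poly (Poly (rev xs)) x"
proof -
  interpret field "ring_of_type_algebra :: 'b ring" by (rule field_ring_of_type_algebra)
  have pow: "x [^]\<^bsub>ring_of_type_algebra\<^esub> (n::nat) = x ^ n" for n
    by (induction n) (simp_all add: ring_of_type_algebra_simps nat_pow_def mult.commute)
  show ?thesis
    by (induction xs) (simp_all add: ring_of_type_algebra_simps pow Poly_append poly_monom)
qed

text \<open>
  Adjoin the elements of \<open>S\<close> one after the other; they are algebraic over \<open>F\<close>, hence over \<open>K\<close>.
\<close>
lemma finite_extension_in_sep_closure:
  fixes S :: "'a::field alg_closure set"
  assumes K: "subfield_set K" "base_field \<subseteq> K" "K \<subseteq> sep_closure" and S: "finite S" "S \<subseteq> sep_closure"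
  shows "\<exists>M. subfield M ring_of_type_algebra \<and> K \<subseteq> M \<and> M \<subseteq> sep_closure \<and> S \<subseteq> M \<and>
           ring.finite_dimension ring_of_type_algebra K M"
proof -
  interpret R: field "ring_of_type_algebra :: 'a alg_closure ring" by (rule field_ring_of_type_algebra)
  have alg: "(R.algebraic over K) x" for x
  proof -
    obtain f where f: "f \<in> polys_over base_field" "f \<noteq> 0" "poly f x = 0"
      by (rule algebraic_over_base_field)
    have "rev (coeffs f) \<in> carrier (univ_poly ring_of_type_algebra K)"
      using f(1,2) K(2)
      by (auto simp: univ_poly_def polynomial_def ring_of_type_algebra_simps hd_rev last_coeffs_eq_coeff_degree
          polys_over_def coeffs_def split: if_splits)
    then show ?thesis
      by (rule R.algebraicI) (simp_all add: f poly_list_eval ring_of_type_algebra_simps)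
  qed
  obtain xs where xs: "set xs = S" using finite_list[OF S(1)] by blast
  have carr: "set xs \<subseteq> carrier (ring_of_type_algebra :: 'a alg_closure ring)"
    by (simp add: ring_of_type_algebra_simps)
  have Kf: "subfield K (ring_of_type_algebra :: 'a alg_closure ring)"
    using K(1) by (simp add: subfield_ring_of_type_algebra_iff)
  have sr: "subring sep_closure (ring_of_type_algebra :: 'a alg_closure ring)"
    by (rule subfieldE(1)) (simp add: subfield_ring_of_type_algebra_iff subfield_set_sep_closure)
  show ?thesis
  proof (intro exI conjI)
    show "subfield (R.finite_extension K xs) ring_of_type_algebra"
      by (rule R.finite_extension_is_subfield[OF Kf carr alg])
    show "K \<subseteq> R.finite_extension K xs"
      by (rule R.finite_extension_incl[OF subfieldE(3)[OF Kf] carr])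
    show "R.finite_extension K xs \<subseteq> sep_closure"
      by (rule R.finite_extension_subring_incl[OF sr K(3)]) (simp add: xs S(2))
    show "S \<subseteq> R.finite_extension K xs"
      using R.finite_extension_mem[OF subfieldE(1)[OF Kf] carr] xs by simp
    show "R.finite_dimension K (R.finite_extension K xs)"
      by (rule R.finite_extension_finite_dimension(1)[OF Kf carr alg])
  qed
qed

lemma Span_subset:
  fixes V :: "'b::field set"
  assumes "0 \<in> V" "\<And>k a v. k \<in> K \<Longrightarrow> a \<in> V \<Longrightarrow> v \<in> V \<Longrightarrow> k * a + v \<in> V" "set Us \<subseteq> V"
  shows "ring.Span ring_of_type_algebra K Us \<subseteq> V"
proof -
  interpret R: field "ring_of_type_algebra :: 'b ring" by (rule field_ring_of_type_algebra)
  show ?thesis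
    using assms(3)
  proof (induction Us)
    case Nil
    then show ?case using assms(1) by (simp add: ring_of_type_algebra_simps)
  next
    case (Cons u Us)
    show ?case
    proof
      fix x assume "x \<in> R.Span K (u # Us)"
      then obtain k v where "k \<in> K" "v \<in> R.Span K Us" "x = k * u + v"
        by (auto simp: R.line_extension_mem_iff ring_of_type_algebra_simps)
      then show "x \<in> V" using Cons assms(2) by auto
    qed
  qed
qed

text \<open>
  For \<open>S\<close> take a basis of \<open>M\<close> over \<open>K\<close>.
\<close>
lemma finite_dimension_agree:
  assumes L: "subfield_set L" and K: "subfield_set K" and KM: "K \<subseteq> M" "M \<subseteq> L"
    and fin: "ring.finite_dimension ring_of_type_algebra K M"
  shows "\<exists>S. finite S \<and> S \<subseteq> M \<and> (\<forall>\<sigma>\<in>carrier (galois_group L K). \<forall>\<tau>\<in>carrier (galois_group L K).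
           (\<forall>x\<in>S. \<tau> x = \<sigma> x) \<longrightarrow> (\<forall>x\<in>M. \<tau> x = \<sigma> x))"
proof -
  interpret R: field "ring_of_type_algebra :: 'a ring" by (rule field_ring_of_type_algebra)
  have Kf: "subfield K (ring_of_type_algebra :: 'a ring)"
    using K(1) by (simp add: subfield_ring_of_type_algebra_iff)
  obtain n where "R.dimension n K M" using fin by (auto elim: R.finite_dimensionE')
  then obtain Us where Us: "R.Span K Us = M" "set Us \<subseteq> carrier ring_of_type_algebra"
    using R.exists_base[OF Kf] by blast
  have sub: "set Us \<subseteq> M" using R.Span_base_incl[OF Kf Us(2)] Us(1) by simp
  show ?thesis
  proof (intro exI conjI ballI impI)
    show "finite (set Us)" "set Us \<subseteq> M" using sub by simp_all
    fix \<sigma> \<tau> x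
    assume \<sigma>: "\<sigma> \<in> carrier (galois_group L K)" and \<tau>: "\<tau> \<in> carrier (galois_group L K)"
      and eq: "\<forall>x\<in>set Us. \<tau> x = \<sigma> x" and x: "x \<in> M"
    note h = galois_group_hom_on[OF L \<sigma>] galois_group_hom_on[OF L \<tau>]
    have KL: "k \<in> L" if "k \<in> K" for k using that KM by blast
    have "R.Span K Us \<subseteq> {x \<in> L. \<tau> x = \<sigma> x}"
    proof (rule Span_subset)
      show "0 \<in> {x \<in> L. \<tau> x = \<sigma> x}"
        by (simp add: subfield_set_zero[OF L] hom_on_zero[OF L h(1)] hom_on_zero[OF L h(2)])
      show "set Us \<subseteq> {x \<in> L. \<tau> x = \<sigma> x}" using sub KM eq by auto
      fix k a v assume "k \<in> K" "a \<in> {x \<in> L. \<tau> x = \<sigma> x}" "v \<in> {x \<in> L. \<tau> x = \<sigma> x}"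
      then show "k * a + v \<in> {x \<in> L. \<tau> x = \<sigma> x}"
        using galois_group_fixes[OF \<sigma>, of k] galois_group_fixes[OF \<tau>, of k] KL[of k]
        by (simp add: subfield_set_add[OF L] subfield_set_mult[OF L] hom_on_add[OF L h(1)] hom_on_add[OF L h(2)]
            hom_on_mult[OF L h(1)] hom_on_mult[OF L h(2)])
    qed
    then show "\<tau> x = \<sigma> x" using Us(1) x by auto
  qed
qed

text \<open>
  A coset of the group that fixes \<open>M\<close> consists of the automorphisms that agree with a given one on \<open>M\<close>.
  For \<open>M\<close> finite over \<open>K\<close> this is agreement on a finite set, and conversely every finite set lies in such
  an \<open>M\<close>. In this form continuity statements need no further mention of intermediate fields.
\<close>
theorem openin_krull_topology_iff:
  fixes K :: "'a::field alg_closure set"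
  assumes K: "subfield_set K" "base_field \<subseteq> K" "K \<subseteq> sep_closure"
  shows "openin (krull_topology sep_closure K) U \<longleftrightarrow>
     U \<subseteq> carrier (galois_group sep_closure K) \<and>
     (\<forall>\<sigma>\<in>U. \<exists>S. finite S \<and> S \<subseteq> sep_closure \<and>
        {\<tau> \<in> carrier (galois_group sep_closure K). \<forall>x\<in>S. \<tau> x = \<sigma> x} \<subseteq> U)"
    (is "_ \<longleftrightarrow> ?P U")
proof
  let ?G = "galois_group sep_closure K"
  note L = subfield_set_sep_closure
  assume "openin (krull_topology sep_closure K) U"
  then have "generate_topology_on {\<sigma> <#\<^bsub>?G\<^esub> carrier (galois_group sep_closure M) | \<sigma> M.
              \<sigma> \<in> carrier ?G \<and> subfield M ring_of_type_algebra \<and>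
              K \<subseteq> M \<and> M \<subseteq> sep_closure \<and> ring.finite_dimension ring_of_type_algebra K M} U"
    unfolding krull_topology_def by (rule openin_topology_generated_by)
  then show "?P U"
  proof (induction rule: generate_topology_on.induct)
    case Empty
    show ?case by simp
  next
    case (Int a b)
    show ?case
    proof (intro conjI ballI)
      show "a \<inter> b \<subseteq> carrier ?G" using Int by auto
      fix \<sigma> assume "\<sigma> \<in> a \<inter> b"
      then have \<sigma>: "\<sigma> \<in> a" "\<sigma> \<in> b" by simp_all
      obtain S where S: "finite S" "S \<subseteq> sep_closure" "{\<tau> \<in> carrier ?G. \<forall>x\<in>S. \<tau> x = \<sigma> x} \<subseteq> a"
        using bspec[OF conjunct2[OF Int.IH(1)] \<sigma>(1)] by (elim exE conjE)
      obtain S' where S': "finite S'" "S' \<subseteq> sep_closure" "{\<tau> \<in> carrier ?G. \<forall>x\<in>S'. \<tau> x = \<sigma> x} \<subseteq> b"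
        using bspec[OF conjunct2[OF Int.IH(2)] \<sigma>(2)] by (elim exE conjE)
      have "{\<tau> \<in> carrier ?G. \<forall>x\<in>S \<union> S'. \<tau> x = \<sigma> x} \<subseteq> a \<inter> b"
      proof (rule Int_greatest)
        show "{\<tau> \<in> carrier ?G. \<forall>x\<in>S \<union> S'. \<tau> x = \<sigma> x} \<subseteq> a"
          by (rule subset_trans[OF _ S(3)]) (simp add: Collect_mono_iff)
        show "{\<tau> \<in> carrier ?G. \<forall>x\<in>S \<union> S'. \<tau> x = \<sigma> x} \<subseteq> b"
          by (rule subset_trans[OF _ S'(3)]) (simp add: Collect_mono_iff)
      qed
      then show "\<exists>S. finite S \<and> S \<subseteq> sep_closure \<and> {\<tau> \<in> carrier ?G. \<forall>x\<in>S. \<tau> x = \<sigma> x} \<subseteq> a \<inter> b"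
        using S(1,2) S'(1,2) by (intro exI[of _ "S \<union> S'"]) simp
    qed
  next
    case (UN \<U>)
    show ?case
    proof (intro conjI ballI)
      show "\<Union>\<U> \<subseteq> carrier ?G" using UN.IH by (intro Union_least) simp
      fix \<sigma> assume "\<sigma> \<in> \<Union>\<U>"
      then obtain V where V: "V \<in> \<U>" "\<sigma> \<in> V" by (rule UnionE)
      obtain S where S: "finite S" "S \<subseteq> sep_closure" "{\<tau> \<in> carrier ?G. \<forall>x\<in>S. \<tau> x = \<sigma> x} \<subseteq> V"
        using bspec[OF conjunct2[OF UN.IH[OF V(1)]] V(2)] by (elim exE conjE)
      then show "\<exists>S. finite S \<and> S \<subseteq> sep_closure \<and> {\<tau> \<in> carrier ?G. \<forall>x\<in>S. \<tau> x = \<sigma> x} \<subseteq> \<Union>\<U>"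
        using subset_trans[OF S(3) Union_upper[OF V(1)]] by (intro exI[of _ S]) simp
    qed
  next
    case (Basis s)
    then obtain \<rho> M where \<rho>: "s = \<rho> <#\<^bsub>?G\<^esub> carrier (galois_group sep_closure M)" "\<rho> \<in> carrier ?G"
      and M: "K \<subseteq> M" "M \<subseteq> sep_closure" "ring.finite_dimension ring_of_type_algebra K M"
      by auto
    have s: "s = {\<tau> \<in> carrier ?G. \<forall>x\<in>M. \<tau> x = \<rho> x}"
      unfolding \<rho>(1) by (rule galois_group_coset[OF L K(3) \<rho>(2) M(1,2)])
    obtain S where S: "finite S" "S \<subseteq> M" "\<forall>\<sigma>\<in>carrier ?G. \<forall>\<tau>\<in>carrier ?G.
           (\<forall>x\<in>S. \<tau> x = \<sigma> x) \<longrightarrow> (\<forall>x\<in>M. \<tau> x = \<sigma> x)"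
      using finite_dimension_agree[OF L K(1) M] by auto
    show ?case
    proof (intro conjI ballI exI[of _ S])
      show "s \<subseteq> carrier ?G" using s by auto
      show "finite S" by (rule S(1))
      show "S \<subseteq> sep_closure" using S(2) M(2) by (rule order_trans)
      fix \<sigma> assume "\<sigma> \<in> s"
      then have \<sigma>: "\<sigma> \<in> carrier ?G" "\<forall>x\<in>M. \<sigma> x = \<rho> x" unfolding s by simp_all
      show "{\<tau> \<in> carrier ?G. \<forall>x\<in>S. \<tau> x = \<sigma> x} \<subseteq> s"
      proof
        fix \<tau> assume "\<tau> \<in> {\<tau> \<in> carrier ?G. \<forall>x\<in>S. \<tau> x = \<sigma> x}"
        then have \<tau>: "\<tau> \<in> carrier ?G" "\<forall>x\<in>S. \<tau> x = \<sigma> x" by simp_all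
        have "\<forall>x\<in>M. \<tau> x = \<sigma> x" using S(3) \<sigma>(1) \<tau> by simp
        then show "\<tau> \<in> s" unfolding s using \<sigma>(2) \<tau>(1) by simp
      qed
    qed
  qed
next
  let ?G = "galois_group sep_closure K"
  note L = subfield_set_sep_closure
  assume U: "?P U"
  show "openin (krull_topology sep_closure K) U"
  proof (subst openin_subopen, intro ballI)
    fix \<sigma> assume \<sigma>: "\<sigma> \<in> U"
    have \<sigma>G: "\<sigma> \<in> carrier ?G" by (rule subsetD[OF conjunct1[OF U] \<sigma>])
    obtain S where S: "finite S" "S \<subseteq> sep_closure" "{\<tau> \<in> carrier ?G. \<forall>x\<in>S. \<tau> x = \<sigma> x} \<subseteq> U"
      using bspec[OF conjunct2[OF U] \<sigma>] by (elim exE conjE)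
    obtain M where M: "subfield M ring_of_type_algebra" "K \<subseteq> M" "M \<subseteq> sep_closure" "S \<subseteq> M"
      "ring.finite_dimension ring_of_type_algebra K M"
      using finite_extension_in_sep_closure[OF K S(1,2)] by (elim exE conjE)
    let ?T = "\<sigma> <#\<^bsub>?G\<^esub> carrier (galois_group sep_closure M)"
    have T: "?T = {\<tau> \<in> carrier ?G. \<forall>x\<in>M. \<tau> x = \<sigma> x}"
      by (rule galois_group_coset[OF L K(3) \<sigma>G M(2,3)])
    show "\<exists>T. openin (krull_topology sep_closure K) T \<and> \<sigma> \<in> T \<and> T \<subseteq> U"
    proof (intro exI[of _ ?T] conjI)
      show "openin (krull_topology sep_closure K) ?T"
        unfolding krull_topology_def by (rule topology_generated_by_Basis) (rule CollectI, rule exI[of _ \<sigma>], rule exI[of _ M], simp add: \<sigma>G M)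
      show "\<sigma> \<in> ?T" unfolding T using \<sigma>G by simp
      show "?T \<subseteq> U"
        unfolding T by (rule subset_trans[OF _ S(3)]) (use M(4) in \<open>simp add: Collect_mono_iff subset_iff\<close>)
    qed
  qed
qed

lemma topspace_krull_topology:
  fixes K :: "'a::field alg_closure set"
  assumes K: "subfield_set K" "base_field \<subseteq> K" "K \<subseteq> sep_closure"
  shows "topspace (krull_topology sep_closure K) = carrier (galois_group sep_closure K)"
proof (rule subset_antisym)
  show "topspace (krull_topology sep_closure K) \<subseteq> carrier (galois_group sep_closure K)"
    by (rule conjunct1[OF iffD1[OF openin_krull_topology_iff[OF K] openin_topspace]])
  have "openin (krull_topology sep_closure K) (carrier (galois_group sep_closure K))"
    unfolding openin_krull_topology_iff[OF K] by auto
  then show "carrier (galois_group sep_closure K) \<subseteq> topspace (krull_topology sep_closure K)"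
    by (rule openin_subset)
qed

section \<open>Galois extensions of prime degree\<close>

lemma dimension_one_imp_eq:
  assumes K: "subfield K (ring_of_type_algebra :: 'b::field ring)"
    and V: "ring.dimension ring_of_type_algebra 1 K V" "1 \<in> V"
  shows "V = K"
proof -
  interpret R: field "ring_of_type_algebra :: 'b ring" by (rule field_ring_of_type_algebra)
  have one: "1 \<in> K" using K by (simp add: subfield_ring_of_type_algebra_iff subfield_set_one)
  have ind: "R.independent K [1]"
    by (rule R.independent.li_Cons) (simp_all add: ring_of_type_algebra_simps)
  have "R.Span K [1] = V"
    using R.independent_length_eq_dimension[OF K V(1) ind] V(2) by simp
  moreover have "R.Span K [1] = K"
    using R.independent_length_eq_dimension[OF K R.dimension_one[OF K] ind] one by simp
  ultimately show ?thesis by simp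
qed

text \<open>
  By the tower law one of the two degrees is \<open>1\<close>.
\<close>
lemma no_intermediate_field_of_prime_degree:
  fixes F E M :: "'b::field set"
  assumes p: "Factorial_Ring.prime p" and dim: "ring.dimension ring_of_type_algebra p F E"
    and F: "subfield_set F" and E: "subfield_set E" and M: "subfield_set M" "F \<subseteq> M" "M \<subseteq> E"
  shows "M = F \<or> M = E"
proof -
  interpret R: field "ring_of_type_algebra :: 'b ring" by (rule field_ring_of_type_algebra)
  have Ff: "subfield F (ring_of_type_algebra :: 'b ring)" and Mf: "subfield M (ring_of_type_algebra :: 'b ring)"
    using F M(1) by (simp_all add: subfield_ring_of_type_algebra_iff)
  have one: "1 \<in> M" "1 \<in> E" using subfield_set_one M(1) E by auto
  have finE: "R.finite_dimension F E" using dim by (rule R.finite_dimensionI)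
  have "subalgebra F M ring_of_type_algebra"
  proof (rule subalgebra.intro)
    show "subgroup M (add_monoid ring_of_type_algebra)"
      by (rule subring.axioms(1)[OF subfieldE(1)[OF Mf]])
    show "subalgebra_axioms F M ring_of_type_algebra"
      by (rule subalgebra_axioms.intro)
        (use subfield_set_mult[OF M(1)] M(2) in \<open>auto simp: ring_of_type_algebra_simps\<close>)
  qed
  then have finFM: "R.finite_dimension F M"
    by (rule R.subalbegra_incl_imp_finite_dimension[OF Ff finE _ M(3)])
  obtain Us where Us: "set Us \<subseteq> carrier (ring_of_type_algebra :: 'b ring)" "R.Span F Us = E"
    using R.exists_base[OF Ff dim] by auto
  have UsE: "set Us \<subseteq> E" using R.Span_base_incl[OF Ff Us(1)] Us(2) by simp
  have "R.Span M Us \<subseteq> E"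
    by (rule Span_subset)
      (use UsE M(3) in \<open>auto intro!: subfield_set_zero[OF E] subfield_set_add[OF E] subfield_set_mult[OF E]\<close>)
  moreover have "E \<subseteq> R.Span M Us"
    unfolding Us(2)[symmetric]
  proof (rule Span_subset)
    show "0 \<in> R.Span M Us"
      using R.Span_subgroup_props(2)[OF Mf Us(1)] by (simp add: ring_of_type_algebra_simps)
    show "set Us \<subseteq> R.Span M Us" by (rule R.Span_base_incl[OF Mf Us(1)])
    fix k a v assume k: "k \<in> F" and a: "a \<in> R.Span M Us" and v: "v \<in> R.Span M Us"
    have "k \<in> M" using k M(2) by (rule subsetD[rotated])
    then show "k * a + v \<in> R.Span M Us"
      using R.Span_subgroup_props(3)[OF Mf Us(1) R.Span_smult_closed[OF Mf Us(1) _ a] v]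
      by (simp add: ring_of_type_algebra_simps)
  qed
  ultimately have "R.Span M Us = E" by (rule subset_antisym)
  then have finME: "R.finite_dimension M E"
    using R.Span_finite_dimension[OF Mf Us(1)] by simp
  have "p = (R.dim over F) M * (R.dim over M) E"
    using R.telescopic_base_dim(2)[OF Ff Mf finFM finME] R.dimI[OF Ff dim] by simp
  then have "(R.dim over F) M = 1 \<or> (R.dim over M) E = 1"
    using p prime_product by blast
  then show ?thesis
  proof
    assume "(R.dim over F) M = 1"
    then show ?thesis
      using dimension_one_imp_eq[OF Ff _ one(1)] R.finite_dimensionE[OF Ff finFM] by simp
  next
    assume "(R.dim over M) E = 1"
    then show ?thesis
      using dimension_one_imp_eq[OF Mf _ one(2)] R.finite_dimensionE[OF Mf finME] by simp
  qed
qed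

lemma hom_on_subset: "hom_on L \<sigma> \<Longrightarrow> K \<subseteq> L \<Longrightarrow> hom_on K \<sigma>"
  unfolding hom_on_def by (simp add: subset_iff)

lemma hom_on_funpow:
  assumes "hom_on L \<sigma>" "\<And>x. x \<in> L \<Longrightarrow> \<sigma> x \<in> L"
  shows "hom_on L (\<sigma> ^^ n)" and "x \<in> L \<Longrightarrow> (\<sigma> ^^ n) x \<in> L"
proof -
  have closed: "(\<sigma> ^^ n) x \<in> L" if "x \<in> L" for x n
    using that by (induction n) (simp_all add: assms(2))
  then show "x \<in> L \<Longrightarrow> (\<sigma> ^^ n) x \<in> L" .
  show "hom_on L (\<sigma> ^^ n)"
  proof (induction n)
    case (Suc n)
    then show ?case using assms(1) closed by (simp add: hom_on_def)
  qed (simp add: hom_on_def)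
qed

lemma subfield_set_equalizer:
  assumes E: "subfield_set E" and h: "hom_on E \<sigma>" "hom_on E \<tau>"
  shows "subfield_set {x \<in> E. \<sigma> x = \<tau> x}"
  by (rule subfield_setI)
    (simp_all add: subfield_set_one[OF E] subfield_set_diff[OF E] subfield_set_mult[OF E] subfield_set_inverse[OF E]
      hom_on_one[OF E h(1)] hom_on_one[OF E h(2)] hom_on_diff[OF E h(1)] hom_on_diff[OF E h(2)]
      hom_on_mult[OF E h(1)] hom_on_mult[OF E h(2)] hom_on_inverse[OF E h(1)] hom_on_inverse[OF E h(2)])

lemma hom_on_id: "hom_on E (\<lambda>x. x)"
  by (simp add: hom_on_def)

text \<open>
  A permutation of the roots of a polynomial fixes its coefficients.
\<close>
lemma coeff_orbit_poly_fixed: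
  assumes L: "subfield_set L" and \<sigma>: "hom_on L \<sigma>" and B: "B \<subseteq> L" "\<sigma> ` B = B"
  shows "\<sigma> (Polynomial.coeff (\<Prod>r\<in>B. [:- r, 1:]) i) = Polynomial.coeff (\<Prod>r\<in>B. [:- r, 1:]) i"
proof -
  have inj: "inj_on \<sigma> B" using hom_on_inj[OF L \<sigma>] B(1) by (rule inj_on_subset)
  have lin: "[:- r, 1:] \<in> polys_over L" if "r \<in> B" for r
    by (intro polys_over_pCons[OF L] polys_over_0[OF L] subfield_set_uminus[OF L] subfield_set_one[OF L] subsetD[OF B(1) that])
  have "map_poly \<sigma> (\<Prod>r\<in>B. [:- r, 1:]) = (\<Prod>r\<in>B. map_poly \<sigma> [:- r, 1:])"
    by (rule map_poly_hom_prod[OF L \<sigma> lin])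
  also have "\<dots> = (\<Prod>r\<in>B. [:- \<sigma> r, 1:])"
  proof (rule prod.cong[OF refl])
    fix r assume "r \<in> B"
    then have "\<sigma> (- r) = - \<sigma> r" using hom_on_uminus[OF L \<sigma>] B(1) by auto
    then show "map_poly \<sigma> [:- r, 1:] = [:- \<sigma> r, 1:]"
      by (simp add: map_poly_pCons hom_on_zero[OF L \<sigma>] hom_on_one[OF L \<sigma>])
  qed
  also have "\<dots> = (\<Prod>r\<in>\<sigma> ` B. [:- r, 1:])"
    by (simp add: prod.reindex[OF inj])
  finally show ?thesis
    unfolding B(2) using coeff_map_poly_hom[OF L \<sigma>, of "\<Prod>r\<in>B. [:- r, 1:]" i] by simp
qed

lemma orbit_poly_over:
  assumes L: "subfield_set L" and B: "B \<subseteq> L"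
  shows "(\<Prod>r\<in>B. [:- r, 1:]) \<in> polys_over L"
  by (rule polys_over_prod[OF L])
    (intro polys_over_pCons[OF L] polys_over_0[OF L] subfield_set_uminus[OF L] subfield_set_one[OF L] subsetD[OF B])

lemma poly_orbit_poly_eq_0:
  assumes "finite B"
  shows "poly (\<Prod>r\<in>B. [:- r, 1:]) x = 0 \<longleftrightarrow> (x :: 'b::field) \<in> B"
  using assms by (auto simp: poly_prod)

lemma pderiv_orbit_poly_ne_0:
  assumes B: "finite B" and x: "(x :: 'b::field) \<in> B"
  shows "poly (pderiv (\<Prod>r\<in>B. [:- r, 1:])) x \<noteq> 0"
proof -
  have "(\<Prod>r\<in>B. [:- r, 1:]) = [:- x, 1:] * (\<Prod>r\<in>B - {x}. [:- r, 1:])"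
    by (rule prod.remove[OF B x])
  then have "poly (pderiv (\<Prod>r\<in>B. [:- r, 1:])) x = poly (\<Prod>r\<in>B - {x}. [:- r, 1:]) x"
    by (simp only: pderiv_mult poly_add poly_mult) (simp add: pderiv_pCons)
  then show ?thesis using B by (simp add: poly_orbit_poly_eq_0)
qed

text \<open>
  The properties of a cyclic extension of prime degree that enter the argument: it is Galois and
  nontrivial, and has no intermediate fields.
\<close>
locale prime_galois_extension =
  fixes E :: "'a::field alg_closure set"
  assumes E: "subfield_set E" and base_E: "base_field \<subseteq> E"
    and no_intermediate: "\<And>M. subfield_set M \<Longrightarrow> base_field \<subseteq> M \<Longrightarrow> M \<subseteq> E \<Longrightarrow> M = base_field \<or> M = E"
    and fixed_field: "{x \<in> E. \<forall>\<sigma>\<in>carrier (galois_group E base_field). \<sigma> x = x} = base_field"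
    and E_ne_base: "E \<noteq> base_field"

lemma prime_galois_extensionI:
  fixes E :: "'a::field alg_closure set"
  assumes p: "Factorial_Ring.prime p" and E: "cyclic_extension p E base_field"
  shows "prime_galois_extension E"
proof
  interpret R: field "ring_of_type_algebra :: 'a alg_closure ring" by (rule field_ring_of_type_algebra)
  show sE: "subfield_set E" and b: "base_field \<subseteq> E"
    and "{x \<in> E. \<forall>\<sigma>\<in>carrier (galois_group E base_field). \<sigma> x = x} = base_field"
    using E by (simp_all add: cyclic_extension_def subfield_ring_of_type_algebra_iff)
  have dim: "R.dimension p base_field E" using E by (simp add: cyclic_extension_def)
  show "M = base_field \<or> M = E" if "subfield_set M" "base_field \<subseteq> M" "M \<subseteq> E" for M
    by (rule no_intermediate_field_of_prime_degree[OF p dim subfield_set_base_field sE that])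
  have Ff: "subfield base_field (ring_of_type_algebra :: 'a alg_closure ring)"
    by (simp add: subfield_ring_of_type_algebra_iff subfield_set_base_field)
  show "E \<noteq> base_field"
  proof
    assume "E = base_field"
    then have "p = 1" using R.dimension_is_inj[OF Ff dim] R.dimension_one[OF Ff] by simp
    then show False using p by simp
  qed
qed

context prime_galois_extension
begin

abbreviation GF :: "('a alg_closure \<Rightarrow> 'a alg_closure) monoid"
  where "GF \<equiv> galois_group sep_closure base_field"
abbreviation GE :: "('a alg_closure \<Rightarrow> 'a alg_closure) monoid"
  where "GE \<equiv> galois_group sep_closure E"

text \<open>
  Homomorphic images of \<open>x\<close> are roots of a polynomial of \<open>x\<close> over \<open>F\<close>.
\<close>
lemma finite_conjugates:
  assumes B: "\<And>y. y \<in> B \<Longrightarrow> \<exists>\<sigma>. hom_on E \<sigma> \<and> (\<forall>c\<in>base_field. \<sigma> c = c) \<and> y = \<sigma> x" and x: "x \<in> E"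
  shows "finite B"
proof -
  obtain f where f: "f \<in> polys_over base_field" "f \<noteq> 0" "poly f x = 0"
    by (rule algebraic_over_base_field)
  have "B \<subseteq> {y. poly f y = 0}"
  proof
    fix y assume "y \<in> B"
    then obtain \<sigma> where \<sigma>: "hom_on E \<sigma>" "\<forall>c\<in>base_field. \<sigma> c = c" "y = \<sigma> x" using B by auto
    have "poly f (\<sigma> x) = \<sigma> (poly f x)"
      by (rule hom_fixing_base_poly[OF E base_E \<sigma>(1) _ f(1) x]) (use \<sigma>(2) in simp)
    then show "y \<in> {y. poly f y = 0}" using f(3) \<sigma>(3) by (simp add: hom_on_zero[OF E \<sigma>(1)])
  qed
  then show ?thesis using poly_roots_finite[OF f(2)] by (rule finite_subset)
qed

text \<open>
  For \<open>B\<close> take the orbit of \<open>x\<close> under the Galois group of \<open>E\<close>. The coefficients of the product are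
  fixed by that group and hence lie in \<open>F\<close>. Both the separability and the normality of \<open>E\<close> follow
  from this polynomial.
\<close>
lemma split_separable_polynomial:
  assumes x: "x \<in> E"
  obtains B where "finite B" "B \<subseteq> E" "x \<in> B" "(\<Prod>r\<in>B. [:- r, 1:]) \<in> polys_over base_field"
proof -
  let ?G = "galois_group E base_field"
  interpret G: group ?G by (rule group_galois_group[OF E base_E])
  define B where "B = (\<lambda>\<sigma>. \<sigma> x) ` carrier ?G"
  have OE: "B \<subseteq> E" unfolding B_def using galois_group_closed[OF _ x] by (rule image_subsetI)
  have fin: "finite B"
  proof (rule finite_conjugates[OF _ x])
    fix y assume "y \<in> B"
    then obtain \<sigma> where "\<sigma> \<in> carrier ?G" "y = \<sigma> x" unfolding B_def by (rule imageE)
    then show "\<exists>\<sigma>. hom_on E \<sigma> \<and> (\<forall>c\<in>base_field. \<sigma> c = c) \<and> y = \<sigma> x"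
      using galois_group_hom_on[OF E, of \<sigma> base_field] galois_group_fixes[of \<sigma> E base_field]
      by (intro exI[of _ \<sigma>]) simp
  qed
  have "\<one>\<^bsub>?G\<^esub> x \<in> B" unfolding B_def by (rule imageI[OF G.one_closed])
  then have xO: "x \<in> B" using galois_group_apply_one[OF x] by simp
  have "Polynomial.coeff (\<Prod>r\<in>B. [:- r, 1:]) i \<in> base_field" for i
  proof -
    have "\<sigma> (Polynomial.coeff (\<Prod>r\<in>B. [:- r, 1:]) i) = Polynomial.coeff (\<Prod>r\<in>B. [:- r, 1:]) i"
      if \<sigma>: "\<sigma> \<in> carrier ?G" for \<sigma>
    proof (rule coeff_orbit_poly_fixed[OF E galois_group_hom_on[OF E \<sigma>] OE])
      have "\<sigma> ` B \<subseteq> B"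
      proof (rule image_subsetI)
        fix y assume "y \<in> B"
        then obtain \<rho> where \<rho>: "\<rho> \<in> carrier ?G" "y = \<rho> x" unfolding B_def by (rule imageE)
        then have "\<sigma> y = (\<sigma> \<otimes>\<^bsub>?G\<^esub> \<rho>) x" using galois_group_apply_mult[OF \<sigma> \<rho>(1) x] by simp
        then show "\<sigma> y \<in> B" unfolding B_def using G.m_closed[OF \<sigma> \<rho>(1)] by (rule image_eqI)
      qed
      moreover have "inj_on \<sigma> B"
        by (rule inj_on_subset[OF hom_on_inj[OF E galois_group_hom_on[OF E \<sigma>]] OE])
      ultimately show "\<sigma> ` B = B" using fin by (simp add: card_subset_eq card_image)
    qed
    moreover have "Polynomial.coeff (\<Prod>r\<in>B. [:- r, 1:]) i \<in> E"
      using orbit_poly_over[OF E OE] by (simp add: polys_over_def)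
    ultimately show ?thesis using fixed_field by auto
  qed
  then show ?thesis using that[OF fin OE xO] by (simp add: polys_over_def)
qed

lemma E_separable: "E \<subseteq> sep_closure"
proof
  fix x assume "x \<in> E"
  then obtain B where B: "finite B" "x \<in> B" "(\<Prod>r\<in>B. [:- r, 1:]) \<in> polys_over base_field"
    by (rule split_separable_polynomial)
  then show "x \<in> sep_closure"
    unfolding mem_sep_closure_iff
    using poly_orbit_poly_eq_0[OF B(1)] pderiv_orbit_poly_ne_0[OF B(1,2)] by (intro bexI[OF _ B(3)]) simp
qed

lemma E_normal:
  assumes \<sigma>: "\<sigma> \<in> carrier GF" and x: "x \<in> E"
  shows "\<sigma> x \<in> E"
proof -
  obtain B where B: "finite B" "B \<subseteq> E" "x \<in> B" "(\<Prod>r\<in>B. [:- r, 1:]) \<in> polys_over base_field"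
    using x by (rule split_separable_polynomial)
  note hom = galois_group_hom_on[OF subfield_set_sep_closure \<sigma>]
  have "poly (\<Prod>r\<in>B. [:- r, 1:]) (\<sigma> x) = \<sigma> (poly (\<Prod>r\<in>B. [:- r, 1:]) x)"
    by (rule hom_fixing_base_poly[OF subfield_set_sep_closure base_field_subset_sep_closure hom _ B(4)])
      (use galois_group_fixes[OF \<sigma>] E_separable x in auto)
  also have "poly (\<Prod>r\<in>B. [:- r, 1:]) x = 0" using B(1,3) by (simp add: poly_orbit_poly_eq_0)
  finally have "\<sigma> x \<in> B"
    using B(1) by (simp add: poly_orbit_poly_eq_0 hom_on_zero[OF subfield_set_sep_closure hom])
  then show ?thesis using B(2) by (rule subsetD[rotated])
qed

text \<open>
  Let \<open>h\<close> move \<open>\<alpha> \<in> E\<close>. The field of elements of \<open>E\<close> fixed by \<open>h\<close> is not \<open>E\<close>, hence it is \<open>F\<close>. So the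
  monic polynomial whose roots are the images of \<open>\<alpha>\<close> under the powers of \<open>h\<close> is over \<open>F\<close>, and \<open>g\<close> maps
  \<open>\<alpha>\<close> to one of these roots. Thus \<open>g\<close> agrees with a power of \<open>h\<close> at \<open>\<alpha>\<close>, which is not in \<open>F\<close>, and therefore on
  all of \<open>E\<close>, again because there are no intermediate fields.
\<close>
lemma restriction_power:
  assumes h: "h \<in> carrier GF" "h \<notin> carrier GE"
    and g: "g \<in> carrier GF"
  shows "\<exists>k. \<forall>x\<in>E. g x = (h ^^ k) x"
proof -
  have hom: "hom_on E \<sigma>" if "\<sigma> \<in> carrier GF" for \<sigma>
    by (rule hom_on_subset[OF galois_group_hom_on[OF subfield_set_sep_closure that] E_separable])
  have pow_hom: "hom_on E (h ^^ k)" and pow_E: "y \<in> E \<Longrightarrow> (h ^^ k) y \<in> E" for k y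
    using hom_on_funpow[OF hom[OF h(1)] E_normal[OF h(1)]] by simp_all
  have pow_fix: "(h ^^ k) c = c" if "c \<in> base_field" for k c
    using galois_group_fixes[OF h(1) that] by (induction k) simp_all
  have "\<exists>\<alpha>\<in>E. h \<alpha> \<noteq> \<alpha>"
    using h by (simp add: mem_galois_group_iff) 
  then obtain \<alpha> where \<alpha>: "\<alpha> \<in> E" "h \<alpha> \<noteq> \<alpha>" by (rule bexE)
  have \<alpha>_base: "\<alpha> \<notin> base_field" using \<alpha>(2) galois_group_fixes[OF h(1)] by auto
  have fixed_h: "{x \<in> E. h x = x} = base_field"
  proof -
    have "{x \<in> E. h x = x} = base_field \<or> {x \<in> E. h x = x} = E"
      by (rule no_intermediate[OF subfield_set_equalizer[OF E hom[OF h(1)] hom_on_id]])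
        (use base_E galois_group_fixes[OF h(1)] in auto)
    then show ?thesis using \<alpha> by auto
  qed
  define B where "B = range (\<lambda>k. (h ^^ k) \<alpha>)"
  have OE: "B \<subseteq> E" unfolding B_def using pow_E[OF \<alpha>(1)] by (rule image_subsetI)
  have fin: "finite B"
  proof (rule finite_conjugates[OF _ \<alpha>(1)])
    fix y assume "y \<in> B"
    then obtain k where "y = (h ^^ k) \<alpha>" unfolding B_def by (rule rangeE)
    then show "\<exists>\<sigma>. hom_on E \<sigma> \<and> (\<forall>c\<in>base_field. \<sigma> c = c) \<and> y = \<sigma> \<alpha>"
      using pow_hom pow_fix by (intro exI[of _ "h ^^ k"]) simp
  qed
  have hB: "h ` B = B"
  proof (rule card_subset_eq[OF fin])
    show "h ` B \<subseteq> B"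
    proof (rule image_subsetI)
      fix y assume "y \<in> B"
      then obtain k where "y = (h ^^ k) \<alpha>" unfolding B_def by (rule rangeE)
      then have "h y = (h ^^ Suc k) \<alpha>" by simp
      then show "h y \<in> B" unfolding B_def by (rule range_eqI)
    qed
    show "card (h ` B) = card B"
      by (rule card_image[OF inj_on_subset[OF hom_on_inj[OF E hom[OF h(1)]] OE]])
  qed
  let ?P = "\<Prod>r\<in>B. [:- r, 1:]"
  have "Polynomial.coeff ?P i \<in> base_field" for i
  proof -
    have "Polynomial.coeff ?P i \<in> E" using orbit_poly_over[OF E OE] by (simp add: polys_over_def)
    moreover have "h (Polynomial.coeff ?P i) = Polynomial.coeff ?P i"
      by (rule coeff_orbit_poly_fixed[OF E hom[OF h(1)] OE hB])
    ultimately show ?thesis using fixed_h by auto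
  qed
  then have P: "?P \<in> polys_over base_field" by (simp add: polys_over_def)
  have "(h ^^ 0) \<alpha> \<in> B" unfolding B_def by (rule rangeI)
  then have P\<alpha>: "poly ?P \<alpha> = 0" using fin by (simp add: poly_orbit_poly_eq_0)
  have "poly ?P (g \<alpha>) = g (poly ?P \<alpha>)"
    by (rule hom_fixing_base_poly[OF E base_E hom[OF g] _ P \<alpha>(1)]) (rule galois_group_fixes[OF g])
  then have "poly ?P (g \<alpha>) = 0" unfolding P\<alpha> hom_on_zero[OF E hom[OF g]] .
  then have "g \<alpha> \<in> B" using fin by (simp add: poly_orbit_poly_eq_0)
  then obtain k where k: "g \<alpha> = (h ^^ k) \<alpha>" unfolding B_def by (rule rangeE)
  have "{x \<in> E. g x = (h ^^ k) x} = base_field \<or> {x \<in> E. g x = (h ^^ k) x} = E"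
    by (rule no_intermediate[OF subfield_set_equalizer[OF E hom[OF g] pow_hom]])
      (use base_E galois_group_fixes[OF g] pow_fix in auto)
  then have "{x \<in> E. g x = (h ^^ k) x} = E" using \<alpha>(1) \<alpha>_base k by auto
  then show ?thesis by auto
qed

text \<open>
  A nontrivial automorphism of \<open>E\<close> over \<open>F\<close>, extended to the algebraic closure and then restricted to
  the separable elements.
\<close>
lemma exists_moving_automorphism:
  "\<exists>\<tau>. \<tau> \<in> carrier GF \<and> \<tau> \<notin> carrier GE"
proof -
  obtain \<alpha> where \<alpha>: "\<alpha> \<in> E" "\<alpha> \<notin> base_field" using E_ne_base base_E by auto
  then obtain \<sigma> where \<sigma>: "\<sigma> \<in> carrier (galois_group E base_field)" "\<sigma> \<alpha> \<noteq> \<alpha>"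
    using fixed_field by auto
  obtain \<tau> where \<tau>: "hom_on UNIV \<tau>" "\<And>x. x \<in> E \<Longrightarrow> \<tau> x = \<sigma> x"
    using extend_hom_to_alg_closure[OF E base_E galois_group_hom_on[OF E \<sigma>(1)] galois_group_fixes[OF \<sigma>(1)]]
    by auto
  have fix_base: "\<tau> c = c" if "c \<in> base_field" for c
    using \<tau>(2)[OF subsetD[OF base_E that]] galois_group_fixes[OF \<sigma>(1) that] by simp
  have "restrict \<tau> sep_closure \<in> carrier GF"
    by (rule restrict_mem_galois_group[OF subfield_set_sep_closure base_field_subset_sep_closure
        bij_betw_sep_closure[OF \<tau>(1) fix_base] hom_on_subset[OF \<tau>(1) subset_UNIV] fix_base])
  moreover have "restrict \<tau> sep_closure \<alpha> \<noteq> \<alpha>"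
    using \<tau>(2)[OF \<alpha>(1)] \<sigma>(2) subsetD[OF E_separable \<alpha>(1)] by simp
  then have "restrict \<tau> sep_closure \<notin> carrier GE"
    using galois_group_fixes \<alpha>(1) by metis
  ultimately show ?thesis by (intro exI conjI)
qed

end

section \<open>Characters and roots of unity\<close>

text \<open>
  Induction on \<open>n\<close>. Subtracting \<open>\<phi>\<^sub>n(y)\<close> times the relation at \<open>x\<close> from the relation at \<open>y x\<close> removes the
  last character and multiplies the other coefficients by \<open>\<phi>\<^sub>i(y) - \<phi>\<^sub>n(y)\<close>, and \<open>y\<close> can be chosen to make
  any one of these factors nonzero.
\<close>
lemma independence_of_characters:
  fixes \<phi> :: "nat \<Rightarrow> 'b::field \<Rightarrow> 'b"
  assumes E: "subfield_set E"
    and hom: "\<And>i. i < n \<Longrightarrow> hom_on E (\<phi> i)"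
    and distinct: "\<And>i j. i < j \<Longrightarrow> j < n \<Longrightarrow> \<exists>x\<in>E. \<phi> i x \<noteq> \<phi> j x"
    and zero: "\<And>x. x \<in> E \<Longrightarrow> (\<Sum>i<n. c i * \<phi> i x) = 0"
  shows "i < n \<Longrightarrow> c i = 0"
  using hom distinct zero
proof (induction n arbitrary: c i)
  case (Suc n)
  note mult = hom_on_mult[OF E Suc.prems(2)]
  have small: "c j = 0" if j: "j < n" for j
  proof -
    have "c j * (\<phi> j y - \<phi> n y) = 0" if y: "y \<in> E" for y
    proof (rule Suc.IH[OF j])
      show "hom_on E (\<phi> i)" if "i < n" for i using that Suc.prems(2) by simp
      show "\<exists>x\<in>E. \<phi> i x \<noteq> \<phi> j x" if "i < j" "j < n" for i j using that Suc.prems(3) by simp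
      fix x assume x: "x \<in> E"
      have "(\<Sum>i<n. c i * (\<phi> i y - \<phi> n y) * \<phi> i x) = (\<Sum>i<Suc n. c i * (\<phi> i y - \<phi> n y) * \<phi> i x)"
        by simp
      also have "\<dots> = (\<Sum>i<Suc n. c i * \<phi> i (y * x)) - \<phi> n y * (\<Sum>i<Suc n. c i * \<phi> i x)"
        unfolding sum_distrib_left sum_subtractf[symmetric]
        by (rule sum.cong) (simp_all add: mult x y algebra_simps)
      also have "\<dots> = 0"
        using Suc.prems(4)[OF x] Suc.prems(4)[OF subfield_set_mult[OF E y x]] by simp
      finally show "(\<Sum>i<n. c i * (\<phi> i y - \<phi> n y) * \<phi> i x) = 0" .
    qed
    moreover obtain y where "y \<in> E" "\<phi> j y \<noteq> \<phi> n y"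
      using Suc.prems(3)[OF j] by auto
    ultimately show ?thesis by force
  qed
  have "(\<Sum>i<Suc n. c i * \<phi> i 1) = 0" by (rule Suc.prems(4)[OF subfield_set_one[OF E]])
  then have "c n = 0"
    using small hom_on_one[OF E Suc.prems(2), of n] by simp
  then show ?case using small Suc.prems(1) by (cases "i = n") auto
qed simp

lemma funpow_fixed: "(f ^^ d) x = x \<Longrightarrow> (f ^^ (d * a)) x = x"
  by (induction a) (simp_all add: funpow_add)

text \<open>
  Write \<open>d a = p b + 1\<close>.
\<close>
lemma funpow_coprime_fixed:
  assumes "(f ^^ d) x = x" "(f ^^ p) x = x" "coprime d p" "d > 0"
  shows "f x = x"
proof -
  obtain a b where "d * a = p * b + 1"
    using bezout_nat[of d p] assms(3,4) by (auto simp: coprime_iff_gcd_eq_1)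
  then have "f x = (f ^^ (d * a)) x"
    using funpow_fixed[OF assms(2), of b] by (simp add: funpow_add)
  then show ?thesis using funpow_fixed[OF assms(1), of a] by simp
qed

lemma sum_less_odd: "(\<Sum>i<2 * m + 1. i) = (2 * m + 1) * (m :: nat)"
  by (induction m) (simp_all add: algebra_simps)

text \<open>
  A polynomial has no further roots once as many roots as its degree are known.
\<close>
lemma roots_subset_of_card:
  fixes P :: "'b::idom poly"
  assumes P: "P \<noteq> 0" "Polynomial.degree P \<le> card Z" and Z: "finite Z" "\<And>z. z \<in> Z \<Longrightarrow> poly P z = 0"
    and u: "poly P u = 0"
  shows "u \<in> Z"
proof -
  have "Z = {z. poly P z = 0}"
  proof (rule card_seteq[OF poly_roots_finite[OF P(1)]])
    show "Z \<subseteq> {z. poly P z = 0}" using Z(2) by auto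
    show "card {z. poly P z = 0} \<le> card Z"
      using card_poly_roots_bound[OF P(1)] P(2) by (rule order_trans)
  qed
  then show ?thesis using u by simp
qed

text \<open>
  The powers of a primitive root of unity exhaust the roots of \<open>X\<^sup>p - 1\<close>.
\<close>
lemma roots_of_unity_in_base_field:
  fixes \<zeta> :: "'a::field" and u :: "'a alg_closure"
  assumes p: "p > 0" and \<zeta>: "\<zeta> ^ p = 1" "\<And>k. 0 < k \<Longrightarrow> k < p \<Longrightarrow> \<zeta> ^ k \<noteq> 1"
    and u: "u ^ p = 1"
  shows "u \<in> base_field"
proof -
  have \<zeta>0: "\<zeta> \<noteq> 0" using \<zeta>(1) p by (auto simp: power_0_left)
  have inj: "inj_on (\<lambda>k. to_ac \<zeta> ^ k) {..<p}"
  proof (rule linorder_inj_onI')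
    fix i j assume ij: "i \<in> {..<p}" "j \<in> {..<p}" "i < j"
    have "\<zeta> ^ j = \<zeta> ^ i * \<zeta> ^ (j - i)" using ij by (simp flip: power_add)
    moreover have "\<zeta> ^ (j - i) \<noteq> 1" using \<zeta>(2)[of "j - i"] ij by simp
    ultimately have "\<zeta> ^ i \<noteq> \<zeta> ^ j" using \<zeta>0 by simp
    then show "to_ac \<zeta> ^ i \<noteq> to_ac \<zeta> ^ j" by (simp flip: to_ac_power)
  qed
  let ?P = "Polynomial.monom 1 p - 1 :: 'a alg_closure poly"
  have "Polynomial.coeff ?P p = 1" using p by simp
  then have P0: "?P \<noteq> 0" by (metis Polynomial.coeff_0 zero_neq_one)
  have "u \<in> (\<lambda>k. to_ac \<zeta> ^ k) ` {..<p}"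
  proof (rule roots_subset_of_card[OF P0])
    have "Polynomial.degree ?P \<le> p"
      by (rule Polynomial.degree_diff_le) (simp_all add: Polynomial.degree_monom_le)
    then show "Polynomial.degree ?P \<le> card ((\<lambda>k. to_ac \<zeta> ^ k) ` {..<p})"
      by (simp add: card_image[OF inj])
    show "poly ?P z = 0" if z: "z \<in> (\<lambda>k. to_ac \<zeta> ^ k) ` {..<p}" for z
    proof -
      obtain k where "z = to_ac \<zeta> ^ k" using z by (rule imageE)
      then have "z ^ p = to_ac ((\<zeta> ^ p) ^ k)" by (simp add: mult.commute flip: power_mult)
      then show ?thesis by (simp add: poly_monom \<zeta>(1))
    qed
    show "poly ?P u = 0" by (simp add: poly_monom u)
  qed simp
  then show ?thesis by (auto simp: base_field_def simp flip: to_ac_power)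
qed

text \<open>
  The \<open>p\<close> elements of the prime field exhaust the roots of \<open>X\<^sup>p - X\<close>.
\<close>
lemma frobenius_fixed_in_base_field:
  fixes u :: "'a::field alg_closure"
  assumes p: "p > 0" "CHAR('a) = p" and u: "u ^ p = u"
  shows "u \<in> base_field"
proof -
  have inj: "inj_on (\<lambda>k. of_nat k :: 'a alg_closure) {..<p}"
  proof (rule linorder_inj_onI')
    fix i j assume ij: "i \<in> {..<p}" "j \<in> {..<p}" "i < j"
    have "\<not> p dvd (j - i)" using ij by (auto dest: dvd_imp_le)
    then have "(of_nat (j - i) :: 'a alg_closure) \<noteq> 0" using p by (simp add: of_nat_eq_0_iff_char_dvd)
    then show "(of_nat i :: 'a alg_closure) \<noteq> of_nat j" using ij by (simp add: of_nat_diff)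
  qed
  have pr: "Factorial_Ring.prime CHAR('a alg_closure)"
    using prime_CHAR_semidom[where ?'a = "'a alg_closure"] p by simp
  have p1: "p > 1" using prime_gt_1_nat[OF pr] p(2) by simp
  let ?P = "Polynomial.monom 1 p - Polynomial.monom 1 1 :: 'a alg_closure poly"
  have "Polynomial.coeff ?P p = 1" using p1 by simp
  then have P0: "?P \<noteq> 0" by (metis Polynomial.coeff_0 zero_neq_one)
  have frob: "(of_nat k :: 'a alg_closure) ^ p = of_nat k" for k
  proof (induction k)
    case (Suc k)
    have "(of_nat k + 1 :: 'a alg_closure) ^ p = of_nat k ^ p + 1 ^ p"
      by (rule freshmans_dream[OF pr]) (simp add: p)
    then show ?case using Suc by (simp add: add.commute)
  qed (use p in \<open>simp add: power_0_left\<close>)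
  have "u \<in> (\<lambda>k. of_nat k) ` {..<p}"
  proof (rule roots_subset_of_card[OF P0])
    have "Polynomial.degree ?P \<le> p"
      by (rule Polynomial.degree_diff_le) (use p1 in \<open>auto intro: order_trans[OF Polynomial.degree_monom_le]\<close>)
    then show "Polynomial.degree ?P \<le> card ((\<lambda>k. of_nat k :: 'a alg_closure) ` {..<p})"
      by (simp add: card_image[OF inj])
    show "poly ?P z = 0" if "z \<in> (\<lambda>k. of_nat k) ` {..<p}" for z
      using that frob by (auto simp: poly_monom)
    show "poly ?P u = 0" by (simp add: poly_monom u)
  qed simp
  then show ?thesis using subfield_set_of_nat[OF subfield_set_base_field] by auto
qed

context prime_galois_extension
begin

section \<open>The subgroup generated by powers and commutators\<close>

lemma GE_subset_GF: "carrier GE \<subseteq> carrier GF"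
  by (rule galois_group_mono[OF base_E])

lemma group_GF: "group GF" and group_GE: "group GE"
  by (rule group_galois_group[OF subfield_set_sep_closure base_field_subset_sep_closure])
    (rule group_galois_group[OF subfield_set_sep_closure E_separable])

lemma T_kernel_least:
  assumes H: "subgroup H GE" "closedin (krull_topology sep_closure E) H"
    and pow: "\<And>g. g \<in> carrier GE \<Longrightarrow> g [^]\<^bsub>GE\<^esub> p \<in> H"
    and comm: "\<And>g h. g \<in> carrier GE \<Longrightarrow> h \<in> carrier GE \<Longrightarrow>
      g \<otimes>\<^bsub>GE\<^esub> h \<otimes>\<^bsub>GE\<^esub> inv\<^bsub>GE\<^esub> g \<otimes>\<^bsub>GE\<^esub> inv\<^bsub>GE\<^esub> h \<in> H"
  shows "T_kernel p E \<subseteq> H"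
  unfolding T_kernel_def power_commutator_subgroup_def closed_subgroup_generated_def
    abs_galois_group_def abs_galois_topology_def
  by (rule Inter_lower) (use H pow comm in auto)

lemma closedin_krull_iff:
  "closedin (krull_topology sep_closure E) H \<longleftrightarrow> H \<subseteq> carrier GE \<and>
     (\<forall>\<sigma>\<in>carrier GE - H. \<exists>S. finite S \<and> S \<subseteq> sep_closure \<and>
        {\<tau> \<in> carrier GE. \<forall>x\<in>S. \<tau> x = \<sigma> x} \<subseteq> carrier GE - H)"
  unfolding closedin_def topspace_krull_topology[OF E base_E E_separable]
    openin_krull_topology_iff[OF E base_E E_separable] by simp

lemma T_kernel_subset: "T_kernel p E \<subseteq> carrier GE"
proof (rule T_kernel_least)
  interpret GE: group GE by (rule group_GE)
  show "subgroup (carrier GE) GE" by (rule GE.subgroup_self)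
  show "closedin (krull_topology sep_closure E) (carrier GE)" by (simp add: closedin_krull_iff)
qed (simp_all add: group.is_monoid[OF group_GE] monoid.nat_pow_closed group.inv_closed[OF group_GE]
      monoid.m_closed)

lemma funpow_trivial_on_E:
  assumes \<tau>: "\<tau> \<in> carrier GF" "\<tau> [^]\<^bsub>GF\<^esub> p \<in> T_kernel p E" and x: "x \<in> E"
  shows "(\<tau> ^^ p) x = x"
proof -
  have "(\<tau> [^]\<^bsub>GF\<^esub> p) x = x"
    by (rule galois_group_fixes[OF subsetD[OF T_kernel_subset \<tau>(2)] x])
  then show ?thesis
    using galois_group_apply_pow[OF subfield_set_sep_closure base_field_subset_sep_closure \<tau>(1) subsetD[OF E_separable x]]
    by simp
qed

text \<open>
  The stabiliser of \<open>\<beta>\<close> in \<open>G\<^sub>E\<close> is a closed subgroup, and the hypotheses say that it contains the \<open>p\<close>-th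
  powers and the commutators.
\<close>
lemma T_kernel_fixes:
  assumes \<beta>: "\<beta> \<in> sep_closure"
    and pow: "\<And>g. g \<in> carrier GE \<Longrightarrow> (g ^^ p) \<beta> = \<beta>"
    and comm: "\<And>g h. g \<in> carrier GE \<Longrightarrow> h \<in> carrier GE \<Longrightarrow> g (h \<beta>) = h (g \<beta>)"
    and n: "n \<in> T_kernel p E"
  shows "n \<beta> = \<beta>"
proof -
  interpret GE: group GE by (rule group_GE)
  note inv = galois_group_apply_inv[OF subfield_set_sep_closure E_separable]
  define H where "H = {g \<in> carrier GE. g \<beta> = \<beta>}"
  have "T_kernel p E \<subseteq> H"
  proof (rule T_kernel_least)
    show "subgroup H GE"
    proof (rule GE.subgroupI)
      show "H \<subseteq> carrier GE" by (simp add: H_def)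
      have "\<one>\<^bsub>GE\<^esub> \<in> H" by (simp add: H_def galois_group_apply_one[OF \<beta>])
      then show "H \<noteq> {}" by auto
      show "inv\<^bsub>GE\<^esub> g \<in> H" if "g \<in> H" for g
        using that inv(1)[of g \<beta>] \<beta> by (simp add: H_def)
      show "g \<otimes>\<^bsub>GE\<^esub> h \<in> H" if "g \<in> H" "h \<in> H" for g h
        using that galois_group_apply_mult[of g sep_closure E h \<beta>] \<beta> by (simp add: H_def)
    qed
    show "closedin (krull_topology sep_closure E) H"
      unfolding closedin_krull_iff
    proof (intro conjI ballI exI[of _ "{\<beta>}"])
      fix \<sigma> assume \<sigma>: "\<sigma> \<in> carrier GE - H"
      then have "\<sigma> \<beta> \<noteq> \<beta>" by (simp add: H_def)
      then show "{\<tau> \<in> carrier GE. \<forall>x\<in>{\<beta>}. \<tau> x = \<sigma> x} \<subseteq> carrier GE - H"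
        by (auto simp: H_def)
    qed (use \<beta> in \<open>auto simp: H_def\<close>)
    show "g [^]\<^bsub>GE\<^esub> p \<in> H" if "g \<in> carrier GE" for g
      using that pow galois_group_apply_pow[OF subfield_set_sep_closure E_separable that \<beta>, of p]
      by (simp add: H_def)
    fix g h assume g: "g \<in> carrier GE" and h: "h \<in> carrier GE"
    let ?a = "inv\<^bsub>GE\<^esub> g" and ?b = "inv\<^bsub>GE\<^esub> h"
    have a: "?a \<in> carrier GE" and b: "?b \<in> carrier GE" using g h by simp_all
    note closed = galois_group_closed[OF a] galois_group_closed[OF b] galois_group_closed[OF g] galois_group_closed[OF h]
    have "(g \<otimes>\<^bsub>GE\<^esub> h \<otimes>\<^bsub>GE\<^esub> ?a \<otimes>\<^bsub>GE\<^esub> ?b) \<beta> = g (h (?a (?b \<beta>)))"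
      using g h a b \<beta> closed
      by (simp add: galois_group_apply_mult)
    also have "?a (?b \<beta>) = ?b (?a \<beta>)" by (rule comm[OF a b])
    also have "g (h (?b (?a \<beta>))) = \<beta>"
      using inv(2)[OF h closed(1)[OF \<beta>]] inv(2)[OF g \<beta>] by simp
    finally show "g \<otimes>\<^bsub>GE\<^esub> h \<otimes>\<^bsub>GE\<^esub> ?a \<otimes>\<^bsub>GE\<^esub> ?b \<in> H"
      using g h a b by (simp add: H_def)
  qed
  then show ?thesis using n by (auto simp: H_def)
qed

text \<open>
  If \<open>\<tau>\<close> is not trivial at \<open>x0\<close> and \<open>\<tau>\<^sup>p\<close> is trivial, the powers \<open>\<tau>\<^sup>i\<close> with \<open>i < p\<close> already differ at \<open>x0\<close>,
  so they are distinct characters. The sum is used as a Lagrange resolvent and as a trace.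
\<close>
lemma nonvanishing_character_sum:
  assumes p: "Factorial_Ring.prime p" and \<tau>: "\<tau> \<in> carrier GF" "x0 \<in> E" "\<tau> x0 \<noteq> x0"
    and \<tau>p: "\<And>x. x \<in> E \<Longrightarrow> (\<tau> ^^ p) x = x" and c: "c 0 \<noteq> 0"
  shows "\<exists>w\<in>E. (\<Sum>i<p. c i * (\<tau> ^^ i) w) \<noteq> 0"
proof (rule ccontr)
  assume "\<not> ?thesis"
  then have zero: "(\<Sum>i<p. c i * (\<tau> ^^ i) w) = 0" if "w \<in> E" for w using that by simp
  have hom: "hom_on E \<tau>"
    by (rule hom_on_subset[OF galois_group_hom_on[OF subfield_set_sep_closure \<tau>(1)] E_separable])
  note pow = hom_on_funpow[OF hom E_normal[OF \<tau>(1)]]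
  have "c 0 = 0"
  proof (rule independence_of_characters[OF E])
    show "0 < p" using prime_gt_0_nat[OF p] .
    show "hom_on E (\<tau> ^^ i)" for i by (rule pow(1))
    show "(\<Sum>i<p. c i * (\<tau> ^^ i) x) = 0" if "x \<in> E" for x by (rule zero[OF that])
    fix i j assume ij: "i < j" "j < p"
    have "(\<tau> ^^ i) x0 \<noteq> (\<tau> ^^ j) x0"
    proof
      assume eq: "(\<tau> ^^ i) x0 = (\<tau> ^^ j) x0"
      also have "(\<tau> ^^ j) x0 = (\<tau> ^^ i) ((\<tau> ^^ (j - i)) x0)"
        using ij by (simp flip: funpow_add comp_apply[of "\<tau> ^^ i"])
      finally have "x0 = (\<tau> ^^ (j - i)) x0"
        using inj_onD[OF hom_on_inj[OF E pow(1)[of i]]] by (simp add: \<tau>(2) pow(2))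
      moreover have "coprime (j - i) p"
        using p ij by (metis coprime_commute less_imp_diff_less nat_dvd_not_less prime_imp_coprime zero_less_diff)
      ultimately have "\<tau> x0 = x0"
        using funpow_coprime_fixed[of "j - i" \<tau> x0 p] \<tau>p[OF \<tau>(2)] ij by simp
      then show False using \<tau>(3) by simp
    qed
    then show "\<exists>x\<in>E. (\<tau> ^^ i) x \<noteq> (\<tau> ^^ j) x" using \<tau>(2) by auto
  qed
  then show False using c by simp
qed

end

context prime_galois_extension
begin

section \<open>Automorphisms whose p-th power lies in the kernel\<close>

text \<open>
  The multiplicative form of the argument: \<open>\<gamma>\<close> below is fixed by \<open>\<tau>\<close> and is also a root of unity times
  the eigenvector \<open>\<alpha>\<close>, which \<open>\<tau>\<close> does not fix.
\<close>
lemma no_lift_of_prime_order_kummer: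
  fixes \<zeta> :: 'a
  assumes p: "Factorial_Ring.prime p" "p > 2"
    and \<zeta>: "\<zeta> ^ p = 1" "\<And>k. 0 < k \<Longrightarrow> k < p \<Longrightarrow> \<zeta> ^ k \<noteq> 1"
    and \<tau>: "\<tau> \<in> carrier GF" "\<tau> [^]\<^bsub>GF\<^esub> p \<in> T_kernel p E"
  shows "\<tau> \<in> carrier GE"
proof (rule ccontr)
  assume "\<tau> \<notin> carrier GE"
  then obtain x0 where x0: "x0 \<in> E" "\<tau> x0 \<noteq> x0" using \<tau>(1) by (auto simp: mem_galois_group_iff)
  have p0: "p > 0" using p by simp
  note S = subfield_set_sep_closure
  note hom = galois_group_hom_on[OF S]
  have pow_hom: "hom_on sep_closure (\<tau> ^^ i)" "x \<in> sep_closure \<Longrightarrow> (\<tau> ^^ i) x \<in> sep_closure" for i x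
    using hom_on_funpow[OF hom[OF \<tau>(1)] galois_group_closed[OF \<tau>(1)]] by simp_all
  note \<tau>p = funpow_trivial_on_E[OF \<tau>]
  define z where "z = to_ac \<zeta>"
  have zp: "z ^ p = 1" using \<zeta>(1) by (simp add: z_def flip: to_ac_power)
  have z1: "z \<noteq> 1" using \<zeta>(2)[of 1] p(2) by (simp add: z_def)
  have z0: "z \<noteq> 0" using zp p0 by (auto simp: power_0_left)
  have zF: "z ^ i \<in> base_field" for i by (auto simp: z_def base_field_def simp flip: to_ac_power)
  have zE: "z ^ i \<in> E" for i using zF base_E by auto
  have \<tau>z: "\<tau> (z ^ i) = z ^ i" for i by (rule galois_group_fixes[OF \<tau>(1) zF])
  \<comment> \<open>In characteristic \<open>p\<close> the equation \<open>\<zeta>\<^sup>p = 1\<close> means \<open>(\<zeta> - 1)\<^sup>p = 0\<close>.\<close>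
  have pF: "(of_nat p :: 'a alg_closure) \<noteq> 0"
  proof
    assume "(of_nat p :: 'a alg_closure) = 0"
    then have "CHAR('a) dvd p" by (simp add: of_nat_eq_0_iff_char_dvd)
    then have c: "CHAR('a) = p" using p(1) CHAR_not_1[where ?'a = 'a] by (auto simp: prime_nat_iff)
    have "((\<zeta> - 1) + 1) ^ p = (\<zeta> - 1) ^ p + 1 ^ p"
      by (rule freshmans_dream) (use c p in simp_all)
    then have "(\<zeta> - 1) ^ p = 0" using \<zeta>(1) by simp
    then show False using \<zeta>(2)[of 1] p(2) by simp
  qed
  \<comment> \<open>A nonzero Lagrange resolvent is an eigenvector of \<open>\<tau>\<close>.\<close>
  obtain w where w: "w \<in> E" "(\<Sum>i<p. z ^ i * (\<tau> ^^ i) w) \<noteq> 0"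
    using nonvanishing_character_sum[OF p(1) \<tau>(1) x0 \<tau>p, of "\<lambda>i. z ^ i"] by auto
  have wpow: "(\<tau> ^^ i) w \<in> E" for i by (induction i) (simp_all add: w(1) E_normal[OF \<tau>(1)])
  have E_S: "x \<in> sep_closure" if "x \<in> E" for x using that E_separable by auto
  define \<alpha> where "\<alpha> = (\<Sum>i<p. z ^ i * (\<tau> ^^ i) w)"
  have \<alpha>0: "\<alpha> \<noteq> 0" using w(2) by (simp add: \<alpha>_def)
  have \<alpha>E: "\<alpha> \<in> E" unfolding \<alpha>_def by (intro subfield_set_sum[OF E] subfield_set_mult[OF E] zE wpow)
  note \<alpha>S = E_S[OF \<alpha>E]
  have z\<tau>\<alpha>: "z * \<tau> \<alpha> = \<alpha>"
  proof -
    have "\<tau> \<alpha> = (\<Sum>i<p. \<tau> (z ^ i * (\<tau> ^^ i) w))"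
      unfolding \<alpha>_def by (rule hom_on_sum[OF S hom[OF \<tau>(1)]]) (intro E_S subfield_set_mult[OF E] zE wpow)
    also have "\<dots> = (\<Sum>i<p. z ^ i * (\<tau> ^^ Suc i) w)"
      by (simp add: hom_on_mult[OF S hom[OF \<tau>(1)]] E_S zE wpow \<tau>z)
    finally have "z * \<tau> \<alpha> = (\<Sum>i<p. z ^ Suc i * (\<tau> ^^ Suc i) w)"
      by (simp add: sum_distrib_left mult.assoc)
    also have "\<dots> = (\<Sum>i<Suc p. z ^ i * (\<tau> ^^ i) w) - w"
      by (subst sum.lessThan_Suc_shift) simp
    also have "\<dots> = \<alpha>" using zp \<tau>p[OF w(1)] by (simp add: \<alpha>_def)
    finally show ?thesis .
  qed
  have \<tau>\<alpha>: "\<tau> \<alpha> = \<alpha> / z" using z\<tau>\<alpha> z0 by (simp add: field_simps)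
  have \<tau>i\<alpha>: "(\<tau> ^^ i) \<alpha> = \<alpha> / z ^ i" for i
  proof (induction i)
    case (Suc i)
    have "(\<tau> ^^ Suc i) \<alpha> = \<tau> (\<alpha> * inverse (z ^ i))" using Suc by (simp add: divide_inverse)
    also have "\<dots> = \<tau> \<alpha> * inverse (\<tau> (z ^ i))"
      by (subst hom_on_mult[OF S hom[OF \<tau>(1)] \<alpha>S subfield_set_inverse[OF S E_S[OF zE]]])
        (simp add: hom_on_inverse[OF S hom[OF \<tau>(1)] E_S[OF zE]])
    finally show ?case by (simp add: \<tau>z \<tau>\<alpha> field_simps)
  qed simp
  define h where "h = Polynomial.monom (1 :: 'a alg_closure) p"
  have "Polynomial.coeff (h - [:\<alpha>:]) p = 1"
    unfolding h_def using p0 by (simp add: coeff_pCons split: nat.split)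
  then have "p \<le> Polynomial.degree (h - [:\<alpha>:])"
    by (intro Polynomial.le_degree) simp
  then obtain \<beta> where "poly (h - [:\<alpha>:]) \<beta> = 0"
    using alg_closed_imp_poly_has_root[of "h - [:\<alpha>:]"] p0 by auto
  then have \<beta>: "\<beta> ^ p = \<alpha>" by (simp add: h_def poly_monom)
  have \<beta>0: "\<beta> \<noteq> 0" using \<beta> \<alpha>0 p0 by (auto simp: power_0_left)
  have \<beta>S: "\<beta> \<in> sep_closure"
  proof (rule separable_preimage)
    show "h \<in> polys_over base_field"
      unfolding h_def by (intro polys_over_monom subfield_set_one subfield_set_base_field)
    show "poly h \<beta> \<in> sep_closure" by (simp add: h_def poly_monom \<beta> \<alpha>S)
    show "poly (pderiv h) \<beta> \<noteq> 0" by (simp add: h_def pderiv_monom poly_monom pF \<beta>0)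
  qed
  have unity: "u \<in> base_field" if "u ^ p = 1" for u :: "'a alg_closure"
    by (rule roots_of_unity_in_base_field[OF p0 \<zeta> that])
  have GE_\<beta>: "\<exists>u\<in>base_field. u ^ p = 1 \<and> g \<beta> = u * \<beta>" if g: "g \<in> carrier GE" for g
  proof -
    have "(g \<beta>) ^ p = g \<alpha>" using hom_on_power[OF S hom[OF g] \<beta>S, of p] \<beta> by simp
    also have "g \<alpha> = \<alpha>" by (rule galois_group_fixes[OF g \<alpha>E])
    finally have "(g \<beta> / \<beta>) ^ p = 1" using \<beta> \<alpha>0 by (simp add: power_divide)
    then show ?thesis using unity \<beta>0 by (intro bexI[of _ "g \<beta> / \<beta>"]) simp_all
  qed
  have GE_mult: "g (u * \<beta>) = u * g \<beta>" if g: "g \<in> carrier GE" and u: "u \<in> base_field" for g u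
    using hom_on_mult[OF S hom[OF g] _ \<beta>S, of u] galois_group_fixes[OF g, of u] base_E E_S u by auto
  have ker_\<beta>: "n \<beta> = \<beta>" if "n \<in> T_kernel p E" for n
  proof (rule T_kernel_fixes[OF \<beta>S _ _ that])
    fix g assume g: "g \<in> carrier GE"
    obtain u where u: "u \<in> base_field" "u ^ p = 1" "g \<beta> = u * \<beta>" using GE_\<beta>[OF g] by auto
    have "(g ^^ i) \<beta> = u ^ i * \<beta>" for i
    proof (induction i)
      case (Suc i)
      then show ?case
        using GE_mult[OF g subfield_set_power[OF subfield_set_base_field u(1)]] u(3) by (simp add: mult_ac)
    qed simp
    then show "(g ^^ p) \<beta> = \<beta>" using u(2) by simp
    fix g' assume g': "g' \<in> carrier GE"
    obtain u' where u': "u' \<in> base_field" "u' ^ p = 1" "g' \<beta> = u' * \<beta>" using GE_\<beta>[OF g'] by auto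
    show "g (g' \<beta>) = g' (g \<beta>)" using u u' GE_mult[OF g u'(1)] GE_mult[OF g' u(1)] by (simp add: mult_ac)
  qed
  have \<tau>p\<beta>: "(\<tau> ^^ p) \<beta> = \<beta>"
    using ker_\<beta>[OF \<tau>(2)] galois_group_apply_pow[OF S base_field_subset_sep_closure \<tau>(1) \<beta>S] by simp
  \<comment> \<open>The factors of \<open>\<gamma>\<close> are permuted cyclically by \<open>\<tau>\<close> because \<open>\<tau>\<^sup>p\<close> fixes \<open>\<beta>\<close>.\<close>
  define \<gamma> where "\<gamma> = (\<Prod>i<p. (\<tau> ^^ i) \<beta>)"
  have \<tau>i\<beta>0: "(\<tau> ^^ i) \<beta> \<noteq> 0" for i
    using hom_on_eq_0_iff[OF S pow_hom(1) \<beta>S] \<beta>0 by simp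
  then have \<gamma>0: "\<gamma> \<noteq> 0" by (simp add: \<gamma>_def)
  have \<tau>\<gamma>: "\<tau> \<gamma> = \<gamma>"
  proof -
    have "\<tau> \<gamma> = (\<Prod>i<p. (\<tau> ^^ Suc i) \<beta>)"
      unfolding \<gamma>_def by (subst hom_on_prod[OF S hom[OF \<tau>(1)]]) (simp_all add: pow_hom(2) \<beta>S)
    then have "\<beta> * \<tau> \<gamma> = (\<Prod>i<Suc p. (\<tau> ^^ i) \<beta>)"
      by (subst prod.lessThan_Suc_shift) simp
    also have "\<dots> = \<beta> * \<gamma>" using \<tau>p\<beta> by (simp add: \<gamma>_def)
    finally show ?thesis using \<beta>0 by simp
  qed
  have "\<gamma> ^ p = (\<Prod>i<p. (\<tau> ^^ i) \<alpha>)"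
    using hom_on_power[OF S pow_hom(1) \<beta>S, where n = p] by (simp add: \<gamma>_def prod_power_distrib \<beta>)
  also have "\<dots> = \<alpha> ^ p / z ^ (\<Sum>i<p. i)"
    by (simp add: \<tau>i\<alpha> prod_dividef power_sum)
  \<comment> \<open>This is where \<open>p\<close> is odd: the exponent is \<open>p (p - 1) / 2\<close>.\<close>
  also have "z ^ (\<Sum>i<p. i) = 1"
  proof -
    have "odd p" using p by (simp add: prime_odd_nat)
    then obtain m where "p = 2 * m + 1" by (rule oddE)
    then have "(\<Sum>i<p. i) = p * m" using sum_less_odd[of m] by simp
    then show ?thesis using zp by (simp add: power_mult)
  qed
  finally have "(\<gamma> / \<alpha>) ^ p = 1" using \<alpha>0 by (simp add: power_divide)
  then have uF: "\<gamma> / \<alpha> \<in> base_field" by (rule unity)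
  have "\<tau> (\<gamma> / \<alpha> * \<alpha>) = \<gamma> / \<alpha> * \<tau> \<alpha>"
    using hom_on_mult[OF S hom[OF \<tau>(1)] _ \<alpha>S, of "\<gamma> / \<alpha>"] galois_group_fixes[OF \<tau>(1) uF]
      subsetD[OF base_field_subset_sep_closure uF] by simp
  then have "\<gamma> = \<gamma> / z" using \<alpha>0 by (simp add: \<tau>\<gamma> \<tau>\<alpha>)
  then show False using \<gamma>0 z0 z1 by (simp add: field_simps)
qed

text \<open>
  The additive form of the argument: \<open>\<gamma>\<close> below is fixed by \<open>\<tau>\<close> and differs by an element of the prime field
  from \<open>\<theta>\<close>, which \<open>\<tau>\<close> does not fix.
\<close>
lemma no_lift_of_prime_order_artin_schreier:
  assumes p: "Factorial_Ring.prime p" and char: "CHAR('a) = p"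
    and \<tau>: "\<tau> \<in> carrier GF" "\<tau> [^]\<^bsub>GF\<^esub> p \<in> T_kernel p E"
  shows "\<tau> \<in> carrier GE"
proof (rule ccontr)
  assume "\<tau> \<notin> carrier GE"
  then obtain x0 where x0: "x0 \<in> E" "\<tau> x0 \<noteq> x0" using \<tau>(1) by (auto simp: mem_galois_group_iff)
  have p0: "p > 0" and p1: "p > 1" using prime_gt_0_nat[OF p] prime_gt_1_nat[OF p] .
  have of_p: "(of_nat p :: 'a alg_closure) = 0" by (simp add: of_nat_eq_0_iff_char_dvd char)
  have frob_add: "(x + y) ^ p = x ^ p + y ^ p" for x y :: "'a alg_closure"
    by (rule freshmans_dream) (simp_all add: char p)
  have frob_diff: "(x - y) ^ p = x ^ p - y ^ p" for x y :: "'a alg_closure"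
    using frob_add[of "x - y" y] by (simp add: algebra_simps)
  note S = subfield_set_sep_closure
  note hom = galois_group_hom_on[OF S]
  note h\<tau> = hom[OF \<tau>(1)]
  have pow_hom: "hom_on sep_closure (\<tau> ^^ i)" "x \<in> sep_closure \<Longrightarrow> (\<tau> ^^ i) x \<in> sep_closure" for i x
    using hom_on_funpow[OF h\<tau> galois_group_closed[OF \<tau>(1)]] by simp_all
  have E_S: "x \<in> sep_closure" if "x \<in> E" for x using that E_separable by auto
  note \<tau>p = funpow_trivial_on_E[OF \<tau>]
  obtain w where w: "w \<in> E" "(\<Sum>i<p. (\<tau> ^^ i) w) \<noteq> 0"
    using nonvanishing_character_sum[OF p \<tau>(1) x0 \<tau>p, of "\<lambda>i. 1"] by auto
  have wpow: "(\<tau> ^^ i) w \<in> E" for i by (induction i) (simp_all add: w(1) E_normal[OF \<tau>(1)])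
  define c where "c = (\<Sum>i<p. (\<tau> ^^ i) w)"
  have c0: "c \<noteq> 0" using w(2) by (simp add: c_def)
  have cE: "c \<in> E" unfolding c_def by (intro subfield_set_sum[OF E] wpow)
  have shift_sum: "(\<Sum>i<p. (\<tau> ^^ Suc i) x) = (\<Sum>i<p. (\<tau> ^^ i) x)" if "(\<tau> ^^ p) x = x" for x
  proof -
    have "x + (\<Sum>i<p. (\<tau> ^^ Suc i) x) = (\<Sum>i<Suc p. (\<tau> ^^ i) x)"
      by (subst sum.lessThan_Suc_shift) simp
    also have "\<dots> = x + (\<Sum>i<p. (\<tau> ^^ i) x)" using that by simp
    finally show ?thesis by simp
  qed
  have \<tau>_sum: "\<tau> (\<Sum>i<p. (\<tau> ^^ i) x) = (\<Sum>i<p. (\<tau> ^^ i) x)" if "x \<in> sep_closure" "(\<tau> ^^ p) x = x" for x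
  proof -
    have "\<tau> (\<Sum>i<p. (\<tau> ^^ i) x) = (\<Sum>i<p. \<tau> ((\<tau> ^^ i) x))"
      by (rule hom_on_sum[OF S h\<tau>]) (rule pow_hom(2)[OF that(1)])
    then show ?thesis using shift_sum[OF that(2)] by simp
  qed
  have \<tau>c: "\<tau> c = c" unfolding c_def by (rule \<tau>_sum[OF E_S[OF w(1)] \<tau>p[OF w(1)]])
  \<comment> \<open>The weights \<open>i\<close> drop by one under the shift, and \<open>p = 0\<close> closes the cycle, so \<open>\<tau> s = s - c\<close>.\<close>
  define s where "s = (\<Sum>i<p. of_nat i * (\<tau> ^^ i) w)"
  have natE: "(of_nat i :: 'a alg_closure) \<in> E" for i by (rule subfield_set_of_nat[OF E])
  have \<tau>nat: "\<tau> (of_nat i) = of_nat i" for i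
    by (rule galois_group_fixes[OF \<tau>(1) subfield_set_of_nat[OF subfield_set_base_field]])
  have sE: "s \<in> E" unfolding s_def by (intro subfield_set_sum[OF E] subfield_set_mult[OF E] wpow natE)
  have \<tau>s: "\<tau> s = s - c"
  proof -
    have "\<tau> s = (\<Sum>i<p. \<tau> (of_nat i * (\<tau> ^^ i) w))"
      unfolding s_def by (rule hom_on_sum[OF S h\<tau>]) (intro E_S subfield_set_mult[OF E] wpow natE)
    also have "\<dots> = (\<Sum>i<p. of_nat i * (\<tau> ^^ Suc i) w)"
      by (simp add: hom_on_mult[OF S h\<tau>] E_S natE wpow \<tau>nat)
    also have "\<dots> = (\<Sum>i<p. of_nat (Suc i) * (\<tau> ^^ Suc i) w) - (\<Sum>i<p. (\<tau> ^^ Suc i) w)"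
      by (simp add: sum_subtractf[symmetric] algebra_simps)
    also have "(\<Sum>i<p. of_nat (Suc i) * (\<tau> ^^ Suc i) w) = (\<Sum>i<Suc p. of_nat i * (\<tau> ^^ i) w)"
      by (subst sum.lessThan_Suc_shift) simp
    also have "\<dots> = s" by (simp add: s_def of_p)
    also have "(\<Sum>i<p. (\<tau> ^^ Suc i) w) = c" unfolding c_def by (rule shift_sum[OF \<tau>p[OF w(1)]])
    finally show ?thesis .
  qed
  define \<theta> where "\<theta> = - s / c"
  have \<theta>E: "\<theta> \<in> E" unfolding \<theta>_def by (intro subfield_set_divide[OF E] subfield_set_uminus[OF E] sE cE)
  have \<tau>_divide: "\<tau> (x / y) = \<tau> x / \<tau> y" if "x \<in> sep_closure" "y \<in> sep_closure" for x y
    using that by (simp add: divide_inverse hom_on_mult[OF S h\<tau>] hom_on_inverse[OF S h\<tau>] subfield_set_inverse[OF S])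
  have \<tau>\<theta>: "\<tau> \<theta> = \<theta> + 1"
  proof -
    have "\<tau> \<theta> = \<tau> (- s) / \<tau> c"
      unfolding \<theta>_def by (rule \<tau>_divide[OF subfield_set_uminus[OF S E_S[OF sE]] E_S[OF cE]])
    then have "\<tau> \<theta> = - \<tau> s / \<tau> c"
      by (simp only: hom_on_uminus[OF S h\<tau> E_S[OF sE]])
    then show ?thesis using c0 by (simp add: \<tau>s \<tau>c \<theta>_def field_simps)
  qed
  define a where "a = \<theta> ^ p - \<theta>"
  have aE: "a \<in> E" unfolding a_def by (intro subfield_set_diff[OF E] subfield_set_power[OF E] \<theta>E)
  have \<tau>a: "\<tau> a = a"
    using E_S[OF \<theta>E] by (simp add: a_def hom_on_diff[OF S h\<tau>] hom_on_power[OF S h\<tau>] subfield_set_power[OF S] \<tau>\<theta> frob_add)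
  \<comment> \<open>Since \<open>a / c\<close> is fixed by \<open>\<tau>\<close> and \<open>w\<close> has trace \<open>c\<close>, the element \<open>y\<close> has trace \<open>a\<close>.\<close>
  define y where "y = a / c * w"
  have acE: "a / c \<in> E" by (rule subfield_set_divide[OF E aE cE])
  have yE: "y \<in> E" unfolding y_def by (rule subfield_set_mult[OF E acE w(1)])
  have \<tau>ac: "\<tau> (a / c) = a / c" using \<tau>_divide[OF E_S[OF aE] E_S[OF cE]] by (simp add: \<tau>a \<tau>c)
  have \<tau>iy: "(\<tau> ^^ i) y = a / c * (\<tau> ^^ i) w" for i
  proof (induction i)
    case (Suc i)
    then show ?case using hom_on_mult[OF S h\<tau> E_S[OF acE] E_S[OF wpow[of i]]] \<tau>ac by simp
  qed (simp add: y_def)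
  have trace_y: "(\<Sum>i<p. (\<tau> ^^ i) y) = a"
  proof -
    have "(\<Sum>i<p. (\<tau> ^^ i) y) = a / c * c"
      unfolding \<tau>iy c_def by (rule sum_distrib_left[symmetric])
    then show ?thesis using c0 by simp
  qed
  \<comment> \<open>A root \<open>\<beta>\<close> of \<open>X\<^sup>p - X - y\<close>; it is separable as the derivative is \<open>-1\<close>.\<close>
  define h where "h = Polynomial.monom (1 :: 'a alg_closure) p - [:0, 1:]"
  have hy: "poly (h - [:y:]) x = x ^ p - x - y" for x by (simp add: h_def poly_monom)
  have "Polynomial.coeff (h - [:y:]) p = 1"
    unfolding h_def using p1 by (simp add: coeff_pCons split: nat.split)
  then have "p \<le> Polynomial.degree (h - [:y:])"
    by (intro Polynomial.le_degree) simp
  then obtain \<beta> where "poly (h - [:y:]) \<beta> = 0"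
    using alg_closed_imp_poly_has_root[of "h - [:y:]"] p0 by auto
  then have \<beta>: "\<beta> ^ p - \<beta> = y" using hy by simp
  have \<beta>S: "\<beta> \<in> sep_closure"
  proof (rule separable_preimage)
    show "h \<in> polys_over base_field"
      unfolding h_def using subfield_set_base_field
      by (intro polys_over_diff polys_over_monom polys_over_pCons polys_over_0 subfield_set_one subfield_set_zero)
    show "poly h \<beta> \<in> sep_closure" using \<beta> E_S[OF yE] by (simp add: h_def poly_monom)
    show "poly (pderiv h) \<beta> \<noteq> 0"
      by (simp add: h_def pderiv_diff pderiv_monom pderiv_pCons poly_monom of_p)
  qed
  have prime_field: "u \<in> base_field" if "u ^ p - u = 0" for u :: "'a alg_closure"
    by (rule frobenius_fixed_in_base_field[OF p0 char]) (use \<open>u ^ p - u = 0\<close> in simp)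
  have GE_\<beta>: "\<exists>u\<in>base_field. g \<beta> = \<beta> + u" if g: "g \<in> carrier GE" for g
  proof -
    have "(g \<beta>) ^ p - g \<beta> = g (\<beta> ^ p - \<beta>)"
      using \<beta>S by (simp add: hom_on_diff[OF S hom[OF g]] hom_on_power[OF S hom[OF g]] subfield_set_power[OF S])
    also have "\<dots> = \<beta> ^ p - \<beta>" unfolding \<beta> by (rule galois_group_fixes[OF g yE])
    finally have "(g \<beta> - \<beta>) ^ p - (g \<beta> - \<beta>) = 0" by (simp add: frob_diff algebra_simps)
    then show ?thesis using prime_field by (intro bexI[of _ "g \<beta> - \<beta>"]) simp_all
  qed
  have GE_add: "g (\<beta> + u) = g \<beta> + u" if g: "g \<in> carrier GE" and u: "u \<in> base_field" for g u
    using hom_on_add[OF S hom[OF g] \<beta>S, of u] galois_group_fixes[OF g, of u] base_E E_S u by auto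
  have ker_\<beta>: "n \<beta> = \<beta>" if "n \<in> T_kernel p E" for n
  proof (rule T_kernel_fixes[OF \<beta>S _ _ that])
    fix g assume g: "g \<in> carrier GE"
    obtain u where u: "u \<in> base_field" "g \<beta> = \<beta> + u" using GE_\<beta>[OF g] by auto
    have "(g ^^ i) \<beta> = \<beta> + of_nat i * u" for i
    proof (induction i)
      case (Suc i)
      have "of_nat i * u \<in> base_field"
        by (intro subfield_set_mult subfield_set_of_nat subfield_set_base_field u(1))
      then have "g (\<beta> + of_nat i * u) = \<beta> + u + of_nat i * u"
        using GE_add[OF g] u(2) by simp
      then show ?case using Suc by (simp add: distrib_right)
    qed simp
    then show "(g ^^ p) \<beta> = \<beta>" by (simp add: of_p)
    fix g' assume g': "g' \<in> carrier GE"
    obtain u' where u': "u' \<in> base_field" "g' \<beta> = \<beta> + u'" using GE_\<beta>[OF g'] by auto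
    show "g (g' \<beta>) = g' (g \<beta>)" using u u' GE_add[OF g u'(1)] GE_add[OF g' u(1)] by simp
  qed
  have \<tau>p\<beta>: "(\<tau> ^^ p) \<beta> = \<beta>"
    using ker_\<beta>[OF \<tau>(2)] galois_group_apply_pow[OF S base_field_subset_sep_closure \<tau>(1) \<beta>S] by simp
  define \<gamma> where "\<gamma> = (\<Sum>i<p. (\<tau> ^^ i) \<beta>)"
  have \<tau>\<gamma>: "\<tau> \<gamma> = \<gamma>" unfolding \<gamma>_def by (rule \<tau>_sum[OF \<beta>S \<tau>p\<beta>])
  have \<gamma>S: "\<gamma> \<in> sep_closure" unfolding \<gamma>_def by (intro subfield_set_sum[OF S] pow_hom(2)[OF \<beta>S])
  have "\<gamma> ^ p = (\<Sum>i<p. ((\<tau> ^^ i) \<beta>) ^ p)"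
    unfolding \<gamma>_def by (rule freshmans_dream_sum) (simp_all add: char p)
  then have "\<gamma> ^ p - \<gamma> = (\<Sum>i<p. ((\<tau> ^^ i) \<beta>) ^ p - (\<tau> ^^ i) \<beta>)"
    by (simp add: \<gamma>_def sum_subtractf)
  also have "\<dots> = (\<Sum>i<p. (\<tau> ^^ i) (\<beta> ^ p - \<beta>))"
    using \<beta>S by (simp add: hom_on_diff[OF S pow_hom(1)] hom_on_power[OF S pow_hom(1)] subfield_set_power[OF S])
  also have "\<dots> = \<theta> ^ p - \<theta>" unfolding \<beta> trace_y by (rule a_def)
  finally have "(\<gamma> - \<theta>) ^ p - (\<gamma> - \<theta>) = 0" by (simp add: frob_diff algebra_simps)
  then have "\<gamma> - \<theta> \<in> base_field" by (rule prime_field)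
  then have "\<tau> (\<gamma> - \<theta>) = \<gamma> - \<theta>" by (rule galois_group_fixes[OF \<tau>(1)])
  then show False using hom_on_diff[OF S h\<tau> \<gamma>S E_S[OF \<theta>E]] by (simp add: \<tau>\<gamma> \<tau>\<theta>)
qed

end

context prime_galois_extension
begin

section \<open>Elementary abelian subgroups of T\<close>

lemma GE_eq_restrict: "GE = GF\<lparr>carrier := carrier GE\<rparr>"
  by (rule galois_group_eq_restrict)

lemma subgroup_GE: "subgroup (carrier GE) GF"
  by (rule subgroup_galois_group[OF subfield_set_sep_closure base_E E_separable])

lemma GE_inv: "g \<in> carrier GE \<Longrightarrow> inv\<^bsub>GE\<^esub> g = inv\<^bsub>GF\<^esub> g"
  by (subst GE_eq_restrict) (rule group.m_inv_consistent[OF group_GF subgroup_GE])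

lemma GE_mult: "mult GE = mult GF" and GE_pow: "g [^]\<^bsub>GE\<^esub> (n::nat) = g [^]\<^bsub>GF\<^esub> n"
  by (simp add: galois_group_def)
    (subst GE_eq_restrict, rule monoid.nat_pow_consistent[OF group.is_monoid[OF group_GF], symmetric])

text \<open>
  \<open>E\<close> is mapped to itself by \<open>G\<^sub>F\<close>.
\<close>
lemma GE_normal: "carrier GE \<lhd> GF"
proof -
  interpret GF: group GF by (rule group_GF)
  note S = subfield_set_sep_closure
  note apply_mult = galois_group_apply_mult[of _ sep_closure base_field]
  note apply_inv = galois_group_apply_inv[OF S base_field_subset_sep_closure]
  show ?thesis
    unfolding GF.normal_inv_iff
  proof (intro conjI ballI)
    show "subgroup (carrier GE) GF" by (rule subgroup_GE)
    fix x h assume x: "x \<in> carrier GF" and h: "h \<in> carrier GE"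
    have hF: "h \<in> carrier GF" using GE_subset_GF h by auto
    have i: "inv\<^bsub>GF\<^esub> x \<in> carrier GF" using x by simp
    have "(x \<otimes>\<^bsub>GF\<^esub> h \<otimes>\<^bsub>GF\<^esub> inv\<^bsub>GF\<^esub> x) e = e" if e: "e \<in> E" for e
    proof -
      have eS: "e \<in> sep_closure" using e E_separable by auto
      have "(x \<otimes>\<^bsub>GF\<^esub> h \<otimes>\<^bsub>GF\<^esub> inv\<^bsub>GF\<^esub> x) e = x (h ((inv\<^bsub>GF\<^esub> x) e))"
        using x hF i eS galois_group_closed[OF i eS] by (simp add: apply_mult)
      also have "h ((inv\<^bsub>GF\<^esub> x) e) = (inv\<^bsub>GF\<^esub> x) e"
        by (rule galois_group_fixes[OF h E_normal[OF i e]])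
      also have "x ((inv\<^bsub>GF\<^esub> x) e) = e" by (rule apply_inv(2)[OF x eS])
      finally show ?thesis .
    qed
    moreover have "x \<otimes>\<^bsub>GF\<^esub> h \<otimes>\<^bsub>GF\<^esub> inv\<^bsub>GF\<^esub> x \<in> carrier GF" using x hF i by simp
    ultimately show "x \<otimes>\<^bsub>GF\<^esub> h \<otimes>\<^bsub>GF\<^esub> inv\<^bsub>GF\<^esub> x \<in> carrier GE"
      by (simp add: mem_galois_group_iff)
  qed
qed

lemma T_kernel_eq_Inter:
  "T_kernel p E = \<Inter>{H. subgroup H GE \<and> closedin (krull_topology sep_closure E) H \<and>
     {g [^]\<^bsub>GE\<^esub> p | g. g \<in> carrier GE} \<union> derived_set GE (carrier GE) \<subseteq> H}"
  by (simp only: T_kernel_def power_commutator_subgroup_def closed_subgroup_generated_def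
    abs_galois_group_def abs_galois_topology_def)

lemma subgroup_T_kernel: "subgroup (T_kernel p E) GF"
proof -
  interpret GE: group GE by (rule group_GE)
  have "subgroup (T_kernel p E) GE"
    unfolding T_kernel_eq_Inter
  proof (rule GE.subgroups_Inter)
    have "carrier GE \<in> {H. subgroup H GE \<and> closedin (krull_topology sep_closure E) H \<and>
     {g [^]\<^bsub>GE\<^esub> p | g. g \<in> carrier GE} \<union> derived_set GE (carrier GE) \<subseteq> H}"
      using GE.subgroup_self by (auto simp: closedin_krull_iff)
    then show "{H. subgroup H GE \<and> closedin (krull_topology sep_closure E) H \<and>
     {g [^]\<^bsub>GE\<^esub> p | g. g \<in> carrier GE} \<union> derived_set GE (carrier GE) \<subseteq> H} \<noteq> {}" by auto
  qed auto
  then show ?thesis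
    using group.incl_subgroup[OF group_GF subgroup_GE] GE_eq_restrict by simp
qed

lemma pow_mem_T_kernel: "g \<in> carrier GE \<Longrightarrow> g [^]\<^bsub>GE\<^esub> p \<in> T_kernel p E"
  and commutator_mem_T_kernel: "g \<in> carrier GE \<Longrightarrow> h \<in> carrier GE \<Longrightarrow>
      g \<otimes>\<^bsub>GE\<^esub> h \<otimes>\<^bsub>GE\<^esub> inv\<^bsub>GE\<^esub> g \<otimes>\<^bsub>GE\<^esub> inv\<^bsub>GE\<^esub> h \<in> T_kernel p E"
  unfolding T_kernel_eq_Inter by auto

text \<open>
  Conjugation by \<open>x \<in> G\<^sub>F\<close> is a continuous automorphism of \<open>G\<^sub>E\<close> that preserves \<open>p\<close>-th powers and
  commutators. So the preimage of each subgroup \<open>H\<close> in the intersection that defines the kernel is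
  again one of these subgroups.
\<close>
lemma T_kernel_normal: "T_kernel p E \<lhd> GF"
proof -
  interpret GF: group GF by (rule group_GF)
  interpret GE: group GE by (rule group_GE)
  note S = subfield_set_sep_closure
  have conj: "x \<otimes>\<^bsub>GF\<^esub> n \<otimes>\<^bsub>GF\<^esub> inv\<^bsub>GF\<^esub> x \<in> H"
    if x: "x \<in> carrier GF" and n: "n \<in> T_kernel p E"
      and H: "subgroup H GE" "closedin (krull_topology sep_closure E) H"
        "{g [^]\<^bsub>GE\<^esub> p | g. g \<in> carrier GE} \<union> derived_set GE (carrier GE) \<subseteq> H" for x n H
  proof -
    have i: "inv\<^bsub>GF\<^esub> x \<in> carrier GF" using x by simp
    define c where "c g = x \<otimes>\<^bsub>GF\<^esub> g \<otimes>\<^bsub>GF\<^esub> inv\<^bsub>GF\<^esub> x" for g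
    have c_closed: "c g \<in> carrier GE" if "g \<in> carrier GE" for g
      unfolding c_def using GE_normal x that by (simp only: GF.normal_inv_iff)
    have c_hom: "c \<in> hom GE GE"
    proof (rule homI[OF c_closed])
      fix g h assume "g \<in> carrier GE" "h \<in> carrier GE"
      then have gh: "g \<in> carrier GF" "h \<in> carrier GF" using GE_subset_GF by auto
      have "c g \<otimes>\<^bsub>GF\<^esub> c h = x \<otimes>\<^bsub>GF\<^esub> g \<otimes>\<^bsub>GF\<^esub> (inv\<^bsub>GF\<^esub> x \<otimes>\<^bsub>GF\<^esub> x) \<otimes>\<^bsub>GF\<^esub> h \<otimes>\<^bsub>GF\<^esub> inv\<^bsub>GF\<^esub> x"
        unfolding c_def using x gh i by (simp only: GF.m_assoc GF.m_closed)
      also have "\<dots> = c (g \<otimes>\<^bsub>GF\<^esub> h)"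
        using x gh by (simp add: c_def GF.m_assoc)
      finally show "c (g \<otimes>\<^bsub>GE\<^esub> h) = c g \<otimes>\<^bsub>GE\<^esub> c h" by (simp add: GE_mult)
    qed
    interpret c: group_hom GE GE c by unfold_locales (rule c_hom)
    have c_apply: "c g s = x (g ((inv\<^bsub>GF\<^esub> x) s))" if "g \<in> carrier GE" "s \<in> sep_closure" for g s
    proof -
      have g: "g \<in> carrier GF" using that(1) GE_subset_GF by auto
      show ?thesis
        unfolding c_def using x g i that(2) galois_group_closed[OF i that(2)]
        by (simp add: galois_group_apply_mult[of _ sep_closure base_field])
    qed
    define H' where "H' = {g \<in> carrier GE. c g \<in> H}"
    have "T_kernel p E \<subseteq> H'"
    proof (rule T_kernel_least)
      show "subgroup H' GE"
      proof (rule GE.subgroupI)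
        show "H' \<subseteq> carrier GE" by (simp add: H'_def)
        have "\<one>\<^bsub>GE\<^esub> \<in> H'" using subgroup.one_closed[OF H(1)] by (simp add: H'_def)
        then show "H' \<noteq> {}" by auto
        show "inv\<^bsub>GE\<^esub> g \<in> H'" if "g \<in> H'" for g
          using that subgroup.m_inv_closed[OF H(1)] by (simp add: H'_def)
        show "g \<otimes>\<^bsub>GE\<^esub> h \<in> H'" if "g \<in> H'" "h \<in> H'" for g h
          using that subgroup.m_closed[OF H(1)] by (simp add: H'_def)
      qed
      show "closedin (krull_topology sep_closure E) H'"
        unfolding closedin_krull_iff
      proof (intro conjI ballI)
        show "H' \<subseteq> carrier GE" by (simp add: H'_def)
        fix \<sigma> assume "\<sigma> \<in> carrier GE - H'"
        then have \<sigma>: "\<sigma> \<in> carrier GE" "c \<sigma> \<in> carrier GE - H" using c_closed by (auto simp: H'_def)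
        obtain D where D: "finite D" "D \<subseteq> sep_closure"
          "{\<tau> \<in> carrier GE. \<forall>s\<in>D. \<tau> s = c \<sigma> s} \<subseteq> carrier GE - H"
          using bspec[OF conjunct2[OF iffD1[OF closedin_krull_iff H(2)]] \<sigma>(2)] by (elim exE conjE)
        show "\<exists>D. finite D \<and> D \<subseteq> sep_closure \<and> {\<tau> \<in> carrier GE. \<forall>s\<in>D. \<tau> s = \<sigma> s} \<subseteq> carrier GE - H'"
        proof (intro exI[of _ "(inv\<^bsub>GF\<^esub> x) ` D"] conjI)
          show "finite ((inv\<^bsub>GF\<^esub> x) ` D)" using D(1) by simp
          show "(inv\<^bsub>GF\<^esub> x) ` D \<subseteq> sep_closure"
            using D(2) galois_group_closed[OF i] by auto
          show "{\<tau> \<in> carrier GE. \<forall>s\<in>(inv\<^bsub>GF\<^esub> x) ` D. \<tau> s = \<sigma> s} \<subseteq> carrier GE - H'"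
          proof
            fix \<tau> assume "\<tau> \<in> {\<tau> \<in> carrier GE. \<forall>s\<in>(inv\<^bsub>GF\<^esub> x) ` D. \<tau> s = \<sigma> s}"
            then have \<tau>: "\<tau> \<in> carrier GE" "\<And>s. s \<in> D \<Longrightarrow> \<tau> ((inv\<^bsub>GF\<^esub> x) s) = \<sigma> ((inv\<^bsub>GF\<^esub> x) s)" by auto
            have "c \<tau> s = c \<sigma> s" if "s \<in> D" for s
              using c_apply[OF \<tau>(1)] c_apply[OF \<sigma>(1)] \<tau>(2)[OF that] subsetD[OF D(2) that] by simp
            then have "c \<tau> \<in> carrier GE - H" using D(3) c_closed[OF \<tau>(1)] by auto
            then show "\<tau> \<in> carrier GE - H'" using \<tau>(1) by (simp add: H'_def)
          qed
        qed
      qed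
      show "g [^]\<^bsub>GE\<^esub> p \<in> H'" if g: "g \<in> carrier GE" for g
      proof -
        have "c g [^]\<^bsub>GE\<^esub> p \<in> {g [^]\<^bsub>GE\<^esub> p | g. g \<in> carrier GE}" using c_closed[OF g] by auto
        then have "c g [^]\<^bsub>GE\<^esub> p \<in> H" using H(3) by auto
        then show ?thesis using g by (simp add: H'_def c.hom_nat_pow)
      qed
      show "g \<otimes>\<^bsub>GE\<^esub> h \<otimes>\<^bsub>GE\<^esub> inv\<^bsub>GE\<^esub> g \<otimes>\<^bsub>GE\<^esub> inv\<^bsub>GE\<^esub> h \<in> H'"
        if "g \<in> carrier GE" "h \<in> carrier GE" for g h
      proof -
        have "c g \<otimes>\<^bsub>GE\<^esub> c h \<otimes>\<^bsub>GE\<^esub> inv\<^bsub>GE\<^esub> c g \<otimes>\<^bsub>GE\<^esub> inv\<^bsub>GE\<^esub> c h \<in> derived_set GE (carrier GE)"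
          using c_closed[OF that(1)] c_closed[OF that(2)] by auto
        then show ?thesis using that H(3) by (auto simp: H'_def)
      qed
    qed
    then show ?thesis using n by (auto simp: H'_def c_def)
  qed
  show ?thesis
    unfolding GF.normal_inv_iff
  proof (intro conjI ballI)
    show "subgroup (T_kernel p E) GF" by (rule subgroup_T_kernel)
    fix x n assume "x \<in> carrier GF" "n \<in> T_kernel p E"
    from conj[OF this] show "x \<otimes>\<^bsub>GF\<^esub> n \<otimes>\<^bsub>GF\<^esub> inv\<^bsub>GF\<^esub> x \<in> T_kernel p E"
      by (subst T_kernel_eq_Inter) simp
  qed
qed

definition T_proj where "T_proj p \<sigma> = T_kernel p E #>\<^bsub>GF\<^esub> \<sigma>"

lemma T_group_eq: "T_group p E = GF Mod T_kernel p E"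
  by (simp add: T_group_def abs_galois_group_def)

lemma group_hom_T_proj: "group_hom GF (T_group p E) (T_proj p)"
proof -
  interpret N: normal "T_kernel p E" GF by (rule T_kernel_normal)
  show ?thesis
    unfolding T_group_eq
  proof (rule group_hom.intro[OF group_GF N.factorgroup_is_group], rule group_hom_axioms.intro)
    show "T_proj p \<in> hom GF (GF Mod T_kernel p E)"
      unfolding T_proj_def[abs_def] by (rule N.r_coset_hom_Mod)
  qed
qed

lemma carrier_T_group: "carrier (T_group p E) = T_proj p ` carrier GF"
  by (auto simp: T_group_eq FactGroup_def RCOSETS_def T_proj_def)

lemma one_T_group: "\<one>\<^bsub>T_group p E\<^esub> = T_kernel p E"
  by (simp add: T_group_eq FactGroup_def)

lemma T_proj_eq_one_iff:
  assumes "\<sigma> \<in> carrier GF"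
  shows "T_proj p \<sigma> = \<one>\<^bsub>T_group p E\<^esub> \<longleftrightarrow> \<sigma> \<in> T_kernel p E"
  unfolding one_T_group T_proj_def
  using group.coset_join1[OF group_GF _ assms subgroup_T_kernel]
    group.coset_join2[OF group_GF assms subgroup_T_kernel] by auto

definition GE_image where "GE_image p = T_proj p ` carrier GE"

text \<open>
  The kernel of the projection is contained in \<open>G\<^sub>E\<close>, so \<open>G\<^sub>E\<close> is the full preimage of its image.
\<close>
lemma T_proj_mem_GE_image_iff:
  assumes \<sigma>: "\<sigma> \<in> carrier GF"
  shows "T_proj p \<sigma> \<in> GE_image p \<longleftrightarrow> \<sigma> \<in> carrier GE"
proof
  assume "T_proj p \<sigma> \<in> GE_image p"
  then obtain g where g: "g \<in> carrier GE" "T_proj p \<sigma> = T_proj p g" unfolding GE_image_def by (rule imageE)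
  have "\<sigma> \<in> T_proj p \<sigma>"
    unfolding T_proj_def by (rule group.rcos_self[OF group_GF \<sigma> subgroup_T_kernel])
  then have "\<sigma> \<in> T_kernel p E #>\<^bsub>GF\<^esub> g" by (simp only: g(2)) (simp only: T_proj_def)
  then obtain n where n: "n \<in> T_kernel p E" "\<sigma> = n \<otimes>\<^bsub>GF\<^esub> g"
    by (auto simp: r_coset_def)
  then show "\<sigma> \<in> carrier GE"
    using subgroup.m_closed[OF subgroup_GE subsetD[OF T_kernel_subset n(1)] g(1)] by simp
qed (simp add: GE_image_def)

lemma subgroup_GE_image: "subgroup (GE_image p) (T_group p E)"
  unfolding GE_image_def by (rule group_hom.subgroup_img_is_subgroup[OF group_hom_T_proj subgroup_GE])

lemma closedin_GE_image: "closedin (T_topology p E) (GE_image p)"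
proof -
  note B = subfield_set_base_field order_refl base_field_subset_sep_closure
  have \<tau>: "T_topology p E = quotient_topology (krull_topology sep_closure base_field) (T_proj p)"
    by (simp add: T_topology_def abs_galois_topology_def abs_galois_group_def T_proj_def[abs_def])
  have top: "topspace (krull_topology sep_closure base_field) = carrier GF"
    by (rule topspace_krull_topology[OF B])
  have "{x \<in> carrier GF. T_proj p x \<in> T_proj p ` carrier GF - GE_image p} = carrier GF - carrier GE"
    using T_proj_mem_GE_image_iff by auto
  moreover have "openin (krull_topology sep_closure base_field) (carrier GF - carrier GE)"
    unfolding openin_krull_topology_iff[OF B]
  proof (intro conjI ballI)
    fix \<sigma> assume \<sigma>: "\<sigma> \<in> carrier GF - carrier GE"
    then obtain e where e: "e \<in> E" "\<sigma> e \<noteq> e" by (auto simp: mem_galois_group_iff)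
    show "\<exists>D. finite D \<and> D \<subseteq> sep_closure \<and> {\<tau> \<in> carrier GF. \<forall>x\<in>D. \<tau> x = \<sigma> x} \<subseteq> carrier GF - carrier GE"
    proof (intro exI[of _ "{e}"] conjI subsetI)
      fix \<tau> assume "\<tau> \<in> {\<tau> \<in> carrier GF. \<forall>x\<in>{e}. \<tau> x = \<sigma> x}"
      then show "\<tau> \<in> carrier GF - carrier GE" using e galois_group_fixes[of \<tau> sep_closure E e] by auto
    qed (use e E_separable in auto)
  qed simp
  ultimately show ?thesis
    unfolding closedin_def \<tau> topspace_quotient_topology openin_quotient_topology top
    using subset_trans[OF subgroup.subset[OF subgroup_GE_image]] carrier_T_group by auto
qed

lemma GE_image_proper: "GE_image p \<noteq> carrier (T_group p E)"
proof -
  obtain \<tau> where \<tau>: "\<tau> \<in> carrier GF" "\<tau> \<notin> carrier GE" using exists_moving_automorphism by auto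
  then have "T_proj p \<tau> \<notin> GE_image p" "T_proj p \<tau> \<in> carrier (T_group p E)"
    by (simp_all add: T_proj_mem_GE_image_iff carrier_T_group)
  then show ?thesis by auto
qed

text \<open>
  A coset outside the image of \<open>G\<^sub>E\<close> is represented by an \<open>h\<close> that moves something in \<open>E\<close>. Every
  \<open>g \<in> G\<^sub>F\<close> agrees on \<open>E\<close> with a power \<open>u\<close> of \<open>h\<close>, so that \<open>g\<close> is the product of \<open>u\<close> and an element of \<open>G\<^sub>E\<close>.
\<close>
lemma GE_image_maximal:
  assumes H: "subgroup H (T_group p E)" "GE_image p \<subseteq> H" "H \<noteq> GE_image p"
  shows "H = carrier (T_group p E)"
proof
  interpret GF: group GF by (rule group_GF)
  interpret P: group_hom GF "T_group p E" "T_proj p" by (rule group_hom_T_proj)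
  note S = subfield_set_sep_closure and B = base_field_subset_sep_closure
  show "H \<subseteq> carrier (T_group p E)" by (rule subgroup.subset[OF H(1)])
  obtain Y where Y: "Y \<in> H" "Y \<notin> GE_image p" using H(2,3) by auto
  then obtain h where h: "h \<in> carrier GF" "Y = T_proj p h"
    using subgroup.subset[OF H(1)] carrier_T_group by auto
  have hE: "h \<notin> carrier GE" using Y(2) h T_proj_mem_GE_image_iff by auto
  show "carrier (T_group p E) \<subseteq> H"
    unfolding carrier_T_group
  proof (rule image_subsetI)
    fix g assume g: "g \<in> carrier GF"
    obtain k where k: "\<forall>x\<in>E. g x = (h ^^ k) x" using restriction_power[OF h(1) hE g] by auto
    define u where "u = h [^]\<^bsub>GF\<^esub> k"
    have u: "u \<in> carrier GF" using h(1) by (simp add: u_def)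
    define g' where "g' = inv\<^bsub>GF\<^esub> u \<otimes>\<^bsub>GF\<^esub> g"
    have g'F: "g' \<in> carrier GF" using u g by (simp add: g'_def)
    have "g' x = x" if x: "x \<in> E" for x
    proof -
      have xS: "x \<in> sep_closure" using x E_separable by auto
      have "g' x = (inv\<^bsub>GF\<^esub> u) (g x)"
        unfolding g'_def by (rule galois_group_apply_mult[OF GF.inv_closed[OF u] g xS])
      also have "g x = u x" using k x galois_group_apply_pow[OF S B h(1) xS] by (simp add: u_def)
      also have "(inv\<^bsub>GF\<^esub> u) (u x) = x" by (rule galois_group_apply_inv(1)[OF S B u xS])
      finally show ?thesis .
    qed
    then have "g' \<in> carrier GE" using g'F by (simp add: mem_galois_group_iff)
    then have "T_proj p g' \<in> H" using H(2) by (auto simp: GE_image_def)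
    moreover have "T_proj p u \<in> H"
    proof -
      have "T_proj p h [^]\<^bsub>T_group p E\<^esub> i \<in> H" for i :: nat
        using Y(1) h(2) subgroup.m_closed[OF H(1)] subgroup.one_closed[OF H(1)] by (induction i) simp_all
      then show ?thesis using h(1) by (simp add: u_def P.hom_nat_pow)
    qed
    moreover have "g = u \<otimes>\<^bsub>GF\<^esub> g'" using u g by (simp add: g'_def GF.m_assoc[symmetric])
    then have "T_proj p g = T_proj p u \<otimes>\<^bsub>T_group p E\<^esub> T_proj p g'" using u g'F by simp
    ultimately show "T_proj p g \<in> H" using subgroup.m_closed[OF H(1)] by simp
  qed
qed

lemma maximal_closed_subgroup_GE_image: "maximal_closed_subgroup (T_group p E) (T_topology p E) (GE_image p)"
  unfolding maximal_closed_subgroup_def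
proof (intro conjI allI impI)
  fix H assume "subgroup H (T_group p E) \<and> closedin (T_topology p E) H \<and> GE_image p \<subseteq> H"
  then show "H = GE_image p \<or> H = carrier (T_group p E)" using GE_image_maximal[of H p] by (elim conjE) (cases "H = GE_image p", simp_all)
qed (rule subgroup_GE_image closedin_GE_image GE_image_proper)+

lemma nat_pow_restrict_T_group:
  "x [^]\<^bsub>(T_group p E)\<lparr>carrier := M\<rparr>\<^esub> (n::nat) = x [^]\<^bsub>T_group p E\<^esub> n"
  by (rule monoid.nat_pow_consistent[symmetric])
    (rule group.is_monoid[OF group_hom.axioms(2)[OF group_hom_T_proj]])

lemma elementary_abelian_GE_image: "elementary_abelian p ((T_group p E)\<lparr>carrier := GE_image p\<rparr>)"
proof -
  interpret GF: group GF by (rule group_GF)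
  interpret P: group_hom GF "T_group p E" "T_proj p" by (rule group_hom_T_proj)
  have pow: "x [^]\<^bsub>T_group p E\<^esub> p = \<one>\<^bsub>T_group p E\<^esub>" if x: "x \<in> GE_image p" for x
  proof -
    obtain g where g: "g \<in> carrier GE" "x = T_proj p g" using x unfolding GE_image_def by (rule imageE)
    have gF: "g \<in> carrier GF" using g(1) GE_subset_GF by auto
    have "g [^]\<^bsub>GF\<^esub> p \<in> T_kernel p E" using pow_mem_T_kernel[OF g(1)] by (simp add: GE_pow)
    then have "T_proj p (g [^]\<^bsub>GF\<^esub> p) = \<one>\<^bsub>T_group p E\<^esub>"
      using T_proj_eq_one_iff[of "g [^]\<^bsub>GF\<^esub> p" p] gF by simp
    then show ?thesis using gF g(2) by (simp add: P.hom_nat_pow)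
  qed
  have comm: "x \<otimes>\<^bsub>T_group p E\<^esub> y = y \<otimes>\<^bsub>T_group p E\<^esub> x" if x: "x \<in> GE_image p" and y: "y \<in> GE_image p" for x y
  proof -
    obtain g where g: "g \<in> carrier GE" "x = T_proj p g" using x unfolding GE_image_def by (rule imageE)
    obtain h where h: "h \<in> carrier GE" "y = T_proj p h" using y unfolding GE_image_def by (rule imageE)
    have gF: "g \<in> carrier GF" and hF: "h \<in> carrier GF" using g(1) h(1) GE_subset_GF by auto
    let ?c = "g \<otimes>\<^bsub>GF\<^esub> h \<otimes>\<^bsub>GF\<^esub> inv\<^bsub>GF\<^esub> g \<otimes>\<^bsub>GF\<^esub> inv\<^bsub>GF\<^esub> h"
    have cF: "?c \<in> carrier GF" using gF hF by simp
    have "?c \<in> T_kernel p E"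
      using commutator_mem_T_kernel[OF g(1) h(1)] by (simp add: GE_mult GE_inv g(1) h(1))
    then have c1: "T_proj p ?c = \<one>\<^bsub>T_group p E\<^esub>" using T_proj_eq_one_iff[OF cF] by simp
    have "?c \<otimes>\<^bsub>GF\<^esub> (h \<otimes>\<^bsub>GF\<^esub> g) = g \<otimes>\<^bsub>GF\<^esub> h \<otimes>\<^bsub>GF\<^esub> inv\<^bsub>GF\<^esub> g \<otimes>\<^bsub>GF\<^esub> ((inv\<^bsub>GF\<^esub> h \<otimes>\<^bsub>GF\<^esub> h) \<otimes>\<^bsub>GF\<^esub> g)"
      using gF hF by (simp only: GF.m_assoc GF.m_closed GF.inv_closed)
    also have "\<dots> = g \<otimes>\<^bsub>GF\<^esub> h" using gF hF by (simp add: GF.m_assoc)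
    finally have "T_proj p (g \<otimes>\<^bsub>GF\<^esub> h) = T_proj p ?c \<otimes>\<^bsub>T_group p E\<^esub> T_proj p (h \<otimes>\<^bsub>GF\<^esub> g)"
      using cF gF hF P.hom_mult[of ?c "h \<otimes>\<^bsub>GF\<^esub> g"] by simp
    then show ?thesis using c1 gF hF g(2) h(2) by simp
  qed
  have grp: "group ((T_group p E)\<lparr>carrier := GE_image p\<rparr>)"
    by (rule subgroup.subgroup_is_group[OF subgroup_GE_image P.H.is_group])
  show ?thesis
    unfolding elementary_abelian_def
  proof (intro conjI ballI)
    show "comm_group ((T_group p E)\<lparr>carrier := GE_image p\<rparr>)"
      by (rule group.group_comm_groupI[OF grp]) (simp add: comm)
  qed (simp add: nat_pow_restrict_T_group pow)
qed

text \<open>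
  An element of exponent \<open>p\<close> in \<open>T\<close> is represented by a \<open>\<tau>\<close> whose \<open>p\<close>-th power lies in the kernel.
\<close>
lemma elementary_abelian_subset_GE_image:
  assumes lift: "\<And>\<tau>. \<tau> \<in> carrier GF \<Longrightarrow> \<tau> [^]\<^bsub>GF\<^esub> p \<in> T_kernel p E \<Longrightarrow> \<tau> \<in> carrier GE"
    and M: "subgroup M (T_group p E)" "elementary_abelian p ((T_group p E)\<lparr>carrier := M\<rparr>)"
  shows "M \<subseteq> GE_image p"
proof
  interpret GF: group GF by (rule group_GF)
  interpret P: group_hom GF "T_group p E" "T_proj p" by (rule group_hom_T_proj)
  fix Y assume Y: "Y \<in> M"
  then obtain \<tau> where \<tau>: "\<tau> \<in> carrier GF" "Y = T_proj p \<tau>"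
    using subgroup.subset[OF M(1)] carrier_T_group by auto
  have "Y [^]\<^bsub>T_group p E\<^esub> p = \<one>\<^bsub>T_group p E\<^esub>"
    using M(2) Y by (simp add: elementary_abelian_def nat_pow_restrict_T_group)
  then have "T_proj p (\<tau> [^]\<^bsub>GF\<^esub> p) = \<one>\<^bsub>T_group p E\<^esub>"
    using \<tau> by (simp add: P.hom_nat_pow)
  then have "\<tau> [^]\<^bsub>GF\<^esub> p \<in> T_kernel p E" using \<tau>(1) T_proj_eq_one_iff by simp
  then have "\<tau> \<in> carrier GE" by (rule lift[OF \<tau>(1)])
  then show "Y \<in> GE_image p" using \<tau>(2) by (simp add: GE_image_def)
qed

end

theorem corollaryA3:
  fixes p :: nat and E :: "'a::field alg_closure set"
  assumes "Factorial_Ring.prime p" and "p > 2"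
    and "(\<exists>\<zeta>::'a. \<zeta> ^ p = 1 \<and> (\<forall>k. 0 < k \<and> k < p \<longrightarrow> \<zeta> ^ k \<noteq> 1)) \<or> CHAR('a) = p"
    and "cyclic_extension p E base_field"
  shows "\<exists>!M. maximal_closed_subgroup (T_group p E) (T_topology p E) M \<and>
              elementary_abelian p ((T_group p E)\<lparr>carrier := M\<rparr>)"
proof -
  interpret prime_galois_extension E
    by (rule prime_galois_extensionI[OF assms(1,4)])
  have lift: "\<tau> \<in> carrier GE" if "\<tau> \<in> carrier GF" "\<tau> [^]\<^bsub>GF\<^esub> p \<in> T_kernel p E" for \<tau>
    using assms(3)
  proof
    assume "\<exists>\<zeta>::'a. \<zeta> ^ p = 1 \<and> (\<forall>k. 0 < k \<and> k < p \<longrightarrow> \<zeta> ^ k \<noteq> 1)"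
    then obtain \<zeta> :: 'a where "\<zeta> ^ p = 1" "\<And>k. 0 < k \<Longrightarrow> k < p \<Longrightarrow> \<zeta> ^ k \<noteq> 1" by auto
    then show ?thesis by (rule no_lift_of_prime_order_kummer[OF assms(1,2) _ _ that])
  next
    assume "CHAR('a) = p"
    then show ?thesis by (rule no_lift_of_prime_order_artin_schreier[OF assms(1) _ that])
  qed
  show ?thesis
  proof (rule ex1I[of _ "GE_image p"])
    show "maximal_closed_subgroup (T_group p E) (T_topology p E) (GE_image p) \<and>
        elementary_abelian p ((T_group p E)\<lparr>carrier := GE_image p\<rparr>)"
      using maximal_closed_subgroup_GE_image elementary_abelian_GE_image by simp
    fix M assume M: "maximal_closed_subgroup (T_group p E) (T_topology p E) M \<and>
        elementary_abelian p ((T_group p E)\<lparr>carrier := M\<rparr>)"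
    then have "M \<subseteq> GE_image p"
      by (intro elementary_abelian_subset_GE_image lift) (simp_all add: maximal_closed_subgroup_def)
    moreover have "\<forall>H. subgroup H (T_group p E) \<and> closedin (T_topology p E) H \<and> M \<subseteq> H \<longrightarrow>
        H = M \<or> H = carrier (T_group p E)"
      using M unfolding maximal_closed_subgroup_def by (elim conjE)
    ultimately have "GE_image p = M \<or> GE_image p = carrier (T_group p E)"
      using subgroup_GE_image closedin_GE_image by simp
    then show "M = GE_image p" using GE_image_proper by simp
  qed
qed

end
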